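(* Let $\omega$ be an open strict interval of $\mathbb T$, let $T>0$, and let $f_0\in H^2\cap W^{1/2,2}(\mathbb T)$. Then $f_0\in \mathcal{NC}_{H^2}(\omega,T)$ if and only if there exists $g\in L^2(\mathbb T)$ such that (1) $\operatorname{supp} g \subset \overline\omega$; (2) $g\in W^{1/2,2}(\mathbb T)$; (3) $f_0 = P_+g$.
   Context: $\mathbb T$ is the complex unit circle, identified with $\mathbb R/2\pi\mathbb Z$ via $x\mapsto e^{ix}$. An open strict interval of $\mathbb T$ is an open arc $\{e^{ix}:a<x<b\}$ with $0<b-a<2\pi$; $\overline\omega$ is its topological closure. Functions are complex valued; $f\in L^2(\mathbb T)$ is written $f(e^{ix})=\sum_{n\in\mathbb Z}\widehat f(n)e^{inx}$. $W^{1/2,2}(\mathbb T)$ is the fractional Sobolev space, i.e. the set of $f\in L^2(\mathbb T)$ with $\sum_{n}|n|\,|\widehat f(n)|^2<\infty$. The Riesz projector is $P_+f(e^{ix})=\sum_{n\ge 0}\widehat f(n)e^{inx}$, and $H^2=P_+L^2(\mathbb T)$. Let $S(t)f(e^{ix})=\sum_{n}\widehat f(n)e^{-|n|t}e^{inx}$ (the semigroup generated by $-|D|$, $|D|f=\sum_n|n|\widehat f(n)e^{inx}$). The $H^2$ control system is $(\partial_t+|D|)f(t,e^{ix})=P_+\mathbf 1_\omega u(t,e^{ix})$, $f(0,\cdot)=f_0\in H^2$, with control $u\in L^2([0,T]\times\omega)$; its solution satisfies $f(T,\cdot)=S(T)f_0+\int_0^TS(T-s)P_+(\mathbf 1_\omega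 u(s,\cdot))\,ds$, where $\mathbf 1_\omega u$ denotes the extension of $u$ by $0$ outside $\omega$. $\mathcal{NC}_{H^2}(\omega,T)$ is the set of $f_0\in H^2$ for which there is $u\in L^2([0,T]\times\omega)$ with $f(T,\cdot)=0$. (This set does not depend on $T>0$.) *)

theory Defs
  imports "HOL-Analysis.Analysis"
begin

text \<open>
  The circle is \<^term>\<open>sphere (0::complex) 1\<close>, with the arc length measure \<open>dx\<close> (total mass
  \<open>2\<pi>\<close>) transported by \<open>x \<mapsto> e\<^sup>i\<^sup>x\<close>. Elements of an \<open>L\<^sup>2\<close> space are represented by
  square-integrable functions, so equality in \<open>L\<^sup>2\<close> is equality almost everywhere. Taking
  Borel representatives on the circle loses no classes.
\<close>

definition circle :: "complex measure" where
  "circle = distr (lebesgue_on {0..<2*pi}) (restrict_space borel (sphere 0 1)) cis"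

definition L2 :: "'a measure \<Rightarrow> ('a \<Rightarrow> complex) set" where
  "L2 M = {f \<in> borel_measurable M. integrable M (\<lambda>x. (cmod (f x))\<^sup>2)}"

definition L2_norm :: "'a measure \<Rightarrow> ('a \<Rightarrow> complex) \<Rightarrow> real" where
  "L2_norm M f = sqrt (\<integral>x. (cmod (f x))\<^sup>2 \<partial>M)"

definition open_strict_interval :: "complex set \<Rightarrow> bool" where
  "open_strict_interval \<omega> \<longleftrightarrow>
     (\<exists>a b::real. 0 < b - a \<and> b - a < 2*pi \<and> \<omega> = cis ` {a<..<b})"

definition fourier_coeff :: "(complex \<Rightarrow> complex) \<Rightarrow> int \<Rightarrow> complex" where
  "fourier_coeff f n = (1 / (2*pi)) * (\<integral>z. f z * z powi (-n) \<partial>circle)"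

text \<open>
  A representative of the \<open>L\<^sup>2\<close>-sum \<open>\<Sum>\<^sub>n c\<^sub>n e\<^sup>i\<^sup>n\<^sup>x\<close>, which exists and is unique up to
  null sets when \<open>c\<close> is square-summable; unspecified otherwise.
\<close>

definition fourier_sum :: "(int \<Rightarrow> complex) \<Rightarrow> complex \<Rightarrow> complex" where
  "fourier_sum c = (SOME f. f \<in> L2 circle \<and>
     ((\<lambda>A. L2_norm circle (\<lambda>z. f z - (\<Sum>n\<in>A. c n * z powi n))) \<longlongrightarrow> 0)
       (finite_subsets_at_top UNIV))"

definition sobolev_half :: "(complex \<Rightarrow> complex) set" where
  "sobolev_half = {f \<in> L2 circle.
     (\<lambda>n::int. real_of_int \<bar>n\<bar> * (cmod (fourier_coeff f n))\<^sup>2) summable_on UNIV}"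

definition riesz_proj :: "(complex \<Rightarrow> complex) \<Rightarrow> complex \<Rightarrow> complex" where
  "riesz_proj f = fourier_sum (\<lambda>n. if n \<ge> 0 then fourier_coeff f n else 0)"

definition H2 :: "(complex \<Rightarrow> complex) set" where
  "H2 = {f \<in> L2 circle. \<exists>g\<in>L2 circle. AE z in circle. f z = riesz_proj g z}"

definition absD_semigroup :: "real \<Rightarrow> (complex \<Rightarrow> complex) \<Rightarrow> complex \<Rightarrow> complex" where
  "absD_semigroup t f =
     fourier_sum (\<lambda>n. complex_of_real (exp (- real_of_int \<bar>n\<bar> * t)) * fourier_coeff f n)"

text \<open>
  The support of an \<open>L\<^sup>2\<close> class: the complement in the circle of the largest open set on which
  \<open>g\<close> vanishes almost everywhere.
\<close>

definition ess_support :: "(complex \<Rightarrow> complex) \<Rightarrow> complex set" where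
  "ess_support g = {z \<in> sphere 0 1.
     \<forall>U. open U \<and> z \<in> U \<longrightarrow> \<not> (AE w in circle. w \<in> U \<longrightarrow> g w = 0)}"

text \<open>
  \<open>F = \<integral> G(s) dM(s)\<close> as a Bochner integral with values in \<open>L\<^sup>2\<close> of the circle. This
  \<open>L\<^sup>2\<close> is not a type, so \<^term>\<open>has_bochner_integral\<close> does not apply; as there, simple
  functions \<open>\<Sum>\<^sub>j 1\<^bsub>E k j\<^esub>(s) h k j\<close> tend to \<open>G\<close> in \<open>L\<^sup>1\<close> of \<open>M\<close> and their integrals tend
  to \<open>F\<close>.
\<close>

definition has_L2_bochner_integral ::
    "'s measure \<Rightarrow> ('s \<Rightarrow> complex \<Rightarrow> complex) \<Rightarrow> (complex \<Rightarrow> complex) \<Rightarrow> bool" where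
  "has_L2_bochner_integral M G F \<longleftrightarrow>
     F \<in> L2 circle \<and> (AE s in M. G s \<in> L2 circle) \<and>
     (\<exists>(m :: nat \<Rightarrow> nat) (E :: nat \<Rightarrow> nat \<Rightarrow> 's set) (h :: nat \<Rightarrow> nat \<Rightarrow> complex \<Rightarrow> complex).
        (\<forall>k. \<forall>j<m k. E k j \<in> sets M \<and> emeasure M (E k j) < \<infinity> \<and> h k j \<in> L2 circle) \<and>
        (\<forall>k. integrable M
           (\<lambda>s. L2_norm circle (\<lambda>z. G s z - (\<Sum>j<m k. indicator (E k j) s * h k j z)))) \<and>
        (\<lambda>k. \<integral>s. L2_norm circle (\<lambda>z. G s z - (\<Sum>j<m k. indicator (E k j) s * h k j z)) \<partial>M)
          \<longlonglongrightarrow> 0 \<and>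
        (\<lambda>k. L2_norm circle
           (\<lambda>z. F z - (\<Sum>j<m k. complex_of_real (measure M (E k j)) * h k j z))) \<longlonglongrightarrow> 0)"

definition controls :: "complex set \<Rightarrow> real \<Rightarrow> (real \<times> complex \<Rightarrow> complex) set" where
  "controls \<omega> T = L2 (lebesgue_on {0..T} \<Otimes>\<^sub>M restrict_space circle \<omega>)"

text \<open>\<open>F\<close> is the state at time \<open>T\<close> of the (mild) solution of the \<open>H\<^sup>2\<close> control system.\<close>

definition H2_final_state :: "complex set \<Rightarrow> real \<Rightarrow> (complex \<Rightarrow> complex) \<Rightarrow>
    (real \<times> complex \<Rightarrow> complex) \<Rightarrow> (complex \<Rightarrow> complex) \<Rightarrow> bool" where
  "H2_final_state \<omega> T f\<^sub>0 u F \<longleftrightarrow>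
     (\<exists>D. has_L2_bochner_integral (lebesgue_on {0..T})
            (\<lambda>s. absD_semigroup (T - s) (riesz_proj (\<lambda>z. if z \<in> \<omega> then u (s, z) else 0))) D \<and>
          (AE z in circle. F z = absD_semigroup T f\<^sub>0 z + D z))"

definition NC_H2 :: "complex set \<Rightarrow> real \<Rightarrow> (complex \<Rightarrow> complex) set" where
  "NC_H2 \<omega> T = {f\<^sub>0 \<in> H2. \<exists>u \<in> controls \<omega> T. H2_final_state \<omega> T f\<^sub>0 u (\<lambda>z. 0)}"

end

theory Submission
  imports Defs "HOL-Complex_Analysis.Complex_Analysis"
begin

text \<open>
  Put \<open>c\<^sub>n = -(2\<pi>)\<^sup>-\<^sup>1 \<integral>\<integral> u(s, x) e\<^sup>n\<^sup>(\<^sup>s\<^sup>-\<^sup>i\<^sup>x\<^sup>) dx ds\<close>, the integral being over \<open>[0, T] \<times> \<omega>\<close>. In Fourier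
  coefficients, \<open>u\<close> steers \<open>f\<^sub>0\<close> to \<open>0\<close> if and only if \<open>f\<^sub>0\<close> has the coefficients \<open>c\<^sub>n\<close> for
  all \<open>n \<ge> 0\<close>.

  Given such a control, let \<open>g\<close> be the function with the coefficients \<open>c\<^sub>n\<close> for all integers
  \<open>n\<close>. For \<open>n < 0\<close> the exponential decays and the Cauchy-Schwarz inequality bounds \<open>|n| |c\<^sub>n|\<^sup>2\<close>.
  The series \<open>\<Sum> c\<^sub>n z\<^sup>n\<close> over \<open>n \<ge> 0\<close> and over \<open>n < 0\<close> are, up to sign, the same Cauchy integral
  of \<open>u\<close>, once inside and once outside the disc. It is holomorphic off the annular sector
  \<open>{e\<^sup>-\<^sup>s w | 0 \<le> s \<le> T, w \<in> closure \<omega>}\<close>, so it has no jump across the circle away from \<open>closure \<omega>\<close>,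
  and \<open>g\<close> vanishes there.

  Conversely, extend \<open>g\<close> to \<open>G(s, x)\<close> with \<open>G(0, x) = g(x)\<close>, \<open>G = 0\<close> for large \<open>s\<close>, and all
  \<open>G(s, \<cdot>)\<close> supported in \<open>closure \<omega>\<close>. As \<open>(\<partial>\<^sub>s - i\<partial>\<^sub>x) e\<^sup>n\<^sup>(\<^sup>s\<^sup>-\<^sup>i\<^sup>x\<^sup>) = 0\<close>, the control
  \<open>u = (\<partial>\<^sub>s - i\<partial>\<^sub>x) G\<close> has the moments \<open>c\<^sub>n\<close> equal to the coefficients of \<open>g\<close>. Averages of \<open>g\<close> over \<open>[x - s, x]\<close> or
  \<open>[x, x + s]\<close> give \<open>G\<close>; a cut-off splits \<open>g\<close> into two parts, each of which is averaged away from
  the end point of \<open>\<omega>\<close> that it touches.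
\<close>

text \<open>The system sees only the frequencies n >= 0; the negative coefficients of
  \<open>g\<close> are the freedom that a control fixes. In the first direction the obstacle is that
  the moments sum to the Cauchy integral only for |z| < exp(-T), below the poles. As they are
  coefficients of a square-integrable function, they are bounded and their power series converges in
  the whole disc. The disc without the sector is starlike about 0, so the identity theorem carries
  the equality up to the circle, where Abel means stand in for boundary values. In the other
  direction the control is a first derivative of an extension of \<open>g\<close>, and half a
  derivative of \<open>g\<close> is what makes it square-integrable, as in the trace theorem.
  Averages over windows of length s have energy of order |n| |c_n|^2 at frequency n and move the
  support by at most s, to one side. The cut-off is a product, hence a convolution of coefficients;
  so regularity is there measured by difference quotients instead.\<close>

section \<open>The circle and its Fourier coefficients\<close>

lemma space_circle [simp]: "space circle = sphere 0 1"
  by (simp add: circle_def space_restrict_space)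

lemma sets_circle: "sets circle = sets (restrict_space borel (sphere 0 1))"
  by (simp add: circle_def)

lemma measurable_circle_cong: "measurable circle N = measurable (restrict_space borel (sphere 0 1)) N"
  by (rule measurable_cong_sets) (simp_all add: sets_circle)

lemma measurable_to_circle:
  assumes "f \<in> borel_measurable M" "\<And>x. x \<in> space M \<Longrightarrow> cmod (f x) = 1"
  shows "f \<in> measurable M circle"
proof -
  have "f \<in> measurable M (restrict_space borel (sphere 0 1))"
    using assms by (intro measurable_restrict_space2) auto
  then show ?thesis by (simp add: measurable_cong_sets[OF refl sets_circle])
qed

lemma borel_measurable_circleI:
  "f \<in> borel_measurable borel \<Longrightarrow> f \<in> borel_measurable circle"
  unfolding measurable_circle_cong by (rule measurable_restrict_space1)

lemma continuous_imp_measurable_circle: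
  fixes f :: "complex \<Rightarrow> 'b::topological_space"
  assumes "continuous_on (sphere 0 1) f" shows "f \<in> borel_measurable circle"
  unfolding measurable_circle_cong using assms by (rule borel_measurable_continuous_on_restrict)

lemma cis_measurable [measurable]: "cis \<in> borel_measurable borel"
  by (intro borel_measurable_continuous_onI continuous_intros)

lemma cis_measurable_circle [measurable]: "cis \<in> measurable borel circle"
  by (rule measurable_to_circle) auto

lemma id_measurable_circle [measurable]: "(\<lambda>z. z) \<in> borel_measurable circle"
  by (rule borel_measurable_circleI) simp

lemma mult_cis_measurable_circle [measurable]:
  assumes "f \<in> measurable M circle" "r \<in> borel_measurable M"
  shows "(\<lambda>x. f x * cis (r x)) \<in> measurable M circle"
proof (rule measurable_to_circle)
  have "f \<in> borel_measurable M"
    using measurable_compose[OF assms(1) id_measurable_circle] by simp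
  then show "(\<lambda>x. f x * cis (r x)) \<in> borel_measurable M"
    using assms(2) by measurable
  show "cmod (f x * cis (r x)) = 1" if "x \<in> space M" for x
    using measurable_space[OF assms(1) that] by (simp add: norm_mult)
qed

section \<open>Integration in the angle variable and invariance under rotation\<close>

lemma nn_integral_circle:
  assumes [measurable]: "f \<in> borel_measurable circle"
  shows "(\<integral>\<^sup>+z. f z \<partial>circle) = (\<integral>\<^sup>+x. f (cis x) * indicator {0..<2*pi} x \<partial>lborel)"
proof -
  have c: "cis \<in> measurable (lebesgue_on {0..<2*pi}) (restrict_space borel (sphere 0 1))"
    by (intro measurable_restrict_space1 measurable_restrict_space2 measurable_completion) auto
  have "(\<integral>\<^sup>+z. f z \<partial>circle) = (\<integral>\<^sup>+x. f (cis x) \<partial>lebesgue_on {0..<2*pi})"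
    unfolding circle_def by (rule nn_integral_distr[OF c assms[unfolded circle_def]])
  also have "\<dots> = (\<integral>\<^sup>+x. f (cis x) * indicator {0..<2*pi} x \<partial>lebesgue)"
    by (rule nn_integral_restrict_space) simp
  also have "\<dots> = (\<integral>\<^sup>+x. f (cis x) * indicator {0..<2*pi} x \<partial>lborel)"
    by (rule nn_integral_completion)
  finally show ?thesis .
qed

text \<open>Whole periods bring the left end \<open>a\<close> to a point \<open>t\<close> of [0, 2
  pi). The part of the window beyond 2 pi is then a translate of [0, t), which completes [t, 2
  pi).\<close>

lemma nn_integral_periodic:
  fixes F :: "real \<Rightarrow> ennreal"
  assumes [measurable]: "F \<in> borel_measurable borel" and per: "\<And>x. F (x + 2*pi) = F x"
  shows "(\<integral>\<^sup>+x. F x * indicator {a..<a + 2*pi} x \<partial>lborel) = (\<integral>\<^sup>+x. F x * indicator {0..<2*pi} x \<partial>lborel)"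
proof -
  interpret periodic_fun_simple F "2*pi" by standard (rule per)
  define k where "k = \<lfloor>a / (2*pi)\<rfloor>"
  define t where "t = a - of_int k * (2*pi)"
  have "of_int k \<le> a / (2*pi)" "a / (2*pi) < of_int k + 1" by (auto simp: k_def)
  then have t: "0 \<le> t" "t < 2*pi"
    by (auto simp: t_def field_simps)
  have shift: "(\<integral>\<^sup>+x. F x * indicator {b + of_int j * (2*pi)..<c + of_int j * (2*pi)} x \<partial>lborel)
      = (\<integral>\<^sup>+x. F x * indicator {b..<c} x \<partial>lborel)" for b c and j :: int
  proof -
    have "F (of_int j * (2*pi) + x) = F x" for x
      using plus_of_int[of x j] by (simp add: add.commute)
    then show ?thesis
      by (subst nn_integral_real_affine[where c=1 and t="of_int j * (2*pi)"])
         (auto intro!: nn_integral_cong split: split_indicator)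
  qed
  have "(\<integral>\<^sup>+x. F x * indicator {a..<a + 2*pi} x \<partial>lborel) = (\<integral>\<^sup>+x. F x * indicator {t..<t + 2*pi} x \<partial>lborel)"
    using shift[of t k "t + 2*pi"] by (simp add: t_def algebra_simps)
  also have "\<dots> = (\<integral>\<^sup>+x. F x * indicator {t..<2*pi} x + F x * indicator {2*pi..<t+2*pi} x \<partial>lborel)"
    using t by (intro nn_integral_cong) (auto split: split_indicator)
  also have "\<dots> = (\<integral>\<^sup>+x. F x * indicator {t..<2*pi} x \<partial>lborel) + (\<integral>\<^sup>+x. F x * indicator {2*pi..<t+2*pi} x \<partial>lborel)"
    by (rule nn_integral_add) auto
  also have "(\<integral>\<^sup>+x. F x * indicator {2*pi..<t+2*pi} x \<partial>lborel) = (\<integral>\<^sup>+x. F x * indicator {0..<t} x \<partial>lborel)"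
    using shift[of 0 1 t] by simp
  also have "(\<integral>\<^sup>+x. F x * indicator {t..<2*pi} x \<partial>lborel) + (\<integral>\<^sup>+x. F x * indicator {0..<t} x \<partial>lborel)
     = (\<integral>\<^sup>+x. F x * indicator {t..<2*pi} x + F x * indicator {0..<t} x \<partial>lborel)"
    by (rule nn_integral_add[symmetric]) auto
  also have "\<dots> = (\<integral>\<^sup>+x. F x * indicator {0..<2*pi} x \<partial>lborel)"
    using t by (intro nn_integral_cong) (auto split: split_indicator)
  finally show ?thesis .
qed

lemma nn_integral_circle_affine:
  assumes [measurable]: "f \<in> borel_measurable circle" and c: "c = 1 \<or> c = -1"
  shows "(\<integral>\<^sup>+x. f (cis (t + c * x)) * indicator {0..<2*pi} x \<partial>lborel) = (\<integral>\<^sup>+z. f z \<partial>circle)"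
  using c
proof
  assume c: "c = 1"
  have "(\<integral>\<^sup>+x. f (cis x) * indicator {t..<t + 2*pi} x \<partial>lborel) = (\<integral>\<^sup>+z. f z \<partial>circle)"
    by (subst nn_integral_periodic) (auto simp: nn_integral_circle cis_mult[symmetric])
  moreover have "(\<integral>\<^sup>+x. f (cis x) * indicator {t..<t + 2*pi} x \<partial>lborel)
    = (\<integral>\<^sup>+x. f (cis (t + c * x)) * indicator {0..<2*pi} x \<partial>lborel)"
    by (subst nn_integral_real_affine[where c=1 and t=t])
       (auto intro!: nn_integral_cong simp: c split: split_indicator)
  ultimately show ?thesis by simp
next
  assume c: "c = -1"
  have "(\<integral>\<^sup>+x. f (cis x) * indicator {t-2*pi..<t-2*pi + 2*pi} x \<partial>lborel) = (\<integral>\<^sup>+z. f z \<partial>circle)"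
    by (subst nn_integral_periodic) (auto simp: nn_integral_circle cis_mult[symmetric])
  moreover have "(\<integral>\<^sup>+x. f (cis x) * indicator {t-2*pi..<t-2*pi + 2*pi} x \<partial>lborel)
    = (\<integral>\<^sup>+x. f (cis (t + c * x)) * indicator {0<..2*pi} x \<partial>lborel)"
    by (subst nn_integral_real_affine[where c="-1" and t=t])
       (auto intro!: nn_integral_cong simp: c split: split_indicator)
  \<comment> \<open>The reflection exchanges the open and the closed end of the interval; this
    changes the integrand at two points only.\<close>
  moreover have "(\<integral>\<^sup>+x. f (cis (t + c * x)) * indicator {0<..2*pi} x \<partial>lborel)
      = (\<integral>\<^sup>+x. f (cis (t + c * x)) * indicator {0..<2*pi} x \<partial>lborel)"
  proof (rule nn_integral_cong_AE)
    have "AE x in lborel. x \<noteq> (0::real)" "AE x in lborel. x \<noteq> 2*pi" by (rule AE_lborel_singleton)+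
    then show "AE x in lborel. f (cis (t + c * x)) * indicator {0<..2*pi} x = f (cis (t + c * x)) * indicator {0..<2*pi} x"
      by eventually_elim (auto split: split_indicator)
  qed
  ultimately show ?thesis by simp
qed

lemma distr_circle_rotate: "distr circle circle (\<lambda>z. z * cis h) = circle"
proof (rule measure_eqI)
  fix A assume "A \<in> sets (distr circle circle (\<lambda>z. z * cis h))"
  then have A[measurable]: "A \<in> sets circle" by simp
  have "emeasure (distr circle circle (\<lambda>z. z * cis h)) A = (\<integral>\<^sup>+z. indicator A z \<partial>distr circle circle (\<lambda>z. z * cis h))"
    by simp
  also have "\<dots> = (\<integral>\<^sup>+z. indicator A (z * cis h) \<partial>circle)"
    by (rule nn_integral_distr) measurable
  also have "\<dots> = (\<integral>\<^sup>+x. indicator A (cis x * cis h) * indicator {0..<2*pi} x \<partial>lborel)"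
    by (rule nn_integral_circle) measurable
  also have "\<dots> = (\<integral>\<^sup>+x. indicator A (cis (h + 1 * x)) * indicator {0..<2*pi} x \<partial>lborel)"
    by (simp add: cis_mult add.commute)
  also have "\<dots> = emeasure circle A"
    by (subst nn_integral_circle_affine) auto
  finally show "emeasure (distr circle circle (\<lambda>z. z * cis h)) A = emeasure circle A" .
qed simp

lemma integral_circle_rotate:
  fixes f :: "complex \<Rightarrow> 'b::{banach, second_countable_topology}"
  assumes [measurable]: "f \<in> borel_measurable circle"
  shows "(\<integral>z. f (z * cis h) \<partial>circle) = (\<integral>z. f z \<partial>circle)"
proof -
  have "(\<integral>z. f z \<partial>circle) = (\<integral>z. f z \<partial>distr circle circle (\<lambda>z. z * cis h))"
    by (simp add: distr_circle_rotate)
  also have "\<dots> = (\<integral>z. f (z * cis h) \<partial>circle)"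
    by (rule integral_distr) measurable
  finally show ?thesis by simp
qed

lemma nn_integral_circle_rotate:
  assumes [measurable]: "f \<in> borel_measurable circle"
  shows "(\<integral>\<^sup>+z. f (z * cis h) \<partial>circle) = (\<integral>\<^sup>+z. f z \<partial>circle)"
proof -
  have "(\<integral>\<^sup>+z. f z \<partial>circle) = (\<integral>\<^sup>+z. f z \<partial>distr circle circle (\<lambda>z. z * cis h))"
    by (simp add: distr_circle_rotate)
  also have "\<dots> = (\<integral>\<^sup>+z. f (z * cis h) \<partial>circle)"
    by (rule nn_integral_distr) measurable
  finally show ?thesis by simp
qed

lemma emeasure_circle: "emeasure circle (sphere 0 1) = ennreal (2*pi)"
proof -
  have "emeasure circle (sphere 0 1) = (\<integral>\<^sup>+z. 1 \<partial>circle)" by (simp flip: space_circle)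
  also have "\<dots> = emeasure lborel {0..<2*pi}" by (subst nn_integral_circle) simp_all
  finally show ?thesis by simp
qed

lemma finite_measure_circle: "finite_measure circle"
  by standard (simp add: emeasure_circle)

interpretation circle: finite_measure circle by (rule finite_measure_circle)

lemma measure_circle: "measure circle (sphere 0 1) = 2*pi"
  by (simp add: measure_def emeasure_circle)

lemma powi_measurable_circle [measurable]: "(\<lambda>z. z powi n) \<in> borel_measurable circle"
  by (rule continuous_imp_measurable_circle) (auto intro!: continuous_intros)

lemma cmod_powi_circle: "cmod z = 1 \<Longrightarrow> cmod (z powi n) = 1"
  by (simp add: norm_power_int)

text \<open>The rotation by \<open>\<pi> / n\<close> multiplies the integral by \<open>-1\<close>.\<close>

lemma integral_powi_circle: "(\<integral>z. z powi n \<partial>circle) = (if n = 0 then 2*pi else 0)"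
proof (cases "n = 0")
  case True
  then show ?thesis by (simp add: measure_circle scaleR_conv_of_real)
next
  case False
  define h where "h = pi / of_int n"
  have "(\<integral>z. z powi n \<partial>circle) = (\<integral>z. (z * cis h) powi n \<partial>circle)"
    by (rule integral_circle_rotate[symmetric]) measurable
  also have "\<dots> = (\<integral>z. z powi n * cis pi \<partial>circle)"
    using False by (simp add: power_int_mult_distrib cis_power_int h_def)
  also have "\<dots> = - (\<integral>z. z powi n \<partial>circle)" by simp
  finally show ?thesis using False by simp
qed

lemma powi_uminus_circle:
  assumes "cmod z = 1" shows "z powi (-n) = cnj (z powi n)"
proof -
  have "z powi n * cnj (z powi n) = 1"
    using cmod_powi_circle[OF assms, of n] complex_norm_square[of "z powi n"] by simp
  then show ?thesis by (metis inverse_unique power_int_minus)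
qed

section \<open>Square-integrable functions\<close>

lemma L2D:
  assumes "f \<in> L2 M"
  shows "f \<in> borel_measurable M" "integrable M (\<lambda>x. (cmod (f x))\<^sup>2)"
  using assms by (auto simp: L2_def)

lemma cmod_add_square_le: "(cmod (a + b))\<^sup>2 \<le> 2 * (cmod a)\<^sup>2 + 2 * (cmod b)\<^sup>2"
proof -
  have "(cmod (a + b))\<^sup>2 \<le> (cmod a + cmod b)\<^sup>2" by (intro power_mono norm_triangle_ineq) simp
  also have "\<dots> \<le> 2 * (cmod a)\<^sup>2 + 2 * (cmod b)\<^sup>2" using sum_squares_bound[of "cmod a" "cmod b"] by (simp add: power2_sum)
  finally show ?thesis .
qed

lemma L2_add:
  assumes f: "f \<in> L2 M" and g: "g \<in> L2 M" shows "(\<lambda>x. f x + g x) \<in> L2 M"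
proof -
  note [measurable] = L2D(1)[OF f] L2D(1)[OF g]
  have "integrable M (\<lambda>x. 2 * (cmod (f x))\<^sup>2 + 2 * (cmod (g x))\<^sup>2)"
    using L2D(2)[OF f] L2D(2)[OF g] by simp
  then have "integrable M (\<lambda>x. (cmod (f x + g x))\<^sup>2)"
    by (rule Bochner_Integration.integrable_bound) (auto simp: cmod_add_square_le)
  then show ?thesis by (simp add: L2_def)
qed

lemma L2_mult_bounded:
  assumes f: "f \<in> L2 M" and g: "g \<in> borel_measurable M" "\<And>x. x \<in> space M \<Longrightarrow> cmod (g x) \<le> C"
  shows "(\<lambda>x. g x * f x) \<in> L2 M"
proof -
  note [measurable] = L2D(1)[OF f] g(1)
  have "integrable M (\<lambda>x. C\<^sup>2 * (cmod (f x))\<^sup>2)" using L2D(2)[OF f] by simp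
  then have "integrable M (\<lambda>x. (cmod (g x * f x))\<^sup>2)"
    by (rule Bochner_Integration.integrable_bound) (auto simp: norm_mult power_mult_distrib intro!: mult_right_mono power_mono g)
  then show ?thesis by (simp add: L2_def)
qed

lemma L2_cmult: "f \<in> L2 M \<Longrightarrow> (\<lambda>x. c * f x) \<in> L2 M"
  by (rule L2_mult_bounded[where C="cmod c"]) auto

lemma L2_diff: "f \<in> L2 M \<Longrightarrow> g \<in> L2 M \<Longrightarrow> (\<lambda>x. f x - g x) \<in> L2 M"
  using L2_add[of f M "\<lambda>x. (-1) * g x"] L2_cmult[of g M "-1"] by simp

lemma L2_zero: "(\<lambda>x. 0) \<in> L2 M"
  by (simp add: L2_def)

lemma L2_sum: "(\<And>i. i \<in> A \<Longrightarrow> f i \<in> L2 M) \<Longrightarrow> (\<lambda>x. \<Sum>i\<in>A. f i x) \<in> L2 M"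
  by (induction A rule: infinite_finite_induct) (auto intro: L2_add L2_zero)

lemma (in finite_measure) L2_boundedI:
  assumes "f \<in> borel_measurable M" "\<And>x. x \<in> space M \<Longrightarrow> cmod (f x) \<le> C"
  shows "f \<in> L2 M"
  using L2_mult_bounded[of "\<lambda>x. 1" M f C] assms by (simp add: L2_def)

lemma (in finite_measure) L2_integrable:
  assumes "f \<in> L2 M" shows "integrable M f"
proof (rule integrable_norm_cancel)
  have "(\<lambda>x. cmod (f x)) \<in> borel_measurable M" using L2D(1)[OF assms] by measurable
  then show "integrable M (\<lambda>x. cmod (f x))"
    using L2D(2)[OF assms] by (rule square_integrable_imp_integrable)
qed (rule L2D(1)[OF assms])

lemma L2_norm_nonneg: "0 \<le> L2_norm M f"
  by (simp add: L2_norm_def)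

lemma L2_norm_square: "(L2_norm M f)\<^sup>2 = (\<integral>x. (cmod (f x))\<^sup>2 \<partial>M)"
  by (simp add: L2_norm_def)

lemma L2_integral_add_le:
  assumes f: "f \<in> L2 M" and g: "g \<in> L2 M"
  shows "(\<integral>x. (cmod (f x + g x))\<^sup>2 \<partial>M) \<le> 2 * (\<integral>x. (cmod (f x))\<^sup>2 \<partial>M) + 2 * (\<integral>x. (cmod (g x))\<^sup>2 \<partial>M)"
proof -
  have "(\<integral>x. (cmod (f x + g x))\<^sup>2 \<partial>M) \<le> (\<integral>x. 2 * (cmod (f x))\<^sup>2 + 2 * (cmod (g x))\<^sup>2 \<partial>M)"
    using L2D(2)[OF f] L2D(2)[OF g] L2D(2)[OF L2_add[OF f g]] by (intro integral_mono) (auto simp: cmod_add_square_le)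
  then show ?thesis using L2D(2)[OF f] L2D(2)[OF g] by simp
qed

text \<open>The constant 2 is the price of integrating \<open>cmod_add_square_le\<close>. It is
  harmless, because both terms will be errors that tend to 0.\<close>

lemma L2_norm_add_le:
  assumes f: "f \<in> L2 M" and g: "g \<in> L2 M"
  shows "L2_norm M (\<lambda>x. f x + g x) \<le> 2 * L2_norm M f + 2 * L2_norm M g"
proof (rule power2_le_imp_le)
  have "(L2_norm M (\<lambda>x. f x + g x))\<^sup>2 \<le> 2 * (L2_norm M f)\<^sup>2 + 2 * (L2_norm M g)\<^sup>2"
    unfolding L2_norm_square by (rule L2_integral_add_le[OF f g])
  also have "\<dots> \<le> (2 * L2_norm M f + 2 * L2_norm M g)\<^sup>2"
    by (simp add: power2_sum power_mult_distrib L2_norm_nonneg)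
  finally show "(L2_norm M (\<lambda>x. f x + g x))\<^sup>2 \<le> (2 * L2_norm M f + 2 * L2_norm M g)\<^sup>2" .
qed (simp add: L2_norm_nonneg)

section \<open>Fourier coefficients, orthogonality and Bessel's inequality\<close>

lemma integrable_mult_powi:
  assumes "integrable circle f" shows "integrable circle (\<lambda>z. f z * z powi n)"
proof (rule Bochner_Integration.integrable_bound[OF assms])
  show "(\<lambda>z. f z * z powi n) \<in> borel_measurable circle" using assms by measurable
qed (auto simp: norm_mult cmod_powi_circle)

lemma L2_powi: "(\<lambda>z. z powi n) \<in> L2 circle"
  by (rule circle.L2_boundedI[where C=1]) (auto simp: cmod_powi_circle)

lemma L2_trig_sum: "(\<lambda>z. \<Sum>n\<in>A. a n * z powi n) \<in> L2 circle"
  by (intro L2_sum L2_cmult L2_powi)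

lemma fourier_coeff_cong_AE:
  assumes [measurable]: "f \<in> borel_measurable circle" "g \<in> borel_measurable circle" and "AE z in circle. f z = g z"
  shows "fourier_coeff f n = fourier_coeff g n"
proof -
  have "(\<integral>z. f z * z powi (-n) \<partial>circle) = (\<integral>z. g z * z powi (-n) \<partial>circle)"
    using assms(3) by (intro integral_cong_AE) auto
  then show ?thesis by (simp add: fourier_coeff_def)
qed

lemma fourier_coeff_add:
  "integrable circle f \<Longrightarrow> integrable circle g \<Longrightarrow> fourier_coeff (\<lambda>z. f z + g z) n = fourier_coeff f n + fourier_coeff g n"
  by (simp add: fourier_coeff_def distrib_right integrable_mult_powi add_divide_distrib)

lemma fourier_coeff_diff:
  "integrable circle f \<Longrightarrow> integrable circle g \<Longrightarrow> fourier_coeff (\<lambda>z. f z - g z) n = fourier_coeff f n - fourier_coeff g n"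
  by (simp add: fourier_coeff_def left_diff_distrib integrable_mult_powi diff_divide_distrib)

lemma fourier_coeff_cmult: "fourier_coeff (\<lambda>z. c * f z) n = c * fourier_coeff f n"
  by (simp add: fourier_coeff_def mult.assoc)

lemma fourier_coeff_powi: "fourier_coeff (\<lambda>z. z powi m) n = (if m = n then 1 else 0)"
proof -
  have "(\<integral>z. z powi m * z powi (-n) \<partial>circle) = (\<integral>z. z powi (m - n) \<partial>circle)"
  proof (intro Bochner_Integration.integral_cong refl)
    fix z assume "z \<in> space circle"
    then have "z \<noteq> 0" by auto
    then show "z powi m * z powi (-n) = z powi (m - n)"
      by (simp add: power_int_diff power_int_minus divide_inverse)
  qed
  then show ?thesis by (simp add: fourier_coeff_def integral_powi_circle)
qed

lemma fourier_coeff_sum: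
  "(\<And>i. i \<in> A \<Longrightarrow> integrable circle (f i)) \<Longrightarrow> fourier_coeff (\<lambda>z. \<Sum>i\<in>A. f i z) n = (\<Sum>i\<in>A. fourier_coeff (f i) n)"
  by (simp add: fourier_coeff_def sum_distrib_right integrable_mult_powi sum_divide_distrib)

lemma fourier_coeff_trig_sum:
  assumes "finite A"
  shows "fourier_coeff (\<lambda>z. \<Sum>n\<in>A. a n * z powi n) m = (if m \<in> A then a m else 0)"
proof -
  have "fourier_coeff (\<lambda>z. \<Sum>n\<in>A. a n * z powi n) m = (\<Sum>n\<in>A. a n * (if n = m then 1 else 0))"
    by (subst fourier_coeff_sum) (auto simp: fourier_coeff_cmult fourier_coeff_powi intro!: circle.L2_integrable L2_cmult L2_powi)
  also have "\<dots> = (\<Sum>n\<in>A. if n = m then a n else 0)" by (intro sum.cong) auto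
  also have "\<dots> = (if m \<in> A then a m else 0)" using assms by simp
  finally show ?thesis .
qed

lemma mult_cnj_cmod: "z * cnj z = complex_of_real ((cmod z)\<^sup>2)"
  by (rule complex_norm_square[symmetric])

lemma mult_cnj_trig_sum:
  assumes "cmod z = 1"
  shows "u * cnj (\<Sum>n\<in>A. a n * z powi n) = (\<Sum>n\<in>A. cnj (a n) * (u * z powi (-n)))"
  by (simp only: powi_uminus_circle[OF assms] cnj_sum complex_cnj_mult sum_distrib_left mult.left_commute)

lemma integral_mult_cnj_trig_sum:
  assumes f: "f \<in> L2 circle"
  shows "(\<integral>z. f z * cnj (\<Sum>n\<in>A. a n * z powi n) \<partial>circle) = 2 * pi * (\<Sum>n\<in>A. cnj (a n) * fourier_coeff f n)"
proof -
  have "(\<integral>z. f z * cnj (\<Sum>n\<in>A. a n * z powi n) \<partial>circle) = (\<integral>z. (\<Sum>n\<in>A. cnj (a n) * (f z * z powi (-n))) \<partial>circle)"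
    by (intro Bochner_Integration.integral_cong refl mult_cnj_trig_sum) simp
  also have "\<dots> = (\<Sum>n\<in>A. \<integral>z. cnj (a n) * (f z * z powi (-n)) \<partial>circle)"
    by (intro Bochner_Integration.integral_sum integrable_mult_right integrable_mult_powi circle.L2_integrable f)
  also have "\<dots> = (\<Sum>n\<in>A. cnj (a n) * (2 * pi * fourier_coeff f n))"
    by (intro sum.cong refl) (simp add: fourier_coeff_def)
  also have "\<dots> = 2 * pi * (\<Sum>n\<in>A. cnj (a n) * fourier_coeff f n)"
    by (simp only: sum_distrib_left mult.left_commute)
  finally show ?thesis .
qed

lemma integral_cmod_trig_sum:
  assumes "finite A"
  shows "(\<integral>z. (cmod (\<Sum>n\<in>A. a n * z powi n))\<^sup>2 \<partial>circle) = 2 * pi * (\<Sum>n\<in>A. (cmod (a n))\<^sup>2)"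
proof -
  let ?p = "\<lambda>z. \<Sum>n\<in>A. a n * z powi n"
  have "complex_of_real (\<integral>z. (cmod (?p z))\<^sup>2 \<partial>circle) = (\<integral>z. ?p z * cnj (?p z) \<partial>circle)"
    by (simp only: mult_cnj_cmod flip: integral_complex_of_real)
  also have "\<dots> = 2 * pi * (\<Sum>n\<in>A. cnj (a n) * fourier_coeff ?p n)"
    by (rule integral_mult_cnj_trig_sum[OF L2_trig_sum])
  also have "\<dots> = 2 * pi * (\<Sum>n\<in>A. complex_of_real ((cmod (a n))\<^sup>2))"
    by (simp add: fourier_coeff_trig_sum[OF assms] mult.commute[of "cnj _"] mult_cnj_cmod cong: sum.cong)
  also have "\<dots> = complex_of_real (2 * pi * (\<Sum>n\<in>A. (cmod (a n))\<^sup>2))" by simp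
  finally show ?thesis by (simp only: of_real_eq_iff)
qed

text \<open>Completing the square in each coefficient. With \<open>a\<close> the coefficients of
  \<open>f\<close> it gives Bessel's and Parseval's statements; with other \<open>a\<close> it
  writes a distance through coefficients alone, which makes it measurable in a parameter.\<close>

lemma L2_distance_trig_sum:
  assumes f: "f \<in> L2 circle" and A: "finite A"
  shows "(\<integral>z. (cmod (f z - (\<Sum>n\<in>A. a n * z powi n)))\<^sup>2 \<partial>circle) =
    (\<integral>z. (cmod (f z))\<^sup>2 \<partial>circle) + 2 * pi * (\<Sum>n\<in>A. (cmod (a n - fourier_coeff f n))\<^sup>2 - (cmod (fourier_coeff f n))\<^sup>2)"
proof -
  let ?p = "\<lambda>z. \<Sum>n\<in>A. a n * z powi n"
  have expand: "(cmod (u - v))\<^sup>2 = (cmod u)\<^sup>2 - 2 * Re (u * cnj v) + (cmod v)\<^sup>2" for u v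
    unfolding cmod_power2 by (simp add: power2_eq_square algebra_simps)
  have fp: "integrable circle (\<lambda>z. f z * cnj (?p z))"
  proof -
    have "integrable circle (\<lambda>z. \<Sum>n\<in>A. cnj (a n) * (f z * z powi (-n)))"
      by (intro Bochner_Integration.integrable_sum integrable_mult_right integrable_mult_powi circle.L2_integrable f)
    then show ?thesis
      by (rule Bochner_Integration.integrable_cong[THEN iffD1, rotated -1])
         (simp_all only: space_circle mem_sphere_0 mult_cnj_trig_sum)
  qed
  have "(\<integral>z. (cmod (f z - ?p z))\<^sup>2 \<partial>circle)
    = (\<integral>z. (cmod (f z))\<^sup>2 - 2 * Re (f z * cnj (?p z)) + (cmod (?p z))\<^sup>2 \<partial>circle)"
    by (simp only: expand)
  also have "\<dots> = (\<integral>z. (cmod (f z))\<^sup>2 \<partial>circle) - (\<integral>z. 2 * Re (f z * cnj (?p z)) \<partial>circle) + (\<integral>z. (cmod (?p z))\<^sup>2 \<partial>circle)"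
    by (simp only: Bochner_Integration.integral_add Bochner_Integration.integral_diff
        Bochner_Integration.integrable_diff L2D(2)[OF f] L2D(2)[OF L2_trig_sum] integrable_mult_right[OF integrable_Re[OF fp]])
  also have "(\<integral>z. 2 * Re (f z * cnj (?p z)) \<partial>circle) = 2 * Re (\<integral>z. f z * cnj (?p z) \<partial>circle)"
    by (simp only: integral_mult_right_zero integral_Re[OF fp])
  also have "(\<integral>z. f z * cnj (?p z) \<partial>circle) = 2 * pi * (\<Sum>n\<in>A. cnj (a n) * fourier_coeff f n)"
    by (rule integral_mult_cnj_trig_sum[OF f])
  also have "Re (2 * pi * (\<Sum>n\<in>A. cnj (a n) * fourier_coeff f n)) = 2 * pi * (\<Sum>n\<in>A. Re (cnj (a n) * fourier_coeff f n))"
    by (simp add: Re_sum)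
  also have "(\<integral>z. (cmod (?p z))\<^sup>2 \<partial>circle) = 2 * pi * (\<Sum>n\<in>A. (cmod (a n))\<^sup>2)"
    by (rule integral_cmod_trig_sum[OF A])
  finally have *: "(\<integral>z. (cmod (f z - ?p z))\<^sup>2 \<partial>circle) = (\<integral>z. (cmod (f z))\<^sup>2 \<partial>circle)
     - 2 * (2 * pi * (\<Sum>n\<in>A. Re (cnj (a n) * fourier_coeff f n))) + 2 * pi * (\<Sum>n\<in>A. (cmod (a n))\<^sup>2)" .
  have "(cmod (a n - fourier_coeff f n))\<^sup>2 - (cmod (fourier_coeff f n))\<^sup>2
      = (cmod (a n))\<^sup>2 - 2 * Re (cnj (a n) * fourier_coeff f n)" for n
    by (subst expand) simp
  then show ?thesis
    unfolding * by (simp only: sum_subtractf flip: sum_distrib_left) (simp add: algebra_simps)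
qed

lemma fourier_bessel:
  assumes f: "f \<in> L2 circle" and A: "finite A"
  shows "2 * pi * (\<Sum>n\<in>A. (cmod (fourier_coeff f n))\<^sup>2) \<le> (\<integral>z. (cmod (f z))\<^sup>2 \<partial>circle)"
proof -
  have "0 \<le> (\<integral>z. (cmod (f z - (\<Sum>n\<in>A. fourier_coeff f n * z powi n)))\<^sup>2 \<partial>circle)" by simp
  then show ?thesis
    unfolding L2_distance_trig_sum[OF f A] by (simp add: sum_negf)
qed

lemma fourier_coeff_bound:
  assumes f: "f \<in> L2 circle"
  shows "cmod (fourier_coeff f n) \<le> L2_norm circle f"
proof (rule power2_le_imp_le[OF _ L2_norm_nonneg])
  have "(cmod (fourier_coeff f n))\<^sup>2 \<le> 2 * pi * (cmod (fourier_coeff f n))\<^sup>2"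
    using pi_gt3 by (intro mult_right_mono[of 1 "2*pi", simplified]) auto
  also have "\<dots> \<le> (L2_norm circle f)\<^sup>2"
    unfolding L2_norm_square using fourier_bessel[OF f, of "{n}"] by simp
  finally show "(cmod (fourier_coeff f n))\<^sup>2 \<le> (L2_norm circle f)\<^sup>2" .
qed

section \<open>Completeness of the trigonometric system\<close>

text \<open>The induction keeps \<open>f\<close> arbitrary: vanishing of all moments passes from
  \<open>f\<close> to \<open>f * p\<close>, so a product of polynomials is treated by using both
  hypotheses in turn. A linear function on the circle only shifts the frequency by one.\<close>

lemma integral_mult_polynomial_eq_0:
  fixes p :: "complex \<Rightarrow> real"
  assumes "real_polynomial_function p" "integrable circle f" "\<And>n. (\<integral>z. f z * z powi n \<partial>circle) = 0"
  shows "integrable circle (\<lambda>z. f z * p z) \<and> (\<forall>n. (\<integral>z. f z * p z * z powi n \<partial>circle) = 0)"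
  using assms
proof (induction p arbitrary: f rule: real_polynomial_function.induct)
  case (linear h)
  then interpret bounded_linear h by simp
  \<comment> \<open>On the circle Re z = (z + 1/z) / 2 and Im z = (z - 1/z) / (2i); collecting the
    factor of z gives \<open>a\<close>.\<close>
  define a where "a = (complex_of_real (h 1) - \<i> * h \<i>) / 2"
  have h: "complex_of_real (h z) = a * z powi 1 + cnj a * z powi (-1)" if "cmod z = 1" for z
  proof -
    have z: "z powi (-1) = cnj z"
      using powi_uminus_circle[OF that, of 1] by simp
    have "h z = h (Re z *\<^sub>R 1 + Im z *\<^sub>R \<i>)"
      by (rule arg_cong[where f=h]) (simp add: complex_eq_iff)
    also have "\<dots> = Re z * h 1 + Im z * h \<i>" by (simp only: add scaleR real_scaleR_def)
    finally show ?thesis unfolding z by (simp add: a_def complex_eq_iff field_simps)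
  qed
  have eq: "f z * h z * z powi n = a * (f z * z powi (n + 1)) + cnj a * (f z * z powi (n - 1))" if "z \<in> space circle" for n z
  proof -
    have "z \<noteq> 0" using that by auto
    then show ?thesis
      using h[of z] that by (simp add: power_int_add power_int_diff power_int_minus algebra_simps divide_inverse)
  qed
  have "integrable circle (\<lambda>z. a * (f z * z powi (0 + 1)) + cnj a * (f z * z powi (0 - 1)))"
    by (intro Bochner_Integration.integrable_add integrable_mult_right integrable_mult_powi linear.prems)
  then have "integrable circle (\<lambda>z. f z * h z * z powi 0)"
    by (rule Bochner_Integration.integrable_cong[THEN iffD2, rotated -1]) (simp_all only: eq)
  moreover have "(\<integral>z. f z * h z * z powi n \<partial>circle) = 0" for n
  proof -
    have "(\<integral>z. f z * h z * z powi n \<partial>circle) = (\<integral>z. a * (f z * z powi (n + 1)) + cnj a * (f z * z powi (n - 1)) \<partial>circle)"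
      by (rule Bochner_Integration.integral_cong) (simp_all only: eq)
    also have "\<dots> = (\<integral>z. a * (f z * z powi (n + 1)) \<partial>circle) + (\<integral>z. cnj a * (f z * z powi (n - 1)) \<partial>circle)"
      by (intro Bochner_Integration.integral_add integrable_mult_right integrable_mult_powi linear.prems)
    finally show ?thesis by (simp add: linear.prems)
  qed
  ultimately show ?case by simp
next
  case (const c)
  then show ?case
    by (simp add: mult.commute[of _ "complex_of_real c"] mult.assoc)
next
  case (add p q)
  show ?case
    using add.IH(1)[OF add.prems] add.IH(2)[OF add.prems]
    by (simp add: distrib_left distrib_right integrable_mult_powi)
next
  case (mult p q)
  show ?case
    using mult.IH(2)[of "\<lambda>z. f z * p z"] mult.IH(1)[OF mult.prems] by (simp add: mult.assoc)
qed

lemma integral_mult_continuous_eq_0: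
  fixes g :: "complex \<Rightarrow> real"
  assumes f: "integrable circle f" and 0: "\<And>n. (\<integral>z. f z * z powi n \<partial>circle) = 0"
    and g: "continuous_on (sphere 0 1) g"
  shows "integrable circle (\<lambda>z. f z * g z)" "(\<integral>z. f z * g z \<partial>circle) = 0"
proof -
  have gm: "g \<in> borel_measurable circle" by (rule continuous_imp_measurable_circle[OF g])
  have [measurable]: "f \<in> borel_measurable circle" "g \<in> borel_measurable circle" using f gm by auto
  have "compact (g ` sphere 0 1)" using g by (intro compact_continuous_image) auto
  then obtain B where "\<forall>z\<in>sphere 0 1. \<bar>g z\<bar> \<le> B"
    using compact_imp_bounded[of "g ` sphere 0 1"] by (auto simp: bounded_iff)
  then have B: "\<bar>g z\<bar> \<le> B" if "cmod z = 1" for z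
    using that by simp
  have "integrable circle (\<lambda>z. B * f z)" using f by simp
  then show i: "integrable circle (\<lambda>z. f z * g z)"
  proof (rule Bochner_Integration.integrable_bound)
    show "AE z in circle. cmod (f z * g z) \<le> cmod (B * f z)"
    proof (rule AE_I2)
      fix z assume "z \<in> space circle"
      then have "\<bar>g z\<bar> \<le> \<bar>B\<bar>" using B[of z] by simp
      then show "cmod (f z * g z) \<le> cmod (B * f z)"
        by (simp add: norm_mult mult.commute mult_right_mono)
    qed
  qed measurable
  have "cmod (\<integral>z. f z * g z \<partial>circle) \<le> 0"
  proof (rule field_le_epsilon)
    fix e :: real assume "0 < e"
    define M where "M = (\<integral>z. cmod (f z) \<partial>circle)"
    have M: "0 \<le> M" by (simp add: M_def)
    \<comment> \<open>\<open>M + 1\<close> instead of \<open>M\<close>, since \<open>f\<close> may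
      have L1 norm 0.\<close>
    have "0 < e / (M + 1)" using M \<open>0 < e\<close> by simp
    from Stone_Weierstrass_real_polynomial_function[OF _ g this]
    obtain p where p: "real_polynomial_function p" "\<And>z. z \<in> sphere 0 1 \<Longrightarrow> \<bar>g z - p z\<bar> < e / (M + 1)"
      by auto
    note P = integral_mult_polynomial_eq_0[OF p(1) f 0]
    have P0: "(\<integral>z. f z * p z \<partial>circle) = 0" using spec[OF conjunct2[OF P], of 0] by simp
    have "cmod (\<integral>z. f z * g z \<partial>circle) = cmod (\<integral>z. f z * g z - f z * p z \<partial>circle)"
      using i P P0 by (subst Bochner_Integration.integral_diff) auto
    also have "\<dots> \<le> (\<integral>z. cmod (f z) * (e / (M + 1)) \<partial>circle)"
    proof (rule Bochner_Integration.integral_norm_bound_integral)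
      show "integrable circle (\<lambda>z. f z * g z - f z * p z)" using i P by auto
      show "integrable circle (\<lambda>z. cmod (f z) * (e / (M + 1)))" using f by (intro integrable_mult_left integrable_norm)
      fix z assume z: "z \<in> space circle"
      have "f z * g z - f z * p z = f z * complex_of_real (g z - p z)" by (simp add: right_diff_distrib)
      then show "cmod (f z * g z - f z * p z) \<le> cmod (f z) * (e / (M + 1))"
        using p(2)[of z] z by (simp only: norm_mult norm_of_real) (rule mult_left_mono, auto)
    qed
    also have "\<dots> = M * (e / (M + 1))" by (simp add: M_def)
    also have "\<dots> \<le> 0 + e" using M \<open>0 < e\<close> by (simp add: field_simps)
    finally show "cmod (\<integral>z. f z * g z \<partial>circle) \<le> 0 + e" .
  qed
  then show "(\<integral>z. f z * g z \<partial>circle) = 0" by simp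
qed

text \<open>The indicator of a closed set is the pointwise limit of the continuous functions max 0
  (1 - k dist(z, C)), and |f| dominates.\<close>

lemma integral_closed_eq_0:
  assumes f: "integrable circle f" and 0: "\<And>n. (\<integral>z. f z * z powi n \<partial>circle) = 0" and C: "closed C"
  shows "(\<integral>z. f z * indicator C z \<partial>circle) = 0"
\<comment> \<open>The distance \<open>infdist\<close> to the empty set is 0 by convention, so the
  approximating functions would be 1 there instead of 0.\<close>
proof (cases "C = {}")
  case False
  have [measurable]: "f \<in> borel_measurable circle" using f by auto
  have [measurable]: "Measurable.pred circle (\<lambda>z. z \<in> C)"
    using borel_measurable_circleI[of "\<lambda>z. z"] C by (intro pred_sets2[where N=borel]) auto
  define g where "g k z = max 0 (1 - real k * infdist z C)" for k z
  have cont: "continuous_on (sphere 0 1) (g k)" for k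
    unfolding g_def by (intro continuous_intros)
  have "(\<lambda>k. \<integral>z. f z * g k z \<partial>circle) \<longlonglongrightarrow> (\<integral>z. f z * indicator C z \<partial>circle)"
  proof (rule integral_dominated_convergence[where w="\<lambda>z. cmod (f z)"])
    show "(\<lambda>z. f z * indicator C z) \<in> borel_measurable circle" by measurable
    show "(\<lambda>z. f z * g k z) \<in> borel_measurable circle" for k
      using continuous_imp_measurable_circle[OF cont] by measurable
    show "integrable circle (\<lambda>z. cmod (f z))" using f by simp
    show "AE z in circle. (\<lambda>k. f z * complex_of_real (g k z)) \<longlonglongrightarrow> f z * indicator C z"
    proof (rule AE_I2, intro tendsto_mult tendsto_const)
      fix z
      show "(\<lambda>k. complex_of_real (g k z)) \<longlonglongrightarrow> indicator C z"
      proof (cases "z \<in> C")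
        case True then show ?thesis by (simp add: g_def)
      next
        case out: False
        then have pos: "0 < infdist z C" using C False by (simp add: infdist_pos_not_in_closed)
        obtain K :: nat where K: "1 / infdist z C < real K" using reals_Archimedean2 by blast
        have "g k z = 0" if "K \<le> k" for k
        proof -
          have "1 / infdist z C \<le> real k" using K that by linarith
          then show ?thesis using pos by (simp add: g_def field_simps)
        qed
        then have "eventually (\<lambda>k. complex_of_real (g k z) = indicator C z) sequentially"
          using out by (auto simp: eventually_sequentially)
        then show ?thesis by (rule tendsto_eventually)
      qed
    qed
    show "AE z in circle. cmod (f z * complex_of_real (g k z)) \<le> cmod (f z)" for k
      by (rule AE_I2) (auto simp: g_def norm_mult infdist_nonneg intro!: mult_left_le)
  qed
  moreover have "(\<integral>z. f z * g k z \<partial>circle) = 0" for k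
    by (rule integral_mult_continuous_eq_0(2)[OF f 0 cont])
  ultimately show ?thesis by (simp add: LIMSEQ_const_iff)
qed simp

text \<open>Dynkin's argument: closed sets are stable under intersection and generate the Borel
  sets; complements are covered by the moment of index 0, disjoint unions by countable
  additivity.\<close>

lemma integral_borel_eq_0:
  assumes f: "integrable circle f" and 0: "\<And>n. (\<integral>z. f z * z powi n \<partial>circle) = 0" and A: "A \<in> sets borel"
  shows "(\<integral>z. f z * indicator A z \<partial>circle) = 0"
proof -
  have meas: "B \<in> sets borel \<Longrightarrow> B \<inter> sphere 0 1 \<in> sets circle" for B
    by (auto simp: sets_circle sets_restrict_space)
  have int: "B \<in> sets borel \<Longrightarrow> integrable circle (\<lambda>z. f z * indicator B z)" for B
  proof -
    assume "B \<in> sets borel"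
    have "integrable circle (\<lambda>z. indicator (B \<inter> sphere 0 1) z *\<^sub>R f z)"
      by (rule integrable_mult_indicator[OF meas[OF \<open>B \<in> sets borel\<close>] f])
    then show ?thesis
      by (rule Bochner_Integration.integrable_cong[THEN iffD1, rotated -1]) (auto split: split_indicator)
  qed
  have "Int_stable (Collect closed :: complex set set)" by (auto simp: Int_stable_def)
  moreover have "Collect closed \<subseteq> Pow (UNIV :: complex set)" by simp
  moreover have "A \<in> sigma_sets UNIV (Collect closed)"
    using A by (simp add: borel_eq_closed)
  ultimately show ?thesis
  proof (induction rule: sigma_sets_induct_disjoint)
    case (basic A)
    then show ?case using integral_closed_eq_0[OF f 0] by simp
  next
    case (compl A)
    have A: "A \<in> sets borel" using compl by (simp add: borel_eq_closed)
    have "(\<integral>z. f z * indicator (UNIV - A) z \<partial>circle) = (\<integral>z. f z - f z * indicator A z \<partial>circle)"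
      by (rule Bochner_Integration.integral_cong) (auto split: split_indicator)
    also have "\<dots> = (\<integral>z. f z \<partial>circle) - (\<integral>z. f z * indicator A z \<partial>circle)"
      by (rule Bochner_Integration.integral_diff[OF f int[OF A]])
    finally show ?case using compl 0[of 0] by simp
  next
    case (union A)
    have A: "A i \<in> sets borel" for i using union by (auto simp: borel_eq_closed)
    let ?B = "\<lambda>i. A i \<inter> sphere 0 1"
    have B: "?B i \<in> sets circle" for i by (rule meas[OF A])
    have eq: "(LINT z:(D \<inter> sphere 0 1)|circle. f z) = (\<integral>z. f z * indicator D z \<partial>circle)" for D
      unfolding set_lebesgue_integral_def
      by (rule Bochner_Integration.integral_cong) (auto split: split_indicator)
    have un: "(\<Union>i. ?B i) = (\<Union>i. A i) \<inter> sphere 0 1" by auto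
    have "(LINT z:(\<Union>i. ?B i)|circle. f z) = (\<Sum>i. LINT z:(?B i)|circle. f z)"
    proof (rule lebesgue_integral_countable_add)
      show "?B i \<inter> ?B j = {}" if "i \<noteq> j" for i j
        using union(1) that by (auto simp: disjoint_family_on_def)
      show "set_integrable circle (\<Union>i. ?B i) f"
        unfolding set_integrable_def by (intro integrable_mult_indicator f sets.countable_UN) (auto intro: B)
    qed (rule B)
    then show ?case using union by (simp add: eq un)
  qed simp
qed

text \<open>Tested against the set where Re f is positive, the previous lemma says that the positive
  part of Re f has integral 0.\<close>

lemma AE_Re_le_0:
  assumes f: "integrable circle f" and 0: "\<And>n. (\<integral>z. f z * z powi n \<partial>circle) = 0"
  shows "AE z in circle. Re (f z) \<le> 0"
proof -
  have [measurable]: "f \<in> borel_measurable circle" using f by auto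
  have "{z \<in> space circle. 0 < Re (f z)} \<in> sets circle" by measurable
  then obtain A where A: "A \<in> sets borel" and eq: "{z \<in> space circle. 0 < Re (f z)} = sphere 0 1 \<inter> A"
    unfolding sets_circle sets_restrict_space by blast
  have m: "max 0 (Re (f z)) = Re (f z * indicator A z)" if "z \<in> space circle" for z
  proof -
    have "z \<in> A \<longleftrightarrow> 0 < Re (f z)" using eq that unfolding space_circle by blast
    then show ?thesis by (cases "z \<in> A") auto
  qed
  have "integrable circle (\<lambda>z. f z * indicator A z)"
  proof -
    have "integrable circle (\<lambda>z. indicator {z \<in> space circle. 0 < Re (f z)} z *\<^sub>R f z)"
      by (intro integrable_mult_indicator f) measurable
    then show ?thesis
      unfolding eq by (rule Bochner_Integration.integrable_cong[THEN iffD1, rotated -1]) (auto split: split_indicator)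
  qed
  then have "(\<integral>z. Re (f z * indicator A z) \<partial>circle) = 0"
    by (simp only: integral_Re integral_borel_eq_0[OF f 0 A]) simp
  moreover have "(\<integral>z. max 0 (Re (f z)) \<partial>circle) = (\<integral>z. Re (f z * indicator A z) \<partial>circle)"
    by (rule Bochner_Integration.integral_cong[OF refl m])
  ultimately have "(\<integral>z. max 0 (Re (f z)) \<partial>circle) = 0" by simp
  moreover have "integrable circle (\<lambda>z. max 0 (Re (f z)))" using f by simp
  ultimately have "AE z in circle. max 0 (Re (f z)) = 0"
    using integral_nonneg_eq_0_iff_AE[of circle "\<lambda>z. max 0 (Re (f z))"] by simp
  then show ?thesis by eventually_elim (metis max.cobounded2)
qed

text \<open>The one-sided bound is applied to \<open>c * f\<close> for the four units c = 1, -1, i,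
  -i, which bounds the real and the imaginary part from both sides.\<close>

lemma fourier_coeff_eq_0_imp_AE:
  assumes f: "integrable circle f" and 0: "\<And>n. fourier_coeff f n = 0"
  shows "AE z in circle. f z = 0"
proof -
  have z: "(\<integral>z. f z * z powi n \<partial>circle) = 0" for n
    using 0[of "-n"] by (simp add: fourier_coeff_def)
  have "AE z in circle. Re (c * f z) \<le> 0" for c
    by (rule AE_Re_le_0) (simp_all add: f mult.assoc z)
  from this[of 1] this[of "-1"] this[of "\<i>"] this[of "-\<i>"]
  show ?thesis by eventually_elim (auto simp: complex_eq_iff)
qed

lemma fourier_coeff_eq_imp_AE:
  assumes f: "f \<in> L2 circle" and g: "g \<in> L2 circle" and eq: "\<And>n. fourier_coeff f n = fourier_coeff g n"
  shows "AE z in circle. f z = g z"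
proof -
  have "AE z in circle. f z - g z = 0"
    using f g by (intro fourier_coeff_eq_0_imp_AE)
      (simp_all add: circle.L2_integrable fourier_coeff_diff eq)
  then show ?thesis by simp
qed

section \<open>The Riesz-Fischer theorem\<close>

lemma nn_integral_cmod_trig_sum:
  assumes "finite A"
  shows "(\<integral>\<^sup>+z. ennreal ((cmod (\<Sum>n\<in>A. a n * z powi n))\<^sup>2) \<partial>circle) = ennreal (2 * pi * (\<Sum>n\<in>A. (cmod (a n))\<^sup>2))"
  using L2D(2)[OF L2_trig_sum] integral_cmod_trig_sum[OF assms, of a]
  by (simp add: nn_integral_eq_integral)

text \<open>From t <= r + t^2 / r, a substitute for the Cauchy-Schwarz inequality with a free
  balance \<open>r\<close>. For a squared norm of order 4^-k the choice r = 2^-k makes both terms of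
  order 2^-k.\<close>

lemma nn_integral_cmod_le_square:
  fixes f :: "'a \<Rightarrow> complex"
  assumes [measurable]: "f \<in> borel_measurable M" and "0 < r"
  shows "(\<integral>\<^sup>+x. ennreal (cmod (f x)) \<partial>M) \<le> ennreal r * emeasure M (space M) + ennreal (1/r) * (\<integral>\<^sup>+x. ennreal ((cmod (f x))\<^sup>2) \<partial>M)"
proof -
  have "t \<le> r + 1/r * t\<^sup>2" if "0 \<le> t" for t :: real
  proof -
    have "0 \<le> (t / 2 - r)\<^sup>2 + 3/4 * t\<^sup>2" by simp
    then show ?thesis using \<open>0 < r\<close> by (simp add: field_simps power2_eq_square)
  qed
  then have "ennreal (cmod (f x)) \<le> ennreal r + ennreal (1/r) * ennreal ((cmod (f x))\<^sup>2)" for x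
    using \<open>0 < r\<close> by (simp flip: ennreal_plus ennreal_mult add: ennreal_leI)
  then have "(\<integral>\<^sup>+x. ennreal (cmod (f x)) \<partial>M) \<le> (\<integral>\<^sup>+x. ennreal r + ennreal (1/r) * ennreal ((cmod (f x))\<^sup>2) \<partial>M)"
    by (intro nn_integral_mono)
  also have "\<dots> = ennreal r * emeasure M (space M) + ennreal (1/r) * (\<integral>\<^sup>+x. ennreal ((cmod (f x))\<^sup>2) \<partial>M)"
    by (subst nn_integral_add) (auto simp: nn_integral_cmult)
  finally show ?thesis .
qed

text \<open>The partial sums over the sets \<open>F k\<close> converge so fast in \<open>L\<^sup>1\<close> that they converge almost everywhere.\<close>

lemma riesz_fischer_aux:
  fixes F :: "nat \<Rightarrow> int set"
  assumes fin: "\<And>k. finite (F k)" and sub: "\<And>k j. k \<le> j \<Longrightarrow> F k \<subseteq> F j"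
    and tail: "\<And>k A. finite A \<Longrightarrow> F k \<subseteq> A \<Longrightarrow> (\<Sum>n\<in>A - F k. (cmod (c n))\<^sup>2) \<le> (1/4)^k"
  shows "\<exists>f \<in> L2 circle. \<forall>k. (\<integral>z. (cmod (f z - (\<Sum>n\<in>F k. c n * z powi n)))\<^sup>2 \<partial>circle) \<le> 2 * pi * (1/4)^k"
proof -
  define S where "S k z = (\<Sum>n\<in>F k. c n * z powi n)" for k z
  have SL2: "S k \<in> L2 circle" for k
    unfolding S_def by (rule L2_trig_sum)
  have [measurable]: "S k \<in> borel_measurable circle" for k by (rule L2D(1)[OF SL2])
  have diff: "S j z - S k z = (\<Sum>n\<in>F j - F k. c n * z powi n)" if "k \<le> j" for k j z
    unfolding S_def using fin sub[OF that] by (simp add: sum_diff)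
  have dist: "(\<integral>\<^sup>+z. ennreal ((cmod (S j z - S k z))\<^sup>2) \<partial>circle) \<le> ennreal (2 * pi * (1/4)^k)" if "k \<le> j" for k j
  proof -
    have "(\<integral>\<^sup>+z. ennreal ((cmod (S j z - S k z))\<^sup>2) \<partial>circle) = ennreal (2 * pi * (\<Sum>n\<in>F j - F k. (cmod (c n))\<^sup>2))"
      unfolding diff[OF that] using fin by (intro nn_integral_cmod_trig_sum) auto
    also have "\<dots> \<le> ennreal (2 * pi * (1/4)^k)"
      using tail[OF fin sub[OF that]] by (intro ennreal_leI mult_left_mono) auto
    finally show ?thesis .
  qed
  have step: "(\<integral>\<^sup>+z. ennreal (cmod (S (Suc k) z - S k z)) \<partial>circle) \<le> ennreal (4 * pi * (1/2)^k)" for k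
  proof -
    have "(\<integral>\<^sup>+z. ennreal (cmod (S (Suc k) z - S k z)) \<partial>circle)
        \<le> ennreal ((1/2)^k) * emeasure circle (space circle) + ennreal (1/(1/2)^k) * (\<integral>\<^sup>+z. ennreal ((cmod (S (Suc k) z - S k z))\<^sup>2) \<partial>circle)"
      by (rule nn_integral_cmod_le_square) auto
    also have "\<dots> \<le> ennreal ((1/2)^k) * ennreal (2 * pi) + ennreal (1/(1/2)^k) * ennreal (2 * pi * (1/4)^k)"
      using dist[of k "Suc k"] by (intro add_mono mult_left_mono) (auto simp: emeasure_circle)
    also have "\<dots> = ennreal ((1/2)^k * (2 * pi) + (1/(1/2)^k) * (2 * pi * (1/4)^k))"
    proof -
      have "ennreal a * ennreal b + ennreal c * ennreal d = ennreal (a * b + c * d)"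
        if "0 \<le> a" "0 \<le> b" "0 \<le> c" "0 \<le> d" for a b c d
        using that by (simp add: ennreal_plus ennreal_mult)
      then show ?thesis by simp
    qed
    also have "(1/2)^k * (2 * pi) + (1/(1/2)^k) * (2 * pi * (1/4)^k) = 4 * pi * (1/2::real)^k"
    proof -
      have "(1/4::real)^k = (1/2)^k * (1/2)^k" by (simp flip: power_mult_distrib)
      then show ?thesis by simp
    qed
    finally show ?thesis .
  qed
  have "(\<integral>\<^sup>+z. (\<Sum>k. ennreal (cmod (S (Suc k) z - S k z))) \<partial>circle) = (\<Sum>k. \<integral>\<^sup>+z. ennreal (cmod (S (Suc k) z - S k z)) \<partial>circle)"
    by (rule nn_integral_suminf) measurable
  also have "\<dots> \<le> (\<Sum>k. ennreal (4 * pi * (1/2)^k))"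
    by (intro suminf_le step) auto
  also have "\<dots> = ennreal (\<Sum>k. 4 * pi * (1/2)^k)"
    by (intro suminf_ennreal2 summable_mult summable_geometric) auto
  finally have "(\<integral>\<^sup>+z. (\<Sum>k. ennreal (cmod (S (Suc k) z - S k z))) \<partial>circle) \<noteq> \<infinity>"
    by (auto simp: top_unique)
  then have "AE z in circle. (\<Sum>k. ennreal (cmod (S (Suc k) z - S k z))) \<noteq> \<infinity>"
    by (intro nn_integral_PInf_AE) auto
  then have conv: "AE z in circle. (\<lambda>k. S k z) \<longlonglongrightarrow> lim (\<lambda>k. S k z)"
  proof eventually_elim
    case (elim z)
    then have "summable (\<lambda>k. cmod (S (Suc k) z - S k z))"
      by (intro summable_suminf_not_top) auto
    then have "summable (\<lambda>k. S (Suc k) z - S k z)" by (rule summable_norm_cancel)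
    then have "(\<lambda>n. \<Sum>k<n. S (Suc k) z - S k z) \<longlonglongrightarrow> (\<Sum>k. S (Suc k) z - S k z)" by (rule summable_LIMSEQ)
    then have "(\<lambda>n. S n z - S 0 z) \<longlonglongrightarrow> (\<Sum>k. S (Suc k) z - S k z)"
      by (simp only: sum_lessThan_telescope[of "\<lambda>k. S k z"])
    from tendsto_add[OF this tendsto_const[of "S 0 z"]]
    have "convergent (\<lambda>k. S k z)" by (auto simp: convergent_def)
    then show ?case by (simp add: convergent_LIMSEQ_iff)
  qed
  define f where "f z = lim (\<lambda>k. S k z)" for z
  have [measurable]: "f \<in> borel_measurable circle"
    unfolding f_def by (rule borel_measurable_lim_metric) measurable
  have fatou: "(\<integral>\<^sup>+z. ennreal ((cmod (f z - S k z))\<^sup>2) \<partial>circle) \<le> ennreal (2 * pi * (1/4)^k)" for k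
  proof -
    have "(\<integral>\<^sup>+z. ennreal ((cmod (f z - S k z))\<^sup>2) \<partial>circle)
       = (\<integral>\<^sup>+z. liminf (\<lambda>j. ennreal ((cmod (S j z - S k z))\<^sup>2)) \<partial>circle)"
    proof (rule nn_integral_cong_AE)
      show "AE z in circle. ennreal ((cmod (f z - S k z))\<^sup>2) = liminf (\<lambda>j. ennreal ((cmod (S j z - S k z))\<^sup>2))"
        using conv
      proof eventually_elim
        case (elim z)
        then have "(\<lambda>j. ennreal ((cmod (S j z - S k z))\<^sup>2)) \<longlonglongrightarrow> ennreal ((cmod (f z - S k z))\<^sup>2)"
          unfolding f_def by (intro tendsto_ennrealI tendsto_power tendsto_norm tendsto_diff tendsto_const)
        then show ?case by (rule lim_imp_Liminf[OF sequentially_bot, symmetric])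
      qed
    qed
    also have "\<dots> \<le> liminf (\<lambda>j. \<integral>\<^sup>+z. ennreal ((cmod (S j z - S k z))\<^sup>2) \<partial>circle)"
      by (rule nn_integral_liminf) measurable
    also have "\<dots> \<le> limsup (\<lambda>j. \<integral>\<^sup>+z. ennreal ((cmod (S j z - S k z))\<^sup>2) \<partial>circle)"
      by (rule Liminf_le_Limsup) simp
    also have "\<dots> \<le> ennreal (2 * pi * (1/4)^k)"
      by (rule Limsup_bounded) (auto simp: eventually_sequentially intro!: exI[of _ k] dist)
    finally show ?thesis .
  qed
  have fS: "(\<lambda>z. f z - S k z) \<in> L2 circle" for k
    unfolding L2_def
  proof (safe intro!: integrableI_bounded)
    have "(\<integral>\<^sup>+z. ennreal ((cmod (f z - S k z))\<^sup>2) \<partial>circle) < \<infinity>"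
      using fatou[of k] by (rule le_less_trans) simp
    then show "(\<integral>\<^sup>+z. ennreal (norm ((cmod (f z - S k z))\<^sup>2)) \<partial>circle) < \<infinity>" by simp
  qed measurable
  show ?thesis
  proof (intro bexI[of _ f] allI)
    show "f \<in> L2 circle" using L2_add[OF fS[of 0] SL2[of 0]] by simp
    fix k
    have "ennreal (\<integral>z. (cmod (f z - S k z))\<^sup>2 \<partial>circle) = (\<integral>\<^sup>+z. ennreal ((cmod (f z - S k z))\<^sup>2) \<partial>circle)"
      using L2D(2)[OF fS[of k]] by (simp add: nn_integral_eq_integral)
    also have "\<dots> \<le> ennreal (2 * pi * (1/4)^k)" by (rule fatou)
    finally have "(\<integral>z. (cmod (f z - S k z))\<^sup>2 \<partial>circle) \<le> 2 * pi * (1/4)^k"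
      by (subst (asm) ennreal_le_iff) auto
    then show "(\<integral>z. (cmod (f z - (\<Sum>n\<in>F k. c n * z powi n)))\<^sup>2 \<partial>circle) \<le> 2 * pi * (1/4)^k"
      by (simp add: S_def)
  qed
qed

text \<open>Convergence along all finite sets is reduced to a sequence: increasing finite sets
  \<open>F k\<close> are chosen whose complements carry at most 4^-k of the square sum.\<close>

lemma riesz_fischer:
  fixes c :: "int \<Rightarrow> complex"
  assumes summ: "(\<lambda>n. (cmod (c n))\<^sup>2) summable_on UNIV"
  shows "\<exists>f \<in> L2 circle. ((\<lambda>A. L2_norm circle (\<lambda>z. f z - (\<Sum>n\<in>A. c n * z powi n))) \<longlongrightarrow> 0) (finite_subsets_at_top UNIV)"
proof -
  let ?a = "\<lambda>n. (cmod (c n))\<^sup>2"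
  define s where "s = infsum ?a UNIV"
  have lim: "(sum ?a \<longlongrightarrow> s) (finite_subsets_at_top UNIV)"
    using has_sum_infsum[OF summ] unfolding has_sum_def s_def .
  have "\<exists>X. finite X \<and> (\<forall>A. finite A \<and> X \<subseteq> A \<longrightarrow> s - (1/4)^k < sum ?a A)" for k :: nat
    using order_tendstoD(1)[OF lim, of "s - (1/4)^k"] by (auto simp: eventually_finite_subsets_at_top)
  then obtain X where X: "\<And>k. finite (X k)" "\<And>k A. finite A \<Longrightarrow> X k \<subseteq> A \<Longrightarrow> s - (1/4)^k < sum ?a A"
    by metis
  define F where "F k = (\<Union>j\<le>k. X j)" for k
  have F: "finite (F k)" "k \<le> j \<Longrightarrow> F k \<subseteq> F j" "X k \<subseteq> F k" for k j
    unfolding F_def using X(1) by (auto intro: order_trans)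
  have le_s: "sum ?a A \<le> s" if "finite A" for A
    unfolding s_def using that by (intro finite_sum_le_infsum[OF summ]) auto
  have tail: "sum ?a (A - F k) \<le> (1/4)^k" if "finite A" "F k \<subseteq> A" for k A
  proof -
    have "sum ?a (A - F k) = sum ?a A - sum ?a (F k)" using that F by (simp add: sum_diff)
    then show ?thesis using le_s[OF that(1)] X(2)[OF F(1) F(3), of k] by simp
  qed
  obtain f where f: "f \<in> L2 circle"
    and fF: "\<And>k. (\<integral>z. (cmod (f z - (\<Sum>n\<in>F k. c n * z powi n)))\<^sup>2 \<partial>circle) \<le> 2 * pi * (1/4)^k"
    using riesz_fischer_aux[of F c, OF F(1,2) tail] by auto
  have "((\<lambda>A. L2_norm circle (\<lambda>z. f z - (\<Sum>n\<in>A. c n * z powi n))) \<longlongrightarrow> 0) (finite_subsets_at_top UNIV)"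
    unfolding tendsto_iff eventually_finite_subsets_at_top
  proof (intro allI impI)
    fix e :: real assume "0 < e"
    \<comment> \<open>The squared distance for a larger set A will be at most 2 (2 pi 4^-k) for the
      limit and as much again for the terms in A - F k, in total 8 pi 4^-k.\<close>
    then obtain k where k: "(1/4)^k < e\<^sup>2 / (8*pi)"
      using real_arch_pow_inv[of "e\<^sup>2/(8*pi)" "1/4"] by auto
    show "\<exists>X. finite X \<and> X \<subseteq> UNIV \<and> (\<forall>Y. finite Y \<and> X \<subseteq> Y \<and> Y \<subseteq> UNIV \<longrightarrow> dist (L2_norm circle (\<lambda>z. f z - (\<Sum>n\<in>Y. c n * z powi n))) 0 < e)"
    proof (intro exI[of _ "F k"] conjI allI impI F(1) subset_UNIV)
      fix A assume "finite A \<and> F k \<subseteq> A \<and> A \<subseteq> UNIV"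
      then have A: "finite A" "F k \<subseteq> A" by auto
      let ?S = "\<lambda>A z. \<Sum>n\<in>A. c n * z powi n"
      have SA: "f z - ?S A z = (f z - ?S (F k) z) + (\<Sum>n\<in>A - F k. (- c n) * z powi n)" for z
        using A F(1)[of k] by (simp add: sum_diff sum_negf)
      have "(L2_norm circle (\<lambda>z. f z - ?S A z))\<^sup>2 \<le> 2 * (\<integral>z. (cmod (f z - ?S (F k) z))\<^sup>2 \<partial>circle) + 2 * (\<integral>z. (cmod (\<Sum>n\<in>A - F k. (- c n) * z powi n))\<^sup>2 \<partial>circle)"
        unfolding L2_norm_square SA by (rule L2_integral_add_le[OF L2_diff[OF f L2_trig_sum] L2_trig_sum])
      also have "\<dots> \<le> 2 * (2 * pi * (1/4)^k) + 2 * (2 * pi * (1/4)^k)"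
      proof -
        have "(\<integral>z. (cmod (\<Sum>n\<in>A - F k. (- c n) * z powi n))\<^sup>2 \<partial>circle) = 2 * (pi * (\<Sum>n\<in>A - F k. (cmod (c n))\<^sup>2))"
          using A by (subst integral_cmod_trig_sum) auto
        then show ?thesis
          using fF[of k] mult_left_mono[OF tail[OF A] pi_ge_zero] by linarith
      qed
      also have "\<dots> < e\<^sup>2" using k by (simp add: field_simps)
      finally have "L2_norm circle (\<lambda>z. f z - ?S A z) < e"
        using \<open>0 < e\<close> by (simp add: power2_less_imp_less)
      then show "dist (L2_norm circle (\<lambda>z. f z - ?S A z)) 0 < e" by (simp add: L2_norm_nonneg)
    qed
  qed
  then show ?thesis using f by blast
qed

lemma fourier_coeff_L2_limit:
  assumes f: "f \<in> L2 circle"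
    and lim: "((\<lambda>A. L2_norm circle (\<lambda>z. f z - (\<Sum>n\<in>A. c n * z powi n))) \<longlongrightarrow> 0) (finite_subsets_at_top UNIV)"
  shows "fourier_coeff f n = c n"
proof -
  have "cmod (fourier_coeff f n - c n) \<le> 0"
  proof (rule tendsto_lowerbound[OF lim])
    have "cmod (fourier_coeff f n - c n) \<le> L2_norm circle (\<lambda>z. f z - (\<Sum>n\<in>A. c n * z powi n))"
      if A: "finite A" "{n} \<subseteq> A" for A
    proof -
      have "fourier_coeff (\<lambda>z. f z - (\<Sum>n\<in>A. c n * z powi n)) n = fourier_coeff f n - c n"
        using A by (simp add: fourier_coeff_diff circle.L2_integrable f L2_trig_sum fourier_coeff_trig_sum)
      then show ?thesis
        using fourier_coeff_bound[OF L2_diff[OF f L2_trig_sum], of c A n] by simp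
    qed
    then show "\<forall>\<^sub>F A in finite_subsets_at_top UNIV. cmod (fourier_coeff f n - c n) \<le> L2_norm circle (\<lambda>z. f z - (\<Sum>n\<in>A. c n * z powi n))"
      unfolding eventually_finite_subsets_at_top by (intro exI[of _ "{n}"]) auto
  qed simp
  then show ?thesis by simp
qed

lemma fourier_sum_L2:
  assumes "(\<lambda>n. (cmod (c n))\<^sup>2) summable_on UNIV"
  shows "fourier_sum c \<in> L2 circle"
    and "((\<lambda>A. L2_norm circle (\<lambda>z. fourier_sum c z - (\<Sum>n\<in>A. c n * z powi n))) \<longlongrightarrow> 0) (finite_subsets_at_top UNIV)"
    and "fourier_coeff (fourier_sum c) n = c n"
proof -
  show L2: "fourier_sum c \<in> L2 circle"
    and lim: "((\<lambda>A. L2_norm circle (\<lambda>z. fourier_sum c z - (\<Sum>n\<in>A. c n * z powi n))) \<longlongrightarrow> 0) (finite_subsets_at_top UNIV)"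
    using someI_ex[of "\<lambda>f. f \<in> L2 circle \<and> ((\<lambda>A. L2_norm circle (\<lambda>z. f z - (\<Sum>n\<in>A. c n * z powi n))) \<longlongrightarrow> 0) (finite_subsets_at_top UNIV)"]
      riesz_fischer[OF assms] unfolding fourier_sum_def by blast+
  show "fourier_coeff (fourier_sum c) n = c n"
    by (rule fourier_coeff_L2_limit[OF L2 lim])
qed

section \<open>Parseval's identity, and the projector and semigroup on coefficients\<close>

lemma fourier_coeff_square_summable:
  assumes f: "f \<in> L2 circle"
  shows "(\<lambda>n. (cmod (fourier_coeff f n))\<^sup>2) summable_on UNIV"
proof (rule nonneg_bdd_above_summable_on)
  show "bdd_above (sum (\<lambda>n. (cmod (fourier_coeff f n))\<^sup>2) ` {F. F \<subseteq> UNIV \<and> finite F})"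
    using fourier_bessel[OF f] by (auto intro!: bdd_aboveI2[where M="(\<integral>z. (cmod (f z))\<^sup>2 \<partial>circle) / (2*pi)"] simp: field_simps)
qed simp

lemma square_summable_mult:
  assumes "(\<lambda>n. (cmod (c n))\<^sup>2) summable_on UNIV" "\<And>n. cmod (m n) \<le> 1"
  shows "(\<lambda>n. (cmod (m n * c n))\<^sup>2) summable_on UNIV"
  by (rule summable_on_comparison_test[OF assms(1)])
     (auto simp: norm_mult power_mult_distrib assms(2) intro!: mult_left_le_one_le power_le_one)

text \<open>By completeness \<open>f\<close> is almost everywhere the sum of its own Fourier series,
  and the squared distance to a partial sum is the defect in Bessel's inequality.\<close>

lemma fourier_parseval:
  assumes f: "f \<in> L2 circle"
  shows "((\<lambda>n. 2 * pi * (cmod (fourier_coeff f n))\<^sup>2) has_sum (\<integral>z. (cmod (f z))\<^sup>2 \<partial>circle)) UNIV"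
proof -
  let ?F = "fourier_sum (fourier_coeff f)"
  note F = fourier_sum_L2[OF fourier_coeff_square_summable[OF f]]
  have AE: "AE z in circle. ?F z = f z"
    by (rule fourier_coeff_eq_imp_AE[OF F(1) f F(3)])
  note [measurable] = L2D(1)[OF f] L2D(1)[OF F(1)]
  have "L2_norm circle (\<lambda>z. ?F z - (\<Sum>n\<in>A. fourier_coeff f n * z powi n)) = L2_norm circle (\<lambda>z. f z - (\<Sum>n\<in>A. fourier_coeff f n * z powi n))" for A
    unfolding L2_norm_def using AE by (intro arg_cong[where f=sqrt] integral_cong_AE) auto
  then have "((\<lambda>A. (L2_norm circle (\<lambda>z. f z - (\<Sum>n\<in>A. fourier_coeff f n * z powi n)))\<^sup>2) \<longlongrightarrow> 0\<^sup>2) (finite_subsets_at_top UNIV)"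
    using F(2) by (intro tendsto_power) simp
  then have "((\<lambda>A. (\<integral>z. (cmod (f z))\<^sup>2 \<partial>circle) - (L2_norm circle (\<lambda>z. f z - (\<Sum>n\<in>A. fourier_coeff f n * z powi n)))\<^sup>2) \<longlongrightarrow> (\<integral>z. (cmod (f z))\<^sup>2 \<partial>circle) - 0\<^sup>2) (finite_subsets_at_top UNIV)"
    by (intro tendsto_diff tendsto_const)
  moreover have "\<forall>\<^sub>F A in finite_subsets_at_top UNIV. (\<integral>z. (cmod (f z))\<^sup>2 \<partial>circle) - (L2_norm circle (\<lambda>z. f z - (\<Sum>n\<in>A. fourier_coeff f n * z powi n)))\<^sup>2
      = (\<Sum>n\<in>A. 2 * pi * (cmod (fourier_coeff f n))\<^sup>2)"
    by (rule eventually_finite_subsets_at_top_weakI)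
       (simp add: L2_norm_square L2_distance_trig_sum[OF f] sum_negf sum_distrib_left)
  ultimately show ?thesis
    unfolding has_sum_def by (subst (asm) tendsto_cong) auto
qed

lemma riesz_proj_L2:
  assumes f: "f \<in> L2 circle"
  shows "riesz_proj f \<in> L2 circle"
    and "fourier_coeff (riesz_proj f) n = (if n \<ge> 0 then fourier_coeff f n else 0)"
proof -
  have "(\<lambda>n. (cmod ((if n \<ge> 0 then 1 else 0) * fourier_coeff f n))\<^sup>2) summable_on UNIV"
    by (rule square_summable_mult[OF fourier_coeff_square_summable[OF f]]) auto
  moreover have "(\<lambda>n. (if n \<ge> 0 then 1 else 0) * fourier_coeff f n) = (\<lambda>n. if n \<ge> 0 then fourier_coeff f n else 0)"
    by auto
  ultimately have "(\<lambda>n. (cmod (if n \<ge> 0 then fourier_coeff f n else 0))\<^sup>2) summable_on UNIV"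
    by metis
  note F = fourier_sum_L2[OF this]
  show "riesz_proj f \<in> L2 circle" unfolding riesz_proj_def by (rule F(1))
  show "fourier_coeff (riesz_proj f) n = (if n \<ge> 0 then fourier_coeff f n else 0)"
    unfolding riesz_proj_def by (rule F(3))
qed

lemma absD_semigroup_L2:
  assumes f: "f \<in> L2 circle" and t: "0 \<le> t"
  shows "absD_semigroup t f \<in> L2 circle"
    and "fourier_coeff (absD_semigroup t f) n = complex_of_real (exp (- real_of_int \<bar>n\<bar> * t)) * fourier_coeff f n"
proof -
  have "(\<lambda>n. (cmod (complex_of_real (exp (- real_of_int \<bar>n\<bar> * t)) * fourier_coeff f n))\<^sup>2) summable_on UNIV"
    by (rule square_summable_mult[OF fourier_coeff_square_summable[OF f]]) (use t in simp)
  note F = fourier_sum_L2[OF this]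
  show "absD_semigroup t f \<in> L2 circle" unfolding absD_semigroup_def by (rule F(1))
  show "fourier_coeff (absD_semigroup t f) n = complex_of_real (exp (- real_of_int \<bar>n\<bar> * t)) * fourier_coeff f n"
    unfolding absD_semigroup_def by (rule F(3))
qed

lemma H2_fourier_coeff_neg:
  assumes "f \<in> H2" "n < 0" shows "fourier_coeff f n = 0"
proof -
  obtain g where f: "f \<in> L2 circle" and g: "g \<in> L2 circle" "AE z in circle. f z = riesz_proj g z"
    using assms by (auto simp: H2_def)
  have "fourier_coeff f n = fourier_coeff (riesz_proj g) n"
    by (rule fourier_coeff_cong_AE[OF L2D(1)[OF f] L2D(1)[OF riesz_proj_L2(1)[OF g(1)]] g(2)])
  then show ?thesis using assms(2) by (simp add: riesz_proj_L2[OF g(1)])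
qed

section \<open>Bochner integrals with values in \<open>L\<^sup>2\<close>\<close>

lemma indicator_complex_integral:
  assumes "A \<in> sets M" "emeasure M A < \<infinity>"
  shows "integrable M (indicator A :: 'a \<Rightarrow> complex)"
    and "(\<integral>x. indicator A x \<partial>M) = complex_of_real (measure M A)"
proof -
  have eq: "(\<lambda>x. complex_of_real (indicator A x)) = indicator A" by (auto simp: indicator_def)
  have "integrable M (\<lambda>x. complex_of_real (indicator A x))"
    using assms by (intro integrable_of_real integrable_real_indicator)
  then show "integrable M (indicator A :: 'a \<Rightarrow> complex)" unfolding eq .
  have "A \<inter> space M = A" using assms(1) by (auto dest: sets.sets_into_space)
  then have "(\<integral>x. complex_of_real (indicator A x) \<partial>M) = complex_of_real (measure M A)"
    by simp
  then show "(\<integral>x. indicator A x \<partial>M) = complex_of_real (measure M A)" unfolding eq .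
qed

text \<open>Coefficients are bounded functionals by \<open>fourier_coeff_bound\<close> and so pass
  through both limits in the definition: \<open>a k\<close>, the coefficient of the integral of the
  k-th simple function, tends to either side.\<close>

lemma fourier_coeff_bochner:
  assumes B: "has_L2_bochner_integral M G F"
    and \<phi>: "integrable M \<phi>" "AE s in M. fourier_coeff (G s) n = \<phi> s"
  shows "fourier_coeff F n = (\<integral>s. \<phi> s \<partial>M)"
proof -
  from B obtain m :: "nat \<Rightarrow> nat" and E and h :: "nat \<Rightarrow> nat \<Rightarrow> complex \<Rightarrow> complex" where
    F: "F \<in> L2 circle" and G: "AE s in M. G s \<in> L2 circle"
    and Eh: "\<And>k j. j < m k \<Longrightarrow> E k j \<in> sets M \<and> emeasure M (E k j) < \<infinity> \<and> h k j \<in> L2 circle"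
    and int: "\<And>k. integrable M (\<lambda>s. L2_norm circle (\<lambda>z. G s z - (\<Sum>j<m k. indicator (E k j) s * h k j z)))"
    and lim1: "(\<lambda>k. \<integral>s. L2_norm circle (\<lambda>z. G s z - (\<Sum>j<m k. indicator (E k j) s * h k j z)) \<partial>M) \<longlonglongrightarrow> 0"
    and lim2: "(\<lambda>k. L2_norm circle (\<lambda>z. F z - (\<Sum>j<m k. complex_of_real (measure M (E k j)) * h k j z))) \<longlonglongrightarrow> 0"
    unfolding has_L2_bochner_integral_def by blast
  define a where "a k = (\<Sum>j<m k. complex_of_real (measure M (E k j)) * fourier_coeff (h k j) n)" for k
  have coeff: "fourier_coeff (\<lambda>z. H z - (\<Sum>j<m k. b j * h k j z)) n = fourier_coeff H n - (\<Sum>j<m k. b j * fourier_coeff (h k j) n)"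
    "(\<lambda>z. H z - (\<Sum>j<m k. b j * h k j z)) \<in> L2 circle"
    if H: "H \<in> L2 circle" for H k and b :: "nat \<Rightarrow> complex"
  proof -
    have S: "(\<lambda>z. \<Sum>j<m k. b j * h k j z) \<in> L2 circle"
      using Eh by (intro L2_sum L2_cmult) auto
    show "(\<lambda>z. H z - (\<Sum>j<m k. b j * h k j z)) \<in> L2 circle" by (rule L2_diff[OF H S])
    have "fourier_coeff (\<lambda>z. \<Sum>j<m k. b j * h k j z) n = (\<Sum>j<m k. b j * fourier_coeff (h k j) n)"
      using Eh by (subst fourier_coeff_sum) (auto simp: fourier_coeff_cmult intro!: circle.L2_integrable L2_cmult)
    then show "fourier_coeff (\<lambda>z. H z - (\<Sum>j<m k. b j * h k j z)) n = fourier_coeff H n - (\<Sum>j<m k. b j * fourier_coeff (h k j) n)"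
      by (simp add: fourier_coeff_diff circle.L2_integrable H S)
  qed
  have "(\<lambda>k. fourier_coeff F n - a k) \<longlonglongrightarrow> 0"
  proof (rule tendsto_norm_zero_cancel)
    show "(\<lambda>k. cmod (fourier_coeff F n - a k)) \<longlonglongrightarrow> 0"
      by (rule tendsto_sandwich[OF _ _ tendsto_const lim2])
         (auto intro!: always_eventually simp: a_def fourier_coeff_bound[OF coeff(2)[OF F], of _ _ n, unfolded coeff(1)[OF F]])
  qed
  moreover have "(\<lambda>k. (\<integral>s. \<phi> s \<partial>M) - a k) \<longlonglongrightarrow> 0"
  proof (rule tendsto_norm_zero_cancel)
    have "cmod ((\<integral>s. \<phi> s \<partial>M) - a k) \<le> (\<integral>s. L2_norm circle (\<lambda>z. G s z - (\<Sum>j<m k. indicator (E k j) s * h k j z)) \<partial>M)" for k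
    proof -
      let ?s = "\<lambda>s. \<Sum>j<m k. indicator (E k j) s * fourier_coeff (h k j) n"
      have s: "integrable M ?s"
        using Eh by (intro Bochner_Integration.integrable_sum integrable_mult_left indicator_complex_integral(1)) auto
      have "(\<integral>s. ?s s \<partial>M) = (\<Sum>j<m k. \<integral>s. indicator (E k j) s * fourier_coeff (h k j) n \<partial>M)"
        using Eh by (intro Bochner_Integration.integral_sum integrable_mult_left indicator_complex_integral(1)) auto
      also have "\<dots> = a k"
        unfolding a_def
      proof (intro sum.cong refl)
        fix j assume "j \<in> {..<m k}"
        then have "E k j \<in> sets M" "emeasure M (E k j) < \<infinity>" using Eh by auto
        then show "(\<integral>s. indicator (E k j) s * fourier_coeff (h k j) n \<partial>M) = complex_of_real (measure M (E k j)) * fourier_coeff (h k j) n"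
          by (simp add: indicator_complex_integral)
      qed
      finally have "(\<integral>s. \<phi> s \<partial>M) - a k = (\<integral>s. \<phi> s - ?s s \<partial>M)"
        using \<phi>(1) s by simp
      also have "cmod \<dots> \<le> (\<integral>s. cmod (\<phi> s - ?s s) \<partial>M)" by (rule integral_norm_bound)
      also have "\<dots> \<le> (\<integral>s. L2_norm circle (\<lambda>z. G s z - (\<Sum>j<m k. indicator (E k j) s * h k j z)) \<partial>M)"
      proof (rule integral_mono_AE[OF _ int])
        show "integrable M (\<lambda>s. cmod (\<phi> s - ?s s))" using \<phi>(1) s by simp
        show "AE s in M. cmod (\<phi> s - ?s s) \<le> L2_norm circle (\<lambda>z. G s z - (\<Sum>j<m k. indicator (E k j) s * h k j z))"
          using G \<phi>(2)
        proof eventually_elim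
          case (elim s)
          show ?case
            using fourier_coeff_bound[OF coeff(2)[OF elim(1)], where n=n and k1=k and b1="\<lambda>j. indicator (E k j) s"]
            unfolding coeff(1)[OF elim(1)] elim(2) .
        qed
      qed
      finally show ?thesis .
    qed
    then show "(\<lambda>k. cmod ((\<integral>s. \<phi> s \<partial>M) - a k)) \<longlonglongrightarrow> 0"
      by (intro tendsto_sandwich[OF _ _ tendsto_const lim1]) auto
  qed
  ultimately have "(\<lambda>k. (fourier_coeff F n - a k) - ((\<integral>s. \<phi> s \<partial>M) - a k)) \<longlonglongrightarrow> 0 - 0" by (rule tendsto_diff)
  then show ?thesis by (simp add: LIMSEQ_const_iff)
qed

lemma filterlim_int_intervals: "filterlim (\<lambda>N. {- int N..int N}) (finite_subsets_at_top UNIV) sequentially"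
  unfolding filterlim_iff eventually_finite_subsets_at_top
proof (safe)
  fix P :: "int set \<Rightarrow> bool" and X :: "int set"
  assume X: "finite X" and P: "\<forall>Y. finite Y \<and> X \<subseteq> Y \<and> Y \<subseteq> UNIV \<longrightarrow> P Y"
  obtain K where K: "\<And>x. x \<in> X \<Longrightarrow> \<bar>x\<bar> \<le> K"
    using X by (metis finite_imageI Max_ge imageI)
  have "X \<subseteq> {- int N..int N}" if "nat K \<le> N" for N
  proof
    fix x assume "x \<in> X" then show "x \<in> {- int N..int N}" using K[of x] that by auto
  qed
  then show "\<forall>\<^sub>F N in sequentially. P {- int N..int N}"
    using P unfolding eventually_sequentially by (intro exI[of _ "nat K"]) auto
qed

lemma parseval_limit:
  assumes f: "f \<in> L2 circle"
  shows "(\<lambda>N. \<Sum>n\<in>{- int N..int N}. 2 * pi * (cmod (fourier_coeff f n))\<^sup>2) \<longlonglongrightarrow> (\<integral>z. (cmod (f z))\<^sup>2 \<partial>circle)"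
  using filterlim_compose[OF fourier_parseval[OF f, unfolded has_sum_def] filterlim_int_intervals] by simp

text \<open>The square sum is at most the square of the sum, and 3 exceeds the square root of 2
  pi.\<close>

lemma L2_norm_trig_sum_le:
  assumes "finite A"
  shows "L2_norm circle (\<lambda>z. \<Sum>n\<in>A. a n * z powi n) \<le> 3 * (\<Sum>n\<in>A. cmod (a n))"
proof (rule power2_le_imp_le)
  have "(\<Sum>n\<in>A. (cmod (a n))\<^sup>2) \<le> (\<Sum>n\<in>A. cmod (a n))\<^sup>2"
    using assms
  proof (induction A rule: finite_induct)
    case (insert x A)
    have "0 \<le> (\<Sum>n\<in>A. cmod (a n))" by (simp add: sum_nonneg)
    then show ?case using insert by (simp add: power2_sum add_increasing2)
  qed simp
  then have "2 * pi * (\<Sum>n\<in>A. (cmod (a n))\<^sup>2) \<le> 9 * (\<Sum>n\<in>A. cmod (a n))\<^sup>2"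
    using pi_less_4 by (intro mult_mono) (auto intro: sum_nonneg)
  then show "(L2_norm circle (\<lambda>z. \<Sum>n\<in>A. a n * z powi n))\<^sup>2 \<le> (3 * (\<Sum>n\<in>A. cmod (a n)))\<^sup>2"
    by (simp add: L2_norm_square integral_cmod_trig_sum[OF assms] power_mult_distrib)
qed (simp add: sum_nonneg)

lemma integrable_simple_approx:
  fixes f :: "'a \<Rightarrow> complex"
  assumes f: "integrable M f" and e: "0 < e"
  shows "\<exists>g. simple_function M g \<and> integrable M g \<and> (\<integral>x. cmod (f x - g x) \<partial>M) \<le> e"
proof -
  obtain x where "has_bochner_integral M f x" using f by (auto simp: integrable.simps)
  then obtain s where s: "\<And>i. Bochner_Integration.simple_bochner_integrable M (s i)"
    and lim: "(\<lambda>i. \<integral>\<^sup>+x. norm (f x - s i x) \<partial>M) \<longlonglongrightarrow> 0"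
    by (auto simp: has_bochner_integral.simps)
  have "\<forall>\<^sub>F i in sequentially. (\<integral>\<^sup>+x. norm (f x - s i x) \<partial>M) < ennreal e"
    using order_tendstoD(2)[OF lim, of "ennreal e"] e by simp
  then obtain i where i: "(\<integral>\<^sup>+x. norm (f x - s i x) \<partial>M) < ennreal e"
    by (auto simp: eventually_sequentially)
  have si: "integrable M (s i)" by (rule integrableI_simple_bochner_integrable[OF s])
  have "integrable M (\<lambda>x. cmod (f x - s i x))" using f si by simp
  then have "ennreal (\<integral>x. cmod (f x - s i x) \<partial>M) = (\<integral>\<^sup>+x. norm (f x - s i x) \<partial>M)"
    by (simp add: nn_integral_eq_integral)
  also note i
  finally have "(\<integral>x. cmod (f x - s i x) \<partial>M) \<le> e" using e by (simp add: ennreal_less_iff)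
  moreover have "simple_function M (s i)" using s[of i] by (simp add: Bochner_Integration.simple_bochner_integrable.simps)
  ultimately show ?thesis using si by blast
qed

text \<open>The approximants are the Fourier series of \<open>G\<close> truncated to \<open>|n| \<le> N\<close>, with coefficients replaced
  by scalar simple functions; distances to them are measurable in \<open>s\<close> by Parseval's identity.\<close>

lemma (in finite_measure) has_L2_bochner_integralI:
  fixes G :: "'a \<Rightarrow> complex \<Rightarrow> complex"
  assumes G: "\<And>s. s \<in> space M \<Longrightarrow> G s \<in> L2 circle"
    and G2: "integrable M (\<lambda>s. \<integral>z. (cmod (G s z))\<^sup>2 \<partial>circle)"
    and meas: "\<And>n. (\<lambda>s. fourier_coeff (G s) n) \<in> borel_measurable M"
    and F: "F \<in> L2 circle" "\<And>n. fourier_coeff F n = (\<integral>s. fourier_coeff (G s) n \<partial>M)"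
  shows "has_L2_bochner_integral M G F"
proof -
  define \<phi> where "\<phi> = (\<lambda>n s. fourier_coeff (G s) n)"
  define Q where "Q = (\<lambda>s. \<integral>z. (cmod (G s z))\<^sup>2 \<partial>circle)"
  have Q: "integrable M Q" using G2 by (simp add: Q_def)
  have [measurable]: "\<phi> n \<in> borel_measurable M" "Q \<in> borel_measurable M" for n using meas Q by (auto simp: \<phi>_def)
  \<comment> \<open>A norm is at most 1 plus its square; on a finite measure space this dominates
    all norms below by the integrable function 1 + Q.\<close>
  have sqrt_le: "sqrt x \<le> 1 + x" if "0 \<le> x" for x
    using that by (intro real_le_lsqrt) (auto simp: power2_eq_square algebra_simps)
  have \<phi>: "integrable M (\<phi> n)" for n
  proof (rule Bochner_Integration.integrable_bound)
    show "integrable M (\<lambda>s. 1 + Q s)" using Q by simp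
    show "AE s in M. norm (\<phi> n s) \<le> norm (1 + Q s)"
    proof (rule AE_I2)
      fix s assume s: "s \<in> space M"
      have "0 \<le> Q s" by (simp add: Q_def)
      have "norm (\<phi> n s) \<le> sqrt (Q s)"
        using fourier_coeff_bound[OF G[OF s], of n] by (simp add: \<phi>_def Q_def L2_norm_def)
      also have "\<dots> \<le> 1 + Q s" using sqrt_le[OF \<open>0 \<le> Q s\<close>] .
      finally show "norm (\<phi> n s) \<le> norm (1 + Q s)" by simp
    qed
  qed measurable
  define S where "S N = {- int N..int N}" for N
  have finS: "finite (S N)" for N by (simp add: S_def)
  \<comment> \<open>There are 2 N + 1 frequencies in \<open>S N\<close>, so the errors
    \<open>e N\<close> add up to 1 / (N + 1).\<close>
  define e where "e N = 1 / ((real N + 1) * (2 * real N + 1))" for N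
  define p where "p N n = (SOME g. simple_function M g \<and> integrable M g \<and> (\<integral>x. cmod (\<phi> n x - g x) \<partial>M) \<le> e N)" for N n
  have "simple_function M (p N n) \<and> integrable M (p N n) \<and> (\<integral>s. cmod (\<phi> n s - p N n s) \<partial>M) \<le> e N" for N n
  proof -
    have "0 < e N" by (simp add: e_def)
    from someI_ex[OF integrable_simple_approx[OF \<phi> this]] show ?thesis unfolding p_def .
  qed
  then have p: "\<And>N n. simple_function M (p N n)" "\<And>N n. integrable M (p N n)"
    "\<And>N n. (\<integral>s. cmod (\<phi> n s - p N n s) \<partial>M) \<le> e N"
    by blast+
  have [measurable]: "p N n \<in> borel_measurable M" for N n using p(2) by auto
  \<comment> \<open>A frequency together with a value of its simple function names one level set.
    Enumerating these finitely many pairs gives the index range that the definition of the integral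
    asks for.\<close>
  define J where "J N = (SIGMA n:S N. p N n ` space M)" for N
  have finJ: "finite (J N)" for N
    unfolding J_def using finS p(1) by (intro finite_SigmaI) (auto dest: simple_functionD)
  have "\<exists>b. bij_betw b {..<card (J N)} (J N)" for N
    using ex_bij_betw_nat_finite[OF finJ[of N]] by (simp add: atLeast0LessThan)
  then obtain b where "\<forall>N. bij_betw (b N) {..<card (J N)} (J N)" using choice[of "\<lambda>N b. bij_betw b {..<card (J N)} (J N)"] by blast
  then have b: "\<And>N. bij_betw (b N) {..<card (J N)} (J N)" by blast
  define E where "E N j = {s \<in> space M. p N (fst (b N j)) s = snd (b N j)}" for N j
  define h where "h N j z = snd (b N j) * z powi (fst (b N j))" for N j and z :: complex
  have level: "{s \<in> space M. p N n s = a} \<in> sets M" for N n a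
  proof -
    have "{s \<in> space M. p N n s = a} = p N n -` {a} \<inter> space M" by auto
    then show ?thesis using simple_functionD(2)[OF p(1), of N n "{a}"] by simp
  qed
  have E: "E N j \<in> sets M" for N j
    unfolding E_def by (rule level)
  have sumJ: "(\<Sum>j<card (J N). w (b N j)) = (\<Sum>n\<in>S N. \<Sum>a\<in>p N n ` space M. w (n, a))" for N and w :: "int \<times> complex \<Rightarrow> complex"
  proof -
    have "(\<Sum>j<card (J N). w (b N j)) = (\<Sum>x\<in>J N. w x)" by (rule sum.reindex_bij_betw[OF b])
    also have "\<dots> = (\<Sum>n\<in>S N. \<Sum>a\<in>p N n ` space M. w (n, a))"
      unfolding J_def using finS p(1) by (subst sum.Sigma) (auto dest: simple_functionD)
    finally show ?thesis .
  qed
  have simple: "(\<Sum>j<card (J N). indicator (E N j) s * h N j z) = (\<Sum>n\<in>S N. p N n s * z powi n)" if s: "s \<in> space M" for N s z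
  proof -
    have "(\<Sum>j<card (J N). indicator (E N j) s * h N j z)
        = (\<Sum>n\<in>S N. \<Sum>a\<in>p N n ` space M. indicator {s \<in> space M. p N n s = a} s * (a * z powi n))"
      using sumJ[where N=N and w="\<lambda>x. indicator {s \<in> space M. p N (fst x) s = snd x} s * (snd x * z powi (fst x))"]
      by (simp add: E_def h_def)
    also have "\<dots> = (\<Sum>n\<in>S N. p N n s * z powi n)"
    proof (intro sum.cong refl)
      fix n
      have "(\<Sum>a\<in>p N n ` space M. indicator {s \<in> space M. p N n s = a} s * (a * z powi n))
         = (\<Sum>a\<in>p N n ` space M. if a = p N n s then a * z powi n else 0)"
        using s by (intro sum.cong) auto
      also have "\<dots> = p N n s * z powi n" using s simple_functionD(1)[OF p(1)] by simp
      finally show "(\<Sum>a\<in>p N n ` space M. indicator {s \<in> space M. p N n s = a} s * (a * z powi n)) = p N n s * z powi n" .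
    qed
    finally show ?thesis .
  qed
  have integral_p: "(\<Sum>a\<in>p N n ` space M. complex_of_real (measure M {s \<in> space M. p N n s = a}) * a) = (\<integral>s. p N n s \<partial>M)" for N n
  proof -
    have "(\<integral>s. p N n s \<partial>M) = (\<integral>s. (\<Sum>a\<in>p N n ` space M. indicator {s \<in> space M. p N n s = a} s *\<^sub>R a) \<partial>M)"
    proof (rule Bochner_Integration.integral_cong[OF refl])
      fix s assume s: "s \<in> space M"
      have "(\<Sum>a\<in>p N n ` space M. indicator {s \<in> space M. p N n s = a} s *\<^sub>R a) = (\<Sum>a\<in>p N n ` space M. if a = p N n s then a else 0)"
        using s by (intro sum.cong) auto
      also have "\<dots> = p N n s" using s simple_functionD(1)[OF p(1)] by simp
      finally show "p N n s = (\<Sum>a\<in>p N n ` space M. indicator {s \<in> space M. p N n s = a} s *\<^sub>R a)" by simp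
    qed
    also have "\<dots> = (\<Sum>a\<in>p N n ` space M. \<integral>s. indicator {s \<in> space M. p N n s = a} s *\<^sub>R a \<partial>M)"
      using level by (intro Bochner_Integration.integral_sum integrable_scaleR_left integrable_real_indicator) (auto simp: less_top[symmetric])
    also have "\<dots> = (\<Sum>a\<in>p N n ` space M. complex_of_real (measure M {s \<in> space M. p N n s = a}) * a)"
    proof (intro sum.cong refl)
      fix a
      have "integrable M (indicator {s \<in> space M. p N n s = a} :: 'a \<Rightarrow> real)"
        using level by (intro integrable_real_indicator) (auto simp: less_top[symmetric])
      moreover have "{s \<in> space M. p N n s = a} \<inter> space M = {s \<in> space M. p N n s = a}" by auto
      ultimately show "(\<integral>s. indicator {s \<in> space M. p N n s = a} s *\<^sub>R a \<partial>M) = complex_of_real (measure M {s \<in> space M. p N n s = a}) * a"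
        by (simp add: integral_scaleR_left scaleR_conv_of_real)
    qed
    finally show ?thesis by simp
  qed
  have simpleF: "(\<Sum>j<card (J N). complex_of_real (measure M (E N j)) * h N j z) = (\<Sum>n\<in>S N. (\<integral>s. p N n s \<partial>M) * z powi n)" for N z
  proof -
    have "(\<Sum>j<card (J N). complex_of_real (measure M (E N j)) * h N j z)
        = (\<Sum>n\<in>S N. \<Sum>a\<in>p N n ` space M. complex_of_real (measure M {s \<in> space M. p N n s = a}) * (a * z powi n))"
      using sumJ[where N=N and w="\<lambda>x. complex_of_real (measure M {s \<in> space M. p N (fst x) s = snd x}) * (snd x * z powi (fst x))"]
      by (simp add: E_def h_def)
    also have "\<dots> = (\<Sum>n\<in>S N. (\<Sum>a\<in>p N n ` space M. complex_of_real (measure M {s \<in> space M. p N n s = a}) * a) * z powi n)"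
      by (simp only: sum_distrib_right mult.assoc)
    finally show ?thesis by (simp only: integral_p)
  qed
  \<comment> \<open>\<open>R\<close> is the distance to the truncated Fourier series and tends to 0
    by dominated convergence; \<open>D\<close>, the distance to the simple function, is at most
    twice \<open>R\<close> plus the scalar errors.\<close>
  define D where "D N s = L2_norm circle (\<lambda>z. G s z - (\<Sum>n\<in>S N. p N n s * z powi n))" for N s
  define R where "R N s = L2_norm circle (\<lambda>z. G s z - (\<Sum>n\<in>S N. \<phi> n s * z powi n))" for N s
  have D_eq: "D N s = sqrt (Q s + 2 * pi * (\<Sum>n\<in>S N. (cmod (p N n s - \<phi> n s))\<^sup>2 - (cmod (\<phi> n s))\<^sup>2))" if "s \<in> space M" for N s
    unfolding D_def L2_norm_def L2_distance_trig_sum[OF G[OF that] finS] \<phi>_def Q_def ..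
  have R_eq: "R N s = sqrt (Q s - (\<Sum>n\<in>S N. 2 * pi * (cmod (\<phi> n s))\<^sup>2))" if "s \<in> space M" for N s
    unfolding R_def L2_norm_def \<phi>_def L2_distance_trig_sum[OF G[OF that] finS] Q_def by (simp add: sum_negf sum_distrib_left)
  have [measurable]: "D N \<in> borel_measurable M" "R N \<in> borel_measurable M" for N
    by (subst measurable_cong[OF D_eq], assumption, measurable) (subst measurable_cong[OF R_eq], assumption, measurable)
  have R_le: "R N s \<le> 1 + Q s" if "s \<in> space M" for N s
  proof -
    have "R N s \<le> sqrt (Q s)" unfolding R_eq[OF that] by (simp add: sum_nonneg)
    also have "\<dots> \<le> 1 + Q s" by (rule sqrt_le) (simp add: Q_def)
    finally show ?thesis .
  qed
  have R_nonneg: "0 \<le> R N s" and D_nonneg: "0 \<le> D N s" for N s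
    by (simp_all add: R_def D_def L2_norm_nonneg)
  have R_int: "integrable M (R N)" for N
  proof (rule Bochner_Integration.integrable_bound)
    show "integrable M (\<lambda>s. 1 + Q s)" using Q by simp
    show "AE s in M. norm (R N s) \<le> norm (1 + Q s)"
      using R_le[of _ N] R_nonneg[of N] by (intro AE_I2) (smt (verit) real_norm_def)
  qed measurable
  have R_lim: "(\<lambda>N. \<integral>s. R N s \<partial>M) \<longlonglongrightarrow> (\<integral>s. 0 \<partial>M)"
  proof (rule integral_dominated_convergence[where w="\<lambda>s. 1 + Q s"])
    show "AE s in M. (\<lambda>N. R N s) \<longlonglongrightarrow> 0"
    proof (rule AE_I2)
      fix s assume s: "s \<in> space M"
      have "(\<lambda>N. sqrt (Q s - (\<Sum>n\<in>S N. 2 * pi * (cmod (\<phi> n s))\<^sup>2))) \<longlonglongrightarrow> sqrt (Q s - Q s)"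
        unfolding Q_def S_def \<phi>_def by (intro tendsto_intros parseval_limit[OF G[OF s]])
      then show "(\<lambda>N. R N s) \<longlonglongrightarrow> 0" by (simp add: R_eq[OF s])
    qed
    show "AE s in M. norm (R N s) \<le> 1 + Q s" for N
      using R_le by (simp add: R_nonneg)
  qed (use Q in auto)
  have L2p: "(\<lambda>z. G s z - (\<Sum>n\<in>S N. \<phi> n s * z powi n)) \<in> L2 circle" if "s \<in> space M" for N s
    by (rule L2_diff[OF G[OF that] L2_trig_sum])
  have D_le: "D N s \<le> 2 * R N s + 6 * (\<Sum>n\<in>S N. cmod (\<phi> n s - p N n s))" if s: "s \<in> space M" for N s
  proof -
    have "D N s = L2_norm circle (\<lambda>z. (G s z - (\<Sum>n\<in>S N. \<phi> n s * z powi n)) + (\<Sum>n\<in>S N. (\<phi> n s - p N n s) * z powi n))"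
      unfolding D_def by (simp add: left_diff_distrib sum_subtractf)
    also have "\<dots> \<le> 2 * R N s + 2 * L2_norm circle (\<lambda>z. \<Sum>n\<in>S N. (\<phi> n s - p N n s) * z powi n)"
      unfolding R_def by (rule L2_norm_add_le[OF L2p[OF s] L2_trig_sum])
    also have "\<dots> \<le> 2 * R N s + 2 * (3 * (\<Sum>n\<in>S N. cmod (\<phi> n s - p N n s)))"
      by (intro add_left_mono mult_left_mono L2_norm_trig_sum_le finS) simp
    finally show ?thesis by simp
  qed
  have dom_int: "integrable M (\<lambda>s. 2 * R N s + 6 * (\<Sum>n\<in>S N. cmod (\<phi> n s - p N n s)))" for N
    using R_int \<phi> p(2) by simp
  have D_int: "integrable M (D N)" for N
  proof (rule Bochner_Integration.integrable_bound[OF dom_int[of N]])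
    show "AE s in M. norm (D N s) \<le> norm (2 * R N s + 6 * (\<Sum>n\<in>S N. cmod (\<phi> n s - p N n s)))"
      using D_le[of _ N] D_nonneg[of N] by (intro AE_I2) (smt (verit) real_norm_def)
  qed measurable
  have card_e: "real (card (S N)) * e N = 1 / (real N + 1)" for N
    by (simp add: S_def e_def divide_simps)
  have eN: "(\<lambda>N. 1 / (real N + 1)) \<longlonglongrightarrow> 0"
    using LIMSEQ_inverse_real_of_nat by (simp add: inverse_eq_divide add.commute)
  have err: "(\<Sum>n\<in>S N. \<integral>s. cmod (\<phi> n s - p N n s) \<partial>M) \<le> 1 / (real N + 1)" for N
    using sum_bounded_above[of "S N" "\<lambda>n. \<integral>s. cmod (\<phi> n s - p N n s) \<partial>M" "e N"] p(3) by (simp add: card_e)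
  have D_bound: "(\<integral>s. D N s \<partial>M) \<le> 2 * (\<integral>s. R N s \<partial>M) + 6 * (1 / (real N + 1))" for N
  proof -
    have "(\<integral>s. D N s \<partial>M) \<le> (\<integral>s. 2 * R N s + 6 * (\<Sum>n\<in>S N. cmod (\<phi> n s - p N n s)) \<partial>M)"
      by (rule integral_mono[OF D_int dom_int D_le])
    also have "\<dots> = 2 * (\<integral>s. R N s \<partial>M) + 6 * (\<Sum>n\<in>S N. \<integral>s. cmod (\<phi> n s - p N n s) \<partial>M)"
      using R_int \<phi> p(2) by simp
    finally show ?thesis using err[of N] by simp
  qed
  have D_lim: "(\<lambda>N. \<integral>s. D N s \<partial>M) \<longlonglongrightarrow> 0"
  proof (rule tendsto_sandwich[OF _ _ tendsto_const])
    show "(\<lambda>N. 2 * (\<integral>s. R N s \<partial>M) + 6 * (1 / (real N + 1))) \<longlonglongrightarrow> 0"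
      using tendsto_add[OF tendsto_mult_right_zero[of _ _ 2] tendsto_mult_right_zero[OF eN, of 6]] R_lim by simp
  qed (auto intro!: always_eventually D_bound[simplified] Bochner_Integration.integral_nonneg D_nonneg)
  define RF where "RF N = L2_norm circle (\<lambda>z. F z - (\<Sum>n\<in>S N. fourier_coeff F n * z powi n))" for N
  have RF_lim: "RF \<longlonglongrightarrow> 0"
  proof -
    have "(\<lambda>N. sqrt ((\<integral>z. (cmod (F z))\<^sup>2 \<partial>circle) - (\<Sum>n\<in>S N. 2 * pi * (cmod (fourier_coeff F n))\<^sup>2))) \<longlonglongrightarrow> sqrt ((\<integral>z. (cmod (F z))\<^sup>2 \<partial>circle) - (\<integral>z. (cmod (F z))\<^sup>2 \<partial>circle))"
      unfolding S_def by (intro tendsto_intros parseval_limit[OF F(1)])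
    then show ?thesis
      unfolding RF_def L2_norm_def L2_distance_trig_sum[OF F(1) finS] by (simp add: sum_negf sum_distrib_left)
  qed
  have F_bound: "L2_norm circle (\<lambda>z. F z - (\<Sum>n\<in>S N. (\<integral>s. p N n s \<partial>M) * z powi n)) \<le> 2 * RF N + 6 * (1 / (real N + 1))" for N
  proof -
    let ?d = "\<lambda>n. fourier_coeff F n - (\<integral>s. p N n s \<partial>M)"
    have "L2_norm circle (\<lambda>z. F z - (\<Sum>n\<in>S N. (\<integral>s. p N n s \<partial>M) * z powi n))
      = L2_norm circle (\<lambda>z. (F z - (\<Sum>n\<in>S N. fourier_coeff F n * z powi n)) + (\<Sum>n\<in>S N. ?d n * z powi n))"
      by (simp add: left_diff_distrib sum_subtractf)
    also have "\<dots> \<le> 2 * RF N + 2 * L2_norm circle (\<lambda>z. \<Sum>n\<in>S N. ?d n * z powi n)"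
      unfolding RF_def by (rule L2_norm_add_le[OF L2_diff[OF F(1) L2_trig_sum] L2_trig_sum])
    also have "\<dots> \<le> 2 * RF N + 2 * (3 * (\<Sum>n\<in>S N. cmod (?d n)))"
      by (intro add_left_mono mult_left_mono L2_norm_trig_sum_le finS) simp
    also have "(\<Sum>n\<in>S N. cmod (?d n)) \<le> (\<Sum>n\<in>S N. \<integral>s. cmod (\<phi> n s - p N n s) \<partial>M)"
    proof (rule sum_mono)
      fix n
      have "?d n = (\<integral>s. \<phi> n s - p N n s \<partial>M)" using \<phi> p(2) by (simp add: F(2) \<phi>_def)
      then show "cmod (?d n) \<le> (\<integral>s. cmod (\<phi> n s - p N n s) \<partial>M)" by (simp only: integral_norm_bound)
    qed
    finally show ?thesis using err[of N] by simp
  qed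
  have F_lim: "(\<lambda>N. L2_norm circle (\<lambda>z. F z - (\<Sum>n\<in>S N. (\<integral>s. p N n s \<partial>M) * z powi n))) \<longlonglongrightarrow> 0"
  proof (rule tendsto_sandwich[OF _ _ tendsto_const])
    show "(\<lambda>N. 2 * RF N + 6 * (1 / (real N + 1))) \<longlonglongrightarrow> 0"
      using tendsto_add[OF tendsto_mult_right_zero[OF RF_lim, of 2] tendsto_mult_right_zero[OF eN, of 6]] by simp
  qed (auto intro!: always_eventually F_bound[simplified] simp: L2_norm_nonneg)
  have D_cong: "D N s = L2_norm circle (\<lambda>z. G s z - (\<Sum>j<card (J N). indicator (E N j) s * h N j z))" if "s \<in> space M" for N s
    unfolding D_def simple[OF that] ..
  show ?thesis
    unfolding has_L2_bochner_integral_def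
  proof (intro conjI F(1) AE_I2 G exI[of _ "\<lambda>N. card (J N)"] exI[of _ E] exI[of _ h] allI impI)
    show "E N j \<in> sets M" for N j by (rule E)
    show "emeasure M (E N j) < \<infinity>" for N j by (simp add: less_top[symmetric])
    show "h N j \<in> L2 circle" for N j unfolding h_def by (intro L2_cmult L2_powi)
    show "integrable M (\<lambda>s. L2_norm circle (\<lambda>z. G s z - (\<Sum>j<card (J N). indicator (E N j) s * h N j z)))" for N
      using D_int[of N] by (rule Bochner_Integration.integrable_cong[THEN iffD1, rotated -1]) (simp_all add: D_cong)
    show "(\<lambda>N. \<integral>s. L2_norm circle (\<lambda>z. G s z - (\<Sum>j<card (J N). indicator (E N j) s * h N j z)) \<partial>M) \<longlonglongrightarrow> 0"
      using D_lim by (simp add: D_cong cong: Bochner_Integration.integral_cong)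
    show "(\<lambda>N. L2_norm circle (\<lambda>z. F z - (\<Sum>j<card (J N). complex_of_real (measure M (E N j)) * h N j z))) \<longlonglongrightarrow> 0"
      using F_lim by (simp add: simpleF)
  qed
qed

section \<open>Exponential moments of a control\<close>

abbreviation space_time :: "real \<Rightarrow> (real \<times> complex) measure" where
  "space_time T \<equiv> lebesgue_on {0..T} \<Otimes>\<^sub>M circle"

text \<open>The negative of the number c_n of the overview.\<close>

definition control_moment :: "real \<Rightarrow> (real \<times> complex \<Rightarrow> complex) \<Rightarrow> int \<Rightarrow> complex" where
  "control_moment T v n =
     (\<integral>s. complex_of_real (exp (of_int n * s)) * fourier_coeff (\<lambda>z. v (s, z)) n \<partial>lebesgue_on {0..T})"

lemma finite_measure_time: "finite_measure (lebesgue_on {0..T::real})"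
  by (rule finite_measure_lebesgue_on) (metis cbox_interval lmeasurable_cbox)

lemma pair_space_time: "pair_sigma_finite (lebesgue_on {0..T::real}) circle"
  by (intro pair_sigma_finite.intro finite_measure.axioms(1) finite_measure_time finite_measure_circle)

lemma finite_measure_space_time: "finite_measure (space_time T)"
proof -
  interpret time: finite_measure "lebesgue_on {0..T}" by (rule finite_measure_time)
  show ?thesis
    by (rule finite_measureI)
       (simp add: space_pair_measure circle.emeasure_pair_measure_Times ennreal_mult_eq_top_iff emeasure_circle time.emeasure_finite flip: space_circle)
qed

lemma space_time_space: "space (space_time T) = {0..T} \<times> sphere 0 1"
  by (simp add: space_pair_measure)

lemma time_measurable [measurable]: "fst \<in> borel_measurable (space_time T)"
proof -
  have "(\<lambda>s. s) \<in> borel_measurable (lebesgue_on {0..T})"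
    by (intro measurable_restrict_space1 measurable_completion) simp
  then show ?thesis by (rule measurable_compose[OF measurable_fst])
qed

lemma position_measurable [measurable]: "snd \<in> borel_measurable (space_time T)"
  by (rule measurable_compose[OF measurable_snd id_measurable_circle])

lemma powi_measurable_space_time [measurable]: "(\<lambda>p. snd p powi n) \<in> borel_measurable (space_time T)"
  by (rule measurable_compose[OF measurable_snd powi_measurable_circle])

lemma integrable_mult_boundedI:
  fixes f g :: "'a \<Rightarrow> complex"
  assumes "integrable M f" "g \<in> borel_measurable M" "\<And>x. x \<in> space M \<Longrightarrow> cmod (g x) \<le> C"
  shows "integrable M (\<lambda>x. f x * g x)"
proof (rule Bochner_Integration.integrable_bound)
  show "integrable M (\<lambda>x. C * f x)" using assms(1) by simp
  show "(\<lambda>x. f x * g x) \<in> borel_measurable M" using assms by measurable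
  show "AE x in M. cmod (f x * g x) \<le> cmod (C * f x)"
  proof (rule AE_I2)
    fix x assume "x \<in> space M"
    then have "cmod (g x) \<le> \<bar>C\<bar>" using assms(3)[of x] by simp
    from mult_right_mono[OF this norm_ge_zero[of "f x"]] show "cmod (f x * g x) \<le> cmod (C * f x)"
      by (simp add: norm_mult mult.commute)
  qed
qed

lemma slice_coeff_measurable:
  assumes [measurable]: "v \<in> borel_measurable (space_time T)"
  shows "(\<lambda>s. fourier_coeff (\<lambda>z. v (s, z)) n) \<in> borel_measurable (lebesgue_on {0..T})"
proof -
  have "(\<lambda>p. v p * snd p powi (-n)) \<in> borel_measurable (space_time T)" by measurable
  then have "(\<lambda>s. \<integral>z. v (s, z) * z powi (-n) \<partial>circle) \<in> borel_measurable (lebesgue_on {0..T})"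
    by (intro circle.borel_measurable_lebesgue_integral) (simp add: split_beta')
  then show ?thesis unfolding fourier_coeff_def by measurable
qed

lemma space_time_slice:
  assumes v: "v \<in> L2 (space_time T)"
  shows "AE s in lebesgue_on {0..T}. (\<lambda>z. v (s, z)) \<in> L2 circle"
    and "integrable (lebesgue_on {0..T}) (\<lambda>s. \<integral>z. (cmod (v (s, z)))\<^sup>2 \<partial>circle)"
    and "(\<lambda>s. fourier_coeff (\<lambda>z. v (s, z)) n) \<in> borel_measurable (lebesgue_on {0..T})"
proof -
  interpret pair_sigma_finite "lebesgue_on {0..T}" circle by (rule pair_space_time)
  note [measurable] = L2D(1)[OF v]
  have "AE s in lebesgue_on {0..T}. integrable circle (\<lambda>z. (cmod (v (s, z)))\<^sup>2)"
    by (rule AE_integrable_fst'[OF L2D(2)[OF v]])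
  then show "AE s in lebesgue_on {0..T}. (\<lambda>z. v (s, z)) \<in> L2 circle"
    using AE_space by eventually_elim (simp add: L2_def measurable_Pair2[OF L2D(1)[OF v]])
  show "integrable (lebesgue_on {0..T}) (\<lambda>s. \<integral>z. (cmod (v (s, z)))\<^sup>2 \<partial>circle)"
    by (rule integrable_fst'[OF L2D(2)[OF v]])
  show "(\<lambda>s. fourier_coeff (\<lambda>z. v (s, z)) n) \<in> borel_measurable (lebesgue_on {0..T})"
    by (rule slice_coeff_measurable[OF L2D(1)[OF v]])
qed

lemma integrable_slice_coeff:
  assumes v: "v \<in> L2 (space_time T)" and g: "g \<in> borel_measurable borel" "\<And>s. s \<in> {0..T} \<Longrightarrow> cmod (g s) \<le> C"
  shows "integrable (space_time T) (\<lambda>p. v p * (g (fst p) * snd p powi (-n)))"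
    and "integrable (lebesgue_on {0..T}) (\<lambda>s. g s * fourier_coeff (\<lambda>z. v (s, z)) n)"
    and "(\<integral>s. g s * fourier_coeff (\<lambda>z. v (s, z)) n \<partial>lebesgue_on {0..T}) =
      1 / (2*pi) * (\<integral>p. v p * (g (fst p) * snd p powi (-n)) \<partial>space_time T)"
proof -
  interpret pair_sigma_finite "lebesgue_on {0..T}" circle by (rule pair_space_time)
  have gm: "(\<lambda>p. g (fst p)) \<in> borel_measurable (space_time T)"
    by (rule measurable_compose[OF time_measurable g(1)])
  have vi: "integrable (space_time T) v"
    by (rule finite_measure.L2_integrable[OF finite_measure_space_time v])
  show i: "integrable (space_time T) (\<lambda>p. v p * (g (fst p) * snd p powi (-n)))"
  proof (rule integrable_mult_boundedI[OF vi, where C=C])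
    show "(\<lambda>p. g (fst p) * snd p powi (-n)) \<in> borel_measurable (space_time T)"
      using gm by measurable
    show "cmod (g (fst p) * snd p powi (-n)) \<le> C" if "p \<in> space (space_time T)" for p
      using that g(2)[of "fst p"] by (auto simp: space_time_space norm_mult cmod_powi_circle)
  qed
  have eq: "(\<integral>z. v (s, z) * (g s * z powi (-n)) \<partial>circle) = 2 * pi * (g s * fourier_coeff (\<lambda>z. v (s, z)) n)" for s
    by (simp add: fourier_coeff_def mult.left_commute[of _ "g s"])
  have "integrable (lebesgue_on {0..T}) (\<lambda>s. 2 * pi * (g s * fourier_coeff (\<lambda>z. v (s, z)) n))"
    using integrable_fst'[OF i] by (simp add: eq)
  from integrable_mult_right[OF this, of "1 / (2*pi)"]
  show "integrable (lebesgue_on {0..T}) (\<lambda>s. g s * fourier_coeff (\<lambda>z. v (s, z)) n)" by simp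
  have "(\<integral>p. v p * (g (fst p) * snd p powi (-n)) \<partial>space_time T) = (\<integral>s. 2 * pi * (g s * fourier_coeff (\<lambda>z. v (s, z)) n) \<partial>lebesgue_on {0..T})"
    using integral_fst'[OF i] by (simp add: eq)
  then show "(\<integral>s. g s * fourier_coeff (\<lambda>z. v (s, z)) n \<partial>lebesgue_on {0..T}) =
      1 / (2*pi) * (\<integral>p. v p * (g (fst p) * snd p powi (-n)) \<partial>space_time T)"
    by simp
qed

lemma exp_bounded_time: "s \<in> {0..T} \<Longrightarrow> cmod (complex_of_real (exp (a * s))) \<le> exp (\<bar>a\<bar> * T)"
proof -
  assume s: "s \<in> {0..T}"
  have "a * s \<le> \<bar>a\<bar> * s" using s by (intro mult_right_mono) auto
  also have "\<dots> \<le> \<bar>a\<bar> * T" using s by (intro mult_left_mono) auto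
  finally show ?thesis by simp
qed

lemma control_moment_eq:
  assumes v: "v \<in> L2 (space_time T)"
  shows "control_moment T v n = 1 / (2*pi) * (\<integral>p. v p * (complex_of_real (exp (of_int n * fst p)) * snd p powi (-n)) \<partial>space_time T)"
  unfolding control_moment_def
  by (rule integrable_slice_coeff(3)[OF v _ exp_bounded_time]) auto

text \<open>For n >= 0 the projector keeps the frequency n, and the semigroup at T - s multiplies it
  by exp(-nT) exp(ns). The factor exp(-nT) also multiplies the coefficient of \<open>f\<close>, so
  it cancels.\<close>

lemma final_state_coeff:
  assumes v: "v \<in> L2 (space_time T)" and T: "0 < T" and f: "f \<in> L2 circle"
    and B: "has_L2_bochner_integral (lebesgue_on {0..T}) (\<lambda>s. absD_semigroup (T - s) (riesz_proj (\<lambda>z. v (s, z)))) D"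
    and z: "AE z in circle. 0 = absD_semigroup T f z + D z" and n: "0 \<le> n"
  shows "fourier_coeff f n = - control_moment T v n"
proof -
  have D: "D \<in> L2 circle" using B by (simp add: has_L2_bochner_integral_def)
  let ?w = "\<lambda>s. complex_of_real (exp (- of_int n * T) * exp (of_int n * s))"
  have w: "cmod (?w s) \<le> exp (- of_int n * T) * exp (\<bar>of_int n\<bar> * T)" if "s \<in> {0..T}" for s
  proof -
    have "exp (of_int n * s) \<le> exp (\<bar>of_int n\<bar> * T)" using exp_bounded_time[OF that, of "of_int n"] by simp
    then show ?thesis by (simp add: norm_mult)
  qed
  have "fourier_coeff D n = (\<integral>s. ?w s * fourier_coeff (\<lambda>z. v (s, z)) n \<partial>lebesgue_on {0..T})"
  proof (rule fourier_coeff_bochner[OF B])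
    show "integrable (lebesgue_on {0..T}) (\<lambda>s. ?w s * fourier_coeff (\<lambda>z. v (s, z)) n)"
      by (rule integrable_slice_coeff(2)[OF v _ w]) auto
    show "AE s in lebesgue_on {0..T}. fourier_coeff (absD_semigroup (T - s) (riesz_proj (\<lambda>z. v (s, z)))) n = ?w s * fourier_coeff (\<lambda>z. v (s, z)) n"
      using space_time_slice(1)[OF v] AE_space
    proof eventually_elim
      case (elim s)
      then have "0 \<le> T - s" by simp
      then show ?case
        using n by (simp add: absD_semigroup_L2[OF riesz_proj_L2(1)[OF elim(1)]] riesz_proj_L2(2)[OF elim(1)] right_diff_distrib algebra_simps flip: exp_add of_real_mult)
    qed
  qed
  also have "\<dots> = complex_of_real (exp (- of_int n * T)) * control_moment T v n"
    unfolding control_moment_def by (simp add: mult.assoc)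
  finally have Dn: "fourier_coeff D n = complex_of_real (exp (- of_int n * T)) * control_moment T v n" .
  note S = absD_semigroup_L2[OF f less_imp_le[OF T]]
  have "0 = fourier_coeff (\<lambda>z. absD_semigroup T f z + D z) n"
    using fourier_coeff_cong_AE[OF _ L2D(1)[OF L2_add[OF S(1) D]] z, of n] by (simp add: fourier_coeff_def)
  also have "\<dots> = complex_of_real (exp (- of_int n * T)) * (fourier_coeff f n + control_moment T v n)"
    using n by (simp add: fourier_coeff_add circle.L2_integrable S D Dn distrib_left)
  finally show ?thesis by (simp add: eq_neg_iff_add_eq_0)
qed

section \<open>Decay of the moments of negative index\<close>

lemma time_integral_lborel:
  fixes g :: "real \<Rightarrow> 'b::{banach, second_countable_topology}"
  assumes "g \<in> borel_measurable borel"
  shows "(\<integral>s. g s \<partial>lebesgue_on {0..T}) = (\<integral>s. indicator {0..T} s *\<^sub>R g s \<partial>lborel)"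
proof -
  have "(\<integral>s. g s \<partial>lebesgue_on {0..T}) = (\<integral>s. indicator {0..T} s *\<^sub>R g s \<partial>lebesgue)"
    by (rule integral_restrict_space) simp
  also have "\<dots> = (\<integral>s. indicator {0..T} s *\<^sub>R g s \<partial>lborel)"
    using assms by (intro integral_completion) measurable
  finally show ?thesis .
qed

lemma integral_exp_time_le:
  fixes a T :: real
  assumes a: "0 < a" and T: "0 \<le> T"
  shows "(\<integral>s. exp (- a * s) \<partial>lebesgue_on {0..T}) \<le> 1 / a"
proof -
  have "(\<integral>s. exp (- a * s) \<partial>lebesgue_on {0..T}) = (\<integral>s. exp (- a * s) * indicator {0..T} s \<partial>lborel)"
    using time_integral_lborel[of "\<lambda>s. exp (- a * s)" T] by (simp add: mult.commute)
  also have "\<dots> = (- exp (- a * T) / a) - (- exp (- a * 0) / a)"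
    by (rule integral_FTC_Icc_nonneg[OF _ _ _ T]) (use a in \<open>auto intro!: derivative_eq_intros continuous_intros\<close>)
  also have "\<dots> \<le> 1 / a" using a by simp
  finally show ?thesis .
qed

lemma integrable_slice_coeff_square:
  assumes v: "v \<in> L2 (space_time T)"
  shows "integrable (lebesgue_on {0..T}) (\<lambda>s. (cmod (fourier_coeff (\<lambda>z. v (s, z)) n))\<^sup>2)"
proof (rule Bochner_Integration.integrable_bound[OF space_time_slice(2)[OF v]])
  show "(\<lambda>s. (cmod (fourier_coeff (\<lambda>z. v (s, z)) n))\<^sup>2) \<in> borel_measurable (lebesgue_on {0..T})"
    using space_time_slice(3)[OF v, of n] by measurable
  show "AE s in lebesgue_on {0..T}. norm ((cmod (fourier_coeff (\<lambda>z. v (s, z)) n))\<^sup>2) \<le> norm (\<integral>z. (cmod (v (s, z)))\<^sup>2 \<partial>circle)"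
    using space_time_slice(1)[OF v]
  proof eventually_elim
    case (elim s)
    have "(cmod (fourier_coeff (\<lambda>z. v (s, z)) n))\<^sup>2 \<le> (L2_norm circle (\<lambda>z. v (s, z)))\<^sup>2"
      by (intro power_mono fourier_coeff_bound[OF elim]) simp
    then show ?case by (simp add: L2_norm_square)
  qed
qed

text \<open>For n < 0 the weight exp(ns) has squared norm at most 1 / (2|n|) on [0, T], which is
  where the factor |n| comes from. The Cauchy-Schwarz inequality takes the form of Young's
  inequality with a parameter \<open>t\<close>.\<close>

lemma control_moment_negative_bound:
  assumes v: "v \<in> L2 (space_time T)" and n: "n < 0" and T: "0 < T"
  shows "of_int \<bar>n\<bar> * (cmod (control_moment T v n))\<^sup>2 \<le> (\<integral>s. (cmod (fourier_coeff (\<lambda>z. v (s, z)) n))\<^sup>2 \<partial>lebesgue_on {0..T})"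
proof -
  define N where "N = real_of_int \<bar>n\<bar>"
  have N: "0 < N" using n by (simp add: N_def)
  let ?\<phi> = "\<lambda>s. fourier_coeff (\<lambda>z. v (s, z)) n"
  let ?X = "\<integral>s. (cmod (?\<phi> s))\<^sup>2 \<partial>lebesgue_on {0..T}"
  define c where "c = cmod (control_moment T v n)"
  have nN: "real_of_int n = - N" using n by (simp add: N_def)
  have young: "2 * c \<le> t / (2 * N) + ?X / t" if t: "0 < t" for t
  proof -
    have "c \<le> (\<integral>s. cmod (complex_of_real (exp (of_int n * s)) * ?\<phi> s) \<partial>lebesgue_on {0..T})"
      unfolding c_def control_moment_def by (rule integral_norm_bound)
    also have "\<dots> \<le> (\<integral>s. t/2 * exp (- (2 * N) * s) + 1/(2*t) * (cmod (?\<phi> s))\<^sup>2 \<partial>lebesgue_on {0..T})"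
    proof (rule integral_mono)
      show "integrable (lebesgue_on {0..T}) (\<lambda>s. cmod (complex_of_real (exp (of_int n * s)) * ?\<phi> s))"
        by (rule integrable_norm, rule integrable_slice_coeff(2)[OF v _ exp_bounded_time]) auto
      show "integrable (lebesgue_on {0..T}) (\<lambda>s. t/2 * exp (- (2 * N) * s) + 1/(2*t) * (cmod (?\<phi> s))\<^sup>2)"
      proof (intro Bochner_Integration.integrable_add integrable_mult_right integrable_slice_coeff_square[OF v])
        show "integrable (lebesgue_on {0..T}) (\<lambda>s. exp (- (2 * N) * s))"
          by (rule finite_measure.integrable_const_bound[OF finite_measure_time, where B=1])
             (use N in \<open>auto intro!: AE_I2 measurable_restrict_space1 measurable_completion\<close>)
      qed
      fix s
      have "0 \<le> (t * exp (- N * s) - cmod (?\<phi> s))\<^sup>2" by simp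
      also have "\<dots> = t\<^sup>2 * (exp (- N * s))\<^sup>2 - 2 * t * exp (- N * s) * cmod (?\<phi> s) + (cmod (?\<phi> s))\<^sup>2"
        by (simp add: power2_diff power_mult_distrib)
      finally have "exp (- N * s) * cmod (?\<phi> s) \<le> t/2 * (exp (- N * s))\<^sup>2 + 1/(2*t) * (cmod (?\<phi> s))\<^sup>2"
        using t by (simp add: field_simps power2_eq_square)
      moreover have "(exp (- N * s))\<^sup>2 = exp (- (2 * N) * s)" by (simp flip: exp_double)
      ultimately show "cmod (complex_of_real (exp (of_int n * s)) * ?\<phi> s) \<le> t/2 * exp (- (2 * N) * s) + 1/(2*t) * (cmod (?\<phi> s))\<^sup>2"
        by (simp add: norm_mult nN)
    qed
    also have "\<dots> = t/2 * (\<integral>s. exp (- (2 * N) * s) \<partial>lebesgue_on {0..T}) + 1/(2*t) * ?X"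
    proof (subst Bochner_Integration.integral_add)
      show "integrable (lebesgue_on {0..T}) (\<lambda>s. t/2 * exp (- (2 * N) * s))"
        by (rule integrable_mult_right, rule finite_measure.integrable_const_bound[OF finite_measure_time, where B=1])
           (use N in \<open>auto intro!: AE_I2 measurable_restrict_space1 measurable_completion\<close>)
    qed (use integrable_slice_coeff_square[OF v] in auto)
    also have "\<dots> \<le> t/2 * (1 / (2 * N)) + 1/(2*t) * ?X"
      using integral_exp_time_le[of "2 * N" T] N T t by (intro add_right_mono mult_left_mono) auto
    finally show ?thesis by (simp add: field_simps)
  qed
  have "N * c\<^sup>2 \<le> ?X"
  proof (cases "c = 0")
    case False
    then have c: "0 < c" by (simp add: c_def)
    \<comment> \<open>With t = 2 N c the first term equals c and can be absorbed on the
      left.\<close>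
    have "2 * c \<le> (2 * N * c) / (2 * N) + ?X / (2 * N * c)"
      by (rule young) (use N c in simp)
    then have "2 * N * c\<^sup>2 \<le> ?X" using N c by (simp add: field_simps power2_eq_square)
    moreover have "0 \<le> N * c\<^sup>2" using N by simp
    ultimately show ?thesis by linarith
  qed simp
  then show ?thesis by (simp add: N_def c_def)
qed

text \<open>The bounds are summed under the time integral, where Bessel's inequality on each slice
  compares them with the squared norm of the control.\<close>

lemma control_moment_negative_summable:
  assumes v: "v \<in> L2 (space_time T)" and T: "0 < T"
  shows "(\<lambda>n. of_int \<bar>n\<bar> * (cmod (control_moment T v n))\<^sup>2) summable_on {..<0}"
proof (rule nonneg_bdd_above_summable_on)
  let ?\<phi> = "\<lambda>n s. fourier_coeff (\<lambda>z. v (s, z)) n"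
  show "bdd_above (sum (\<lambda>n. of_int \<bar>n\<bar> * (cmod (control_moment T v n))\<^sup>2) ` {F. F \<subseteq> {..<0} \<and> finite F})"
  proof (rule bdd_aboveI2)
    fix A :: "int set" assume "A \<in> {F. F \<subseteq> {..<0} \<and> finite F}"
    then have A: "finite A" "\<And>n. n \<in> A \<Longrightarrow> n < 0" by auto
    have "(\<Sum>n\<in>A. of_int \<bar>n\<bar> * (cmod (control_moment T v n))\<^sup>2) \<le> (\<Sum>n\<in>A. \<integral>s. (cmod (?\<phi> n s))\<^sup>2 \<partial>lebesgue_on {0..T})"
      by (intro sum_mono control_moment_negative_bound v T A)
    also have "\<dots> = (\<integral>s. (\<Sum>n\<in>A. (cmod (?\<phi> n s))\<^sup>2) \<partial>lebesgue_on {0..T})"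
      by (rule Bochner_Integration.integral_sum[symmetric]) (rule integrable_slice_coeff_square[OF v])
    also have "\<dots> \<le> (\<integral>s. (\<integral>z. (cmod (v (s, z)))\<^sup>2 \<partial>circle) \<partial>lebesgue_on {0..T})"
    proof (rule integral_mono_AE)
      show "AE s in lebesgue_on {0..T}. (\<Sum>n\<in>A. (cmod (?\<phi> n s))\<^sup>2) \<le> (\<integral>z. (cmod (v (s, z)))\<^sup>2 \<partial>circle)"
        using space_time_slice(1)[OF v]
      proof eventually_elim
        case (elim s)
        have "1 * (\<Sum>n\<in>A. (cmod (?\<phi> n s))\<^sup>2) \<le> 2 * pi * (\<Sum>n\<in>A. (cmod (?\<phi> n s))\<^sup>2)"
          using pi_gt3 by (intro mult_right_mono sum_nonneg) auto
        then show ?case using fourier_bessel[OF elim A(1)] by simp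
      qed
    qed (use integrable_slice_coeff_square[OF v] space_time_slice(2)[OF v] in auto)
    finally show "(\<Sum>n\<in>A. of_int \<bar>n\<bar> * (cmod (control_moment T v n))\<^sup>2) \<le> (\<integral>s. (\<integral>z. (cmod (v (s, z)))\<^sup>2 \<partial>circle) \<partial>lebesgue_on {0..T})" .
  qed
qed (intro mult_nonneg_nonneg, auto)

text \<open>All estimates are made on the whole cylinder \<open>space_time T\<close>. Extension by
  zero carries a control there without changing the integral of its square; conversely a function on
  the cylinder acts as a control through its values on the arc.\<close>

lemma controls_extend:
  assumes \<omega>: "\<omega> \<in> sets circle"
  shows "(u \<in> controls \<omega> T \<longrightarrow> (\<lambda>p. if snd p \<in> \<omega> then u p else 0) \<in> L2 (space_time T))"
    and "v \<in> L2 (space_time T) \<Longrightarrow> v \<in> controls \<omega> T"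
proof -
  let ?R = "lebesgue_on {0..T} \<Otimes>\<^sub>M restrict_space circle \<omega>"
  interpret pair_sigma_finite "lebesgue_on {0..T}" circle by (rule pair_space_time)
  have sub: "\<omega> \<subseteq> sphere 0 1" using sets.sets_into_space[OF \<omega>] by simp
  have fin: "finite_measure (restrict_space circle \<omega>)"
    by (rule finite_measure_restrict_space[OF finite_measure_circle]) (simp add: sub \<omega>)
  then interpret R: sigma_finite_measure "restrict_space circle \<omega>" by (rule finite_measure.axioms(1))
  have pred: "{p \<in> space (space_time T). snd p \<in> \<omega>} \<in> sets (space_time T)"
    using \<omega> by measurable
  have ident: "(\<lambda>p. p) \<in> measurable ?R (space_time T)"
  proof -
    have "snd \<in> measurable ?R circle"
      using measurable_compose[OF measurable_snd measurable_restrict_space1[OF measurable_ident], of "lebesgue_on {0..T}" circle \<omega>]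
      by (simp add: id_def)
    then have "(\<lambda>p. (fst p, snd p)) \<in> measurable ?R (space_time T)"
      by (intro measurable_Pair) auto
    then show ?thesis by simp
  qed
  have ext: "(\<integral>\<^sup>+p. h p \<partial>?R) = (\<integral>\<^sup>+p. h p * indicator \<omega> (snd p) \<partial>space_time T)"
    if h: "h \<in> borel_measurable ?R" and h': "(\<lambda>p. h p * indicator \<omega> (snd p)) \<in> borel_measurable (space_time T)" for h :: "real \<times> complex \<Rightarrow> ennreal"
  proof -
    have "(\<integral>\<^sup>+p. h p \<partial>?R) = (\<integral>\<^sup>+s. \<integral>\<^sup>+z. h (s, z) \<partial>restrict_space circle \<omega> \<partial>lebesgue_on {0..T})"
      by (rule R.nn_integral_fst[symmetric, OF h])
    also have "\<dots> = (\<integral>\<^sup>+s. \<integral>\<^sup>+z. h (s, z) * indicator \<omega> z \<partial>circle \<partial>lebesgue_on {0..T})"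
      using sub \<omega> by (simp add: nn_integral_restrict_space Int_absorb2)
    also have "\<dots> = (\<integral>\<^sup>+p. h p * indicator \<omega> (snd p) \<partial>space_time T)"
      using circle.nn_integral_fst[OF h'] by simp
    finally show ?thesis .
  qed
  show "u \<in> controls \<omega> T \<longrightarrow> (\<lambda>p. if snd p \<in> \<omega> then u p else 0) \<in> L2 (space_time T)"
  proof
    assume "u \<in> controls \<omega> T"
    then have u: "u \<in> L2 ?R" by (simp add: controls_def)
    have id2: "(\<lambda>p. p) \<in> measurable (restrict_space (space_time T) {p. snd p \<in> \<omega>}) ?R"
    proof -
      have "snd \<in> measurable (restrict_space (space_time T) {p. snd p \<in> \<omega>}) (restrict_space circle \<omega>)"
        by (intro measurable_restrict_space2 measurable_restrict_space1) (auto simp: space_restrict_space)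
      moreover have "fst \<in> measurable (restrict_space (space_time T) {p. snd p \<in> \<omega>}) (lebesgue_on {0..T})"
        by (intro measurable_restrict_space1) auto
      ultimately have "(\<lambda>p. (fst p, snd p)) \<in> measurable (restrict_space (space_time T) {p. snd p \<in> \<omega>}) ?R"
        by (intro measurable_Pair) auto
      then show ?thesis by simp
    qed
    have "u \<in> borel_measurable (restrict_space (space_time T) {p. snd p \<in> \<omega>})"
      using measurable_compose[OF id2 L2D(1)[OF u]] .
    then have m: "(\<lambda>p. if snd p \<in> \<omega> then u p else 0) \<in> borel_measurable (space_time T)"
      using pred by (subst measurable_If_restrict_space_iff) auto
    have eq: "ennreal ((cmod (if snd p \<in> \<omega> then u p else 0))\<^sup>2) = ennreal ((cmod (u p))\<^sup>2) * indicator \<omega> (snd p)" for p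
      by auto
    have "(\<lambda>p. ennreal ((cmod (if snd p \<in> \<omega> then u p else 0))\<^sup>2)) \<in> borel_measurable (space_time T)"
      using m by measurable
    then have "(\<integral>\<^sup>+p. ennreal ((cmod (u p))\<^sup>2) \<partial>?R) = (\<integral>\<^sup>+p. ennreal ((cmod (if snd p \<in> \<omega> then u p else 0))\<^sup>2) \<partial>space_time T)"
      unfolding eq using L2D(1)[OF u] by (intro ext) auto
    moreover have "(\<integral>\<^sup>+p. ennreal ((cmod (u p))\<^sup>2) \<partial>?R) < \<infinity>"
      using L2D(2)[OF u] by (simp add: integrable_iff_bounded)
    ultimately show "(\<lambda>p. if snd p \<in> \<omega> then u p else 0) \<in> L2 (space_time T)"
      using m unfolding L2_def by (simp add: integrable_iff_bounded)
  qed
  show "v \<in> controls \<omega> T" if v: "v \<in> L2 (space_time T)"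
  proof -
    have m: "v \<in> borel_measurable ?R" using measurable_compose[OF ident L2D(1)[OF v]] .
    have ind: "(\<lambda>p. indicator \<omega> (snd p) :: ennreal) \<in> borel_measurable (space_time T)"
      using \<omega> by measurable
    have "(\<integral>\<^sup>+p. ennreal ((cmod (v p))\<^sup>2) \<partial>?R) = (\<integral>\<^sup>+p. ennreal ((cmod (v p))\<^sup>2) * indicator \<omega> (snd p) \<partial>space_time T)"
      using m ind L2D(1)[OF v] by (intro ext) auto
    also have "\<dots> \<le> (\<integral>\<^sup>+p. ennreal ((cmod (v p))\<^sup>2) \<partial>space_time T)"
      by (intro nn_integral_mono) (auto split: split_indicator)
    also have "\<dots> < \<infinity>"
      using L2D(2)[OF v] by (simp add: integrable_iff_bounded)
    finally show ?thesis using m by (simp add: controls_def L2_def integrable_iff_bounded)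
  qed
qed

section \<open>The Cauchy transform of a control\<close>

definition control_sector :: "real \<Rightarrow> complex set \<Rightarrow> complex set" where
  "control_sector T \<omega> = (\<lambda>(s, w). complex_of_real (exp (- s)) * w) ` ({0..T} \<times> closure \<omega>)"

text \<open>For w = e^(ix) this is e^(s - ix), whose n-th power is the kernel of the n-th
  moment.\<close>

definition pole_param :: "real \<times> complex \<Rightarrow> complex" where
  "pole_param p = complex_of_real (exp (fst p)) * cnj (snd p)"

text \<open>The pole \<open>1 / pole_param (s, w) = e\<^sup>-\<^sup>s w\<close> of the integrand runs through the sector.\<close>

definition control_transform :: "real \<Rightarrow> (real \<times> complex \<Rightarrow> complex) \<Rightarrow> complex \<Rightarrow> complex" where
  "control_transform T v z = (\<integral>p. v p / (1 - pole_param p * z) \<partial>space_time T)"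

lemma closure_subset_sphere: "\<omega> \<subseteq> sphere 0 1 \<Longrightarrow> closure \<omega> \<subseteq> sphere (0::complex) 1"
  by (rule closure_minimal) auto

lemma compact_control_sector:
  assumes "\<omega> \<subseteq> sphere 0 1" shows "compact (control_sector T \<omega>)"
proof -
  have "compact (closure \<omega>)"
    using closure_subset_sphere[OF assms] by (metis compact_sphere compact_Int_closed closed_closure inf.absorb2)
  then have "compact ({0..T} \<times> closure \<omega>)" by (intro compact_Times) auto
  then show ?thesis
    unfolding control_sector_def by (intro compact_continuous_image) (auto intro!: continuous_intros simp: split_beta)
qed

lemma pole_param_measurable [measurable]: "pole_param \<in> borel_measurable (space_time T)"
proof -
  have "(\<lambda>p. complex_of_real (exp (fst p))) \<in> borel_measurable (space_time T)"
    by (rule measurable_compose[OF time_measurable]) measurable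
  moreover have "(\<lambda>p. cnj (snd p)) \<in> borel_measurable (space_time T)"
    by (rule measurable_compose[OF position_measurable]) (intro borel_measurable_continuous_onI continuous_intros)
  ultimately show ?thesis unfolding pole_param_def by (rule borel_measurable_times)
qed

lemma cmod_pole_param: "cmod (snd p) = 1 \<Longrightarrow> cmod (pole_param p) = exp (fst p)"
  by (simp add: pole_param_def norm_mult)

lemma pole_param_power:
  assumes "cmod (snd p) = 1"
  shows "pole_param p ^ n = complex_of_real (exp (of_int (int n) * fst p)) * snd p powi (- int n)"
    "inverse (pole_param p) ^ n = complex_of_real (exp (of_int (- int n) * fst p)) * snd p powi (- (- int n))"
proof -
  have nz: "snd p \<noteq> 0" using assms by auto
  have inv: "cnj (snd p) = inverse (snd p)"
    using powi_uminus_circle[OF assms, of 1] by (simp add: power_int_minus)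
  show 1: "pole_param p ^ n = complex_of_real (exp (of_int (int n) * fst p)) * snd p powi (- int n)"
    by (simp add: pole_param_def power_mult_distrib inv power_int_minus power_inverse exp_of_nat_mult flip: of_real_power)
  show "inverse (pole_param p) ^ n = complex_of_real (exp (of_int (- int n) * fst p)) * snd p powi (- (- int n))"
    unfolding power_inverse 1 by (simp add: power_int_minus exp_minus)
qed

text \<open>The denominator is \<open>pole_param p\<close> times the difference of the pole and
  \<open>\<zeta>\<close>, and |\<open>pole_param p\<close>| >= 1 because s >= 0. So the distance
  from the compact sector bounds it below. The bound is uniform for \<open>\<zeta>\<close> near
  \<open>z\<close>, as differentiation under the integral requires.\<close>

lemma pole_distance:
  assumes \<omega>: "\<omega> \<subseteq> sphere 0 1" and z: "z \<notin> control_sector T \<omega>"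
  shows "\<exists>r>0. \<forall>\<zeta>\<in>ball z r. \<forall>p. fst p \<in> {0..T} \<and> snd p \<in> \<omega> \<longrightarrow> r \<le> cmod (1 - pole_param p * \<zeta>)"
proof -
  have "open (- control_sector T \<omega>)"
    using compact_control_sector[OF \<omega>] by (simp add: compact_imp_closed open_Compl)
  then obtain e where e: "0 < e" "ball z e \<subseteq> - control_sector T \<omega>"
    using z by (meson ComplI open_contains_ball)
  show ?thesis
  proof (intro exI[of _ "e/2"] conjI ballI allI impI)
    show "0 < e/2" using e by simp
    fix \<zeta> p assume \<zeta>: "\<zeta> \<in> ball z (e/2)" and p: "fst p \<in> {0..T} \<and> snd p \<in> \<omega>"
    let ?b = "complex_of_real (exp (- fst p)) * snd p"
    have w1: "cmod (snd p) = 1" using p \<omega> by auto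
    have "?b \<in> control_sector T \<omega>"
      unfolding control_sector_def using p closure_subset[of \<omega>] by (auto intro!: image_eqI[where x=p] simp: split_beta mem_Times_iff)
    then have "?b \<notin> ball z e" using e by auto
    then have "e \<le> dist z ?b" by simp
    also have "\<dots> \<le> dist z \<zeta> + dist \<zeta> ?b" by (rule dist_triangle)
    finally have "e/2 \<le> cmod (?b - \<zeta>)" using \<zeta> by (simp add: dist_norm norm_minus_commute)
    also have "\<dots> \<le> exp (fst p) * cmod (?b - \<zeta>)"
      using p mult_right_mono[of 1 "exp (fst p)" "cmod (?b - \<zeta>)"] by simp
    also have "\<dots> = cmod (pole_param p * (?b - \<zeta>))"
      by (simp add: norm_mult cmod_pole_param[OF w1])
    also have "pole_param p * (?b - \<zeta>) = 1 - pole_param p * \<zeta>"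
    proof -
      have "pole_param p * ?b = complex_of_real (exp (fst p) * exp (- fst p)) * (snd p * cnj (snd p))"
        by (simp add: pole_param_def)
      also have "\<dots> = 1" unfolding mult_cnj_cmod w1 by (simp flip: exp_add)
      finally show ?thesis by (simp add: right_diff_distrib)
    qed
    finally show "e/2 \<le> cmod (1 - pole_param p * \<zeta>)" .
  qed
qed

lemma integrable_dominatedI:
  fixes f g :: "'a \<Rightarrow> complex"
  assumes "integrable M f" "g \<in> borel_measurable M" "\<And>x. x \<in> space M \<Longrightarrow> cmod (g x) \<le> C * cmod (f x)"
  shows "integrable M g"
proof (rule Bochner_Integration.integrable_bound)
  show "integrable M (\<lambda>x. C * cmod (f x))" using assms(1) by simp
  show "AE x in M. cmod (g x) \<le> norm (C * cmod (f x))"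
    using assms(3) by (intro AE_I2) (metis abs_ge_self order_trans real_norm_def)
qed (rule assms)

text \<open>To be read with A = 1 - a \<zeta>, B = 1 - a z and h = \<zeta> - z: the exact remainder
  of the difference quotient of v / (1 - a z), with its factor h exposed.\<close>

lemma difference_quotient_inverse:
  fixes v a A B h :: complex
  assumes "A \<noteq> 0" "B \<noteq> 0" "h \<noteq> 0" and AB: "B - A = a * h"
  shows "(v / A - v / B) / h - v * (a * (inverse B)\<^sup>2) = v * (h * a\<^sup>2 * inverse A * (inverse B)\<^sup>2)"
proof -
  have "v / A - v / B = v * (B - A) / (A * B)" using assms by (simp add: field_simps)
  then have 1: "(v / A - v / B) / h = v * a / (A * B)" using assms by (simp add: AB)
  have "v * a / (A * B) - v * a / (B * B) = v * a * (B - A) / (A * (B * B))"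
    using assms(1,2) by (simp add: field_simps)
  then show ?thesis
    unfolding 1 AB by (simp add: power2_eq_square divide_inverse mult.assoc mult.left_commute)
qed

text \<open>Differentiation under the integral with an explicit rate: the exact remainder and the
  lower bound \<open>r\<close> for the denominators leave at most |\<zeta> - z| times a constant
  times |v|, which is integrable.\<close>

lemma control_transform_derivative:
  assumes v: "v \<in> L2 (space_time T)" and supp: "\<And>p. snd p \<notin> \<omega> \<Longrightarrow> v p = 0"
    and \<omega>: "\<omega> \<subseteq> sphere 0 1" and z: "z \<notin> control_sector T \<omega>"
  shows "\<exists>D. (control_transform T v has_field_derivative D) (at z)"
proof -
  obtain r where r: "0 < r" and
    lower: "\<And>\<zeta> p. \<zeta> \<in> ball z r \<Longrightarrow> fst p \<in> {0..T} \<Longrightarrow> snd p \<in> \<omega> \<Longrightarrow> r \<le> cmod (1 - pole_param p * \<zeta>)"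
    using pole_distance[OF \<omega> z] by blast
  have vi: "integrable (space_time T) v"
    by (rule finite_measure.L2_integrable[OF finite_measure_space_time v])
  have [measurable]: "v \<in> borel_measurable (space_time T)" by (rule L2D(1)[OF v])
  have zr: "z \<in> ball z r" using r by simp
  let ?a = pole_param
  define D where "D = (\<integral>p. v p * ?a p / (1 - ?a p * z)\<^sup>2 \<partial>space_time T)"
  have a_le: "cmod (?a p) \<le> exp T" if "p \<in> space (space_time T)" for p
    using that by (auto simp: space_time_space cmod_pole_param)
  \<comment> \<open>Denominators are controlled only over the arc; elsewhere \<open>v\<close>
    vanishes and any bound holds.\<close>
  have cases: "cmod (v p * h) \<le> C * cmod (v p)" if "p \<in> space (space_time T)" "snd p \<in> \<omega> \<Longrightarrow> cmod h \<le> C" for p h C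
    using that supp[of p] by (cases "snd p \<in> \<omega>") (auto simp: norm_mult mult.commute[of _ "cmod (v p)"] intro!: mult_left_mono)
  have inv_le: "cmod (inverse (1 - ?a p * \<zeta>)) \<le> 1 / r"
    if "p \<in> space (space_time T)" "snd p \<in> \<omega>" "\<zeta> \<in> ball z r" for p \<zeta>
  proof -
    have "r \<le> cmod (1 - ?a p * \<zeta>)" using lower[of \<zeta> p] that by (simp add: space_time_space mem_Times_iff)
    from le_imp_inverse_le[OF this r] show ?thesis by (simp only: norm_inverse inverse_eq_divide[of r])
  qed
  have K_int: "integrable (space_time T) (\<lambda>p. v p / (1 - ?a p * \<zeta>))" if "\<zeta> \<in> ball z r" for \<zeta>
    unfolding divide_inverse
    by (rule integrable_dominatedI[OF vi, where C="1/r"]) (measurable, rule cases, assumption, rule inv_le[OF _ _ that])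
  have D_bound: "cmod (?a p * (inverse (1 - ?a p * z))\<^sup>2) \<le> exp T * (1/r)\<^sup>2"
    if "p \<in> space (space_time T)" "snd p \<in> \<omega>" for p
    unfolding norm_mult norm_power
    by (intro mult_mono power_mono a_le inv_le[OF _ _ zr] that) auto
  have D_int: "integrable (space_time T) (\<lambda>p. v p * (?a p * (inverse (1 - ?a p * z))\<^sup>2))"
    by (rule integrable_dominatedI[OF vi, where C="exp T * (1/r)\<^sup>2"]) (measurable, rule cases, assumption, rule D_bound)
  have D_eq: "D = (\<integral>p. v p * (?a p * (inverse (1 - ?a p * z))\<^sup>2) \<partial>space_time T)"
    unfolding D_def by (simp add: divide_inverse power_inverse mult.assoc)
  define C where "C = exp T * exp T * (1/r)^3 * (\<integral>p. cmod (v p) \<partial>space_time T)"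
  have est: "cmod ((control_transform T v \<zeta> - control_transform T v z) / (\<zeta> - z) - D) \<le> cmod (\<zeta> - z) * C"
    if \<zeta>: "\<zeta> \<in> ball z r" "\<zeta> \<noteq> z" for \<zeta>
  proof -
    let ?q = "\<lambda>p. (\<zeta> - z) * (?a p)\<^sup>2 * inverse (1 - ?a p * \<zeta>) * (inverse (1 - ?a p * z))\<^sup>2"
    have point: "(v p / (1 - ?a p * \<zeta>) - v p / (1 - ?a p * z)) / (\<zeta> - z) - v p * (?a p * (inverse (1 - ?a p * z))\<^sup>2) = v p * ?q p"
      if p: "p \<in> space (space_time T)" for p
    proof (cases "snd p \<in> \<omega>")
      case True
      have "1 - ?a p * \<zeta> \<noteq> 0" "1 - ?a p * z \<noteq> 0"
        using lower[OF \<zeta>(1) _ True] lower[OF zr _ True] p r by (auto simp: space_time_space)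
      then show ?thesis using \<zeta>(2) by (intro difference_quotient_inverse) (auto simp: algebra_simps)
    qed (simp add: supp)
    have "(control_transform T v \<zeta> - control_transform T v z) / (\<zeta> - z) - D
        = (\<integral>p. (v p / (1 - ?a p * \<zeta>) - v p / (1 - ?a p * z)) / (\<zeta> - z) - v p * (?a p * (inverse (1 - ?a p * z))\<^sup>2) \<partial>space_time T)"
      unfolding control_transform_def D_eq using K_int[OF \<zeta>(1)] K_int[OF zr] D_int by simp
    also have "\<dots> = (\<integral>p. v p * ?q p \<partial>space_time T)"
      by (rule Bochner_Integration.integral_cong[OF refl point])
    also have "cmod \<dots> \<le> (\<integral>p. (cmod (\<zeta> - z) * (exp T * exp T * (1/r)^3)) * cmod (v p) \<partial>space_time T)"
    proof (rule Bochner_Integration.integral_norm_bound_integral)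
      have b: "cmod (?q p) \<le> cmod (\<zeta> - z) * (exp T * exp T * (1/r)^3)"
        if p: "p \<in> space (space_time T)" "snd p \<in> \<omega>" for p
      proof -
        have "cmod (?q p) = cmod (\<zeta> - z) * (cmod (?a p) * cmod (?a p) * (cmod (inverse (1 - ?a p * \<zeta>)) * (cmod (inverse (1 - ?a p * z)))\<^sup>2))"
          by (simp only: norm_mult norm_power power2_eq_square mult.assoc)
        also have "\<dots> \<le> cmod (\<zeta> - z) * (exp T * exp T * ((1/r) * (1/r)\<^sup>2))"
          by (intro mult_left_mono mult_mono power_mono a_le inv_le[OF _ _ \<zeta>(1)] inv_le[OF _ _ zr] p) (use r in auto)
        finally show ?thesis by (simp add: power2_eq_square power3_eq_cube)
      qed
      show bb: "cmod (v p * ?q p) \<le> (cmod (\<zeta> - z) * (exp T * exp T * (1/r)^3)) * cmod (v p)"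
        if "p \<in> space (space_time T)" for p
        by (rule cases[OF that b[OF that]])
      show "integrable (space_time T) (\<lambda>p. v p * ?q p)"
        by (rule integrable_dominatedI[OF vi _ bb]) measurable
      show "integrable (space_time T) (\<lambda>p. (cmod (\<zeta> - z) * (exp T * exp T * (1/r)^3)) * cmod (v p))"
        using vi by simp
    qed
    also have "\<dots> = cmod (\<zeta> - z) * C" by (simp add: C_def)
    finally show ?thesis .
  qed
  have "((\<lambda>\<zeta>. (control_transform T v \<zeta> - control_transform T v z) / (\<zeta> - z) - D) \<longlongrightarrow> 0) (at z)"
  proof (rule tendsto_norm_zero_cancel, rule tendsto_sandwich[OF _ _ tendsto_const])
    have "((\<lambda>\<zeta>. cmod (\<zeta> - z) * C) \<longlongrightarrow> cmod (z - z) * C) (at z)" by (intro tendsto_intros)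
    then show "((\<lambda>\<zeta>. cmod (\<zeta> - z) * C) \<longlongrightarrow> 0) (at z)" by simp
    show "\<forall>\<^sub>F \<zeta> in at z. cmod ((control_transform T v \<zeta> - control_transform T v z) / (\<zeta> - z) - D) \<le> cmod (\<zeta> - z) * C"
      unfolding eventually_at using r est by (intro exI[of _ r]) (auto simp: dist_commute)
  qed simp
  then have "(control_transform T v has_field_derivative D) (at z)"
    unfolding has_field_derivative_iff by (simp add: LIM_zero_iff)
  then show ?thesis by blast
qed

section \<open>Expansions of the Cauchy transform inside and outside the disc\<close>

lemma sums_integral_geometric:
  fixes v q :: "'a \<Rightarrow> complex"
  assumes v: "integrable M v" and qm: "q \<in> borel_measurable M"
    and q: "\<And>x. x \<in> space M \<Longrightarrow> cmod (q x) \<le> \<rho>" and \<rho>: "0 \<le> \<rho>" "\<rho> < 1"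
  shows "(\<lambda>n. \<integral>x. v x * q x ^ n \<partial>M) sums (\<integral>x. v x / (1 - q x) \<partial>M)"
proof -
  have [measurable]: "v \<in> borel_measurable M" "q \<in> borel_measurable M" using v qm by auto
  have le: "cmod (v x * q x ^ n) \<le> \<rho> ^ n * cmod (v x)" if "x \<in> space M" for x n
    using power_mono[OF q[OF that] norm_ge_zero, of n]
    by (simp add: norm_mult norm_power mult.commute[of "cmod (v x)"] mult_right_mono)
  have int: "integrable M (\<lambda>x. v x * q x ^ n)" for n
    by (rule integrable_dominatedI[OF v _ le]) measurable
  have geo: "summable (\<lambda>n. \<rho> ^ n * c)" for c
    using \<rho> by (intro summable_mult2 summable_geometric) simp
  have "(\<lambda>n. \<integral>x. v x * q x ^ n \<partial>M) sums (\<integral>x. (\<Sum>n. v x * q x ^ n) \<partial>M)"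
  proof (rule sums_integral[OF int])
    show "AE x in M. summable (\<lambda>n. cmod (v x * q x ^ n))"
    proof (rule AE_I2)
      fix x assume "x \<in> space M"
      from le[OF this] show "summable (\<lambda>n. cmod (v x * q x ^ n))"
        by (intro summable_comparison_test'[OF geo, where N=0]) simp
    qed
    have "(\<integral>x. cmod (v x * q x ^ n) \<partial>M) \<le> (\<integral>x. \<rho> ^ n * cmod (v x) \<partial>M)" for n
      by (rule integral_mono[OF integrable_norm[OF int] _ le]) (use v in auto)
    then show "summable (\<lambda>n. \<integral>x. cmod (v x * q x ^ n) \<partial>M)"
      by (intro summable_comparison_test'[OF geo[of "\<integral>x. cmod (v x) \<partial>M"], where N=0]) simp
  qed
  also have "(\<integral>x. (\<Sum>n. v x * q x ^ n) \<partial>M) = (\<integral>x. v x / (1 - q x) \<partial>M)"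
  proof (rule Bochner_Integration.integral_cong[OF refl])
    fix x assume "x \<in> space M"
    then have "cmod (q x) < 1" using q \<rho> by (meson le_less_trans)
    then show "(\<Sum>n. v x * q x ^ n) = v x / (1 - q x)"
      by (simp add: suminf_mult summable_geometric suminf_geometric)
  qed
  finally show ?thesis .
qed

text \<open>All poles have modulus at least exp(-T), so for smaller |z| the integrand is a geometric
  series in \<open>pole_param p * z\<close>, whose powers are the kernels of the moments.\<close>

lemma control_transform_inside:
  assumes v: "v \<in> L2 (space_time T)" and z: "exp T * cmod z < 1"
  shows "(\<lambda>n. control_moment T v (int n) * z ^ n) sums (control_transform T v z / (2 * pi))"
proof -
  have vi: "integrable (space_time T) v"
    by (rule finite_measure.L2_integrable[OF finite_measure_space_time v])
  have q: "cmod (pole_param p * z) \<le> exp T * cmod z" if "p \<in> space (space_time T)" for p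
    using that by (auto simp: space_time_space norm_mult cmod_pole_param intro!: mult_right_mono)
  have "(\<lambda>n. \<integral>p. v p * (pole_param p * z) ^ n \<partial>space_time T) sums control_transform T v z"
    unfolding control_transform_def by (rule sums_integral_geometric[OF vi _ q _ z]) auto
  from sums_mult[OF this, of "1 / (2*pi)"]
  have "(\<lambda>n. 1 / (2*pi) * (\<integral>p. v p * (pole_param p * z) ^ n \<partial>space_time T)) sums (1 / (2*pi) * control_transform T v z)"
    by simp
  moreover have "1 / (2*pi) * (\<integral>p. v p * (pole_param p * z) ^ n \<partial>space_time T) = control_moment T v (int n) * z ^ n" for n
  proof -
    have "(\<integral>p. v p * (pole_param p * z) ^ n \<partial>space_time T) = (\<integral>p. v p * (complex_of_real (exp (of_int (int n) * fst p)) * snd p powi (- int n)) * z ^ n \<partial>space_time T)"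
      by (rule Bochner_Integration.integral_cong) (auto simp: space_time_space power_mult_distrib pole_param_power)
    then show ?thesis unfolding control_moment_eq[OF v] by simp
  qed
  ultimately show ?thesis by simp
qed

text \<open>Here the integrand is expanded in powers of 1 / (\<open>pole_param p\<close> z). The
  expansion begins with the first power, hence \<open>Suc n\<close>, and carries a minus sign: that
  sign turns the sum of the two one-sided series into a difference of values of one
  function.\<close>

lemma control_transform_outside:
  assumes v: "v \<in> L2 (space_time T)" and z: "1 < cmod z"
  shows "(\<lambda>n. control_moment T v (- int (Suc n)) * inverse z ^ Suc n) sums (- control_transform T v z / (2 * pi))"
proof -
  have vi: "integrable (space_time T) v"
    by (rule finite_measure.L2_integrable[OF finite_measure_space_time v])
  have \<rho>: "0 \<le> inverse (cmod z)" "inverse (cmod z) < 1" using z by (auto simp: divide_simps)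
  let ?q = "\<lambda>p. inverse (pole_param p) * inverse z"
  have q: "cmod (?q p) \<le> inverse (cmod z)" if "p \<in> space (space_time T)" for p
  proof -
    have "1 \<le> cmod (pole_param p)" using that by (auto simp: space_time_space cmod_pole_param)
    then have "inverse (cmod (pole_param p)) \<le> 1" by (simp add: divide_simps)
    from mult_right_mono[OF this \<rho>(1)] show ?thesis by (simp add: norm_mult norm_inverse)
  qed
  have qm: "?q \<in> borel_measurable (space_time T)" by measurable
  have vq: "integrable (space_time T) (\<lambda>p. v p * ?q p)"
    by (rule integrable_mult_boundedI[OF vi qm q])
  have "(\<lambda>n. \<integral>p. v p * ?q p * ?q p ^ n \<partial>space_time T) sums (\<integral>p. v p * ?q p / (1 - ?q p) \<partial>space_time T)"
    by (rule sums_integral_geometric[OF vq qm q \<rho>])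
  also have "(\<integral>p. v p * ?q p / (1 - ?q p) \<partial>space_time T) = (\<integral>p. - (v p / (1 - pole_param p * z)) \<partial>space_time T)"
  proof (rule Bochner_Integration.integral_cong[OF refl])
    fix p assume p: "p \<in> space (space_time T)"
    then have "cmod (?q p) < 1" using q \<rho> by (meson le_less_trans)
    then have q1: "1 - ?q p \<noteq> 0" by auto
    have nz: "pole_param p \<noteq> 0" "z \<noteq> 0" using p z by (auto simp: space_time_space pole_param_def)
    have "1 - pole_param p * z \<noteq> 0" using nz q1 by (auto simp: field_simps)
    then have "?q p * (1 / (1 - ?q p)) = - (1 / (1 - pole_param p * z))"
      using nz q1 by (simp add: field_simps)
    from arg_cong[OF this, of "(*) (v p)"]
    show "v p * ?q p / (1 - ?q p) = - (v p / (1 - pole_param p * z))" by simp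
  qed
  also have "\<dots> = - control_transform T v z"
    unfolding control_transform_def by (rule integral_minus)
  finally have "(\<lambda>n. \<integral>p. v p * ?q p ^ Suc n \<partial>space_time T) sums - control_transform T v z"
    by (simp only: power_Suc mult.assoc)
  from sums_mult[OF this, of "1 / (2*pi)"]
  have "(\<lambda>n. 1 / (2*pi) * (\<integral>p. v p * ?q p ^ Suc n \<partial>space_time T)) sums (1 / (2*pi) * - control_transform T v z)"
    by simp
  moreover have "1 / (2*pi) * (\<integral>p. v p * ?q p ^ Suc n \<partial>space_time T) = control_moment T v (- int (Suc n)) * inverse z ^ Suc n" for n
  proof -
    have "(\<integral>p. v p * ?q p ^ Suc n \<partial>space_time T) = (\<integral>p. v p * (complex_of_real (exp (of_int (- int (Suc n)) * fst p)) * snd p powi (- (- int (Suc n)))) * inverse z ^ Suc n \<partial>space_time T)"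
    proof (rule Bochner_Integration.integral_cong[OF refl])
      fix p assume "p \<in> space (space_time T)"
      then have "cmod (snd p) = 1" by (auto simp: space_time_space)
      from pole_param_power(2)[OF this, of "Suc n"]
      show "v p * ?q p ^ Suc n = v p * (complex_of_real (exp (of_int (- int (Suc n)) * fst p)) * snd p powi (- (- int (Suc n)))) * inverse z ^ Suc n"
        by (simp only: power_mult_distrib mult.assoc)
    qed
    also have "\<dots> = (\<integral>p. v p * (complex_of_real (exp (of_int (- int (Suc n)) * fst p)) * snd p powi (- (- int (Suc n)))) \<partial>space_time T) * inverse z ^ Suc n"
      by (rule integral_mult_left_zero)
    finally show ?thesis unfolding control_moment_eq[OF v] by (simp only: mult.assoc)
  qed
  ultimately show ?thesis by simp
qed

text \<open>Bounded moments make the power series holomorphic in the whole disc, while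
  \<open>control_transform_inside\<close> identifies it only for |z| < exp(-T). The identity theorem
  extends the equality past the sector up to the circle.\<close>

lemma control_transform_continuation:
  assumes v: "v \<in> L2 (space_time T)" and supp: "\<And>p. snd p \<notin> \<omega> \<Longrightarrow> v p = 0"
    and \<omega>: "\<omega> \<subseteq> sphere 0 1" and T: "0 < T"
    and bound: "\<And>n. cmod (control_moment T v (int n)) \<le> B"
    and z: "cmod z < 1" "z \<notin> control_sector T \<omega>"
  shows "(\<lambda>n. control_moment T v (int n) * z ^ n) sums (control_transform T v z / (2 * pi))"
proof -
  define G where "G z = (\<Sum>n. control_moment T v (int n) * z ^ n)" for z
  have sums: "(\<lambda>n. control_moment T v (int n) * z ^ n) sums G z" if "cmod z < 1" for z
  proof -
    have "summable (\<lambda>n. control_moment T v (int n) * z ^ n)"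
    proof (rule summable_comparison_test'[where N=0 and g="\<lambda>n. B * cmod z ^ n"])
      show "summable (\<lambda>n. B * cmod z ^ n)" using that by (intro summable_mult summable_geometric) simp
      show "norm (control_moment T v (int n) * z ^ n) \<le> B * cmod z ^ n" for n
        using bound[of n] by (simp add: norm_mult norm_power mult_right_mono)
    qed
    then show ?thesis by (simp add: G_def summable_sums)
  qed
  have Ghol: "G holomorphic_on ball 0 1"
    by (rule power_series_holomorphic[where a="\<lambda>n. control_moment T v (int n)"]) (use sums in simp)
  let ?U = "ball 0 1 - control_sector T \<omega>"
  have closed: "closed (control_sector T \<omega>)" by (rule compact_imp_closed[OF compact_control_sector[OF \<omega>]])
  have norm_sector: "exp (- T) \<le> cmod b" if "b \<in> control_sector T \<omega>" for b
    using that closure_subset_sphere[OF \<omega>] by (auto simp: control_sector_def norm_mult)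
  \<comment> \<open>Moving outward from a point exp(-s) w of the sector lowers s, which stays
    nonnegative inside the disc, so one remains in the sector. Hence a point outside it has its
    whole segment to 0 outside.\<close>
  have star: "starlike ?U"
    unfolding starlike_def
  proof (intro bexI[of _ 0] ballI subsetI)
    show "0 \<in> ?U" using norm_sector[of 0] by auto
    fix x y assume x: "x \<in> ?U" and y: "y \<in> closed_segment 0 x"
    then obtain t where t: "0 \<le> t" "t \<le> 1" and yt: "y = complex_of_real t * x"
      by (auto simp: closed_segment_def scaleR_conv_of_real)
    have "cmod y \<le> cmod x" using t by (simp add: yt norm_mult mult_left_le_one_le)
    then have y1: "cmod y < 1" using x by simp
    have "y \<notin> control_sector T \<omega>"
    proof
      assume "y \<in> control_sector T \<omega>"
      then obtain s w where sw: "s \<in> {0..T}" "w \<in> closure \<omega>" "y = complex_of_real (exp (- s)) * w"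
        by (auto simp: control_sector_def)
      have w: "cmod w = 1" using sw closure_subset_sphere[OF \<omega>] by auto
      have "y \<noteq> 0" using sw w by auto
      then have t0: "0 < t" using t yt by (cases "t = 0") auto
      define s' where "s' = s + ln t"
      have xs: "x = complex_of_real (exp (- s')) * w"
      proof -
        have "exp (- s') = exp (- s) / t" using t0 by (simp add: s'_def exp_add exp_minus divide_simps exp_diff)
        then have "exp (- s) = t * exp (- s')" using t0 by simp
        then have "complex_of_real t * x = complex_of_real t * (complex_of_real (exp (- s')) * w)"
          using yt sw(3) by (simp flip: mult.assoc of_real_mult)
        then show ?thesis using t0 by simp
      qed
      have "exp (- s') < 1" using x w by (simp add: xs norm_mult)
      then have "0 \<le> s'" by simp
      moreover have "ln t \<le> 0" using t t0 by simp
      then have "s' \<le> T" using sw(1) unfolding s'_def by (simp only: atLeastAtMost_iff) linarith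
      ultimately have "x \<in> control_sector T \<omega>"
        unfolding control_sector_def xs using sw(2) by (intro image_eqI[where x="(s', w)"]) auto
      then show False using x by simp
    qed
    then show "y \<in> ?U" using y1 by simp
  qed
  have Khol: "(\<lambda>z. control_transform T v z / (2 * pi)) holomorphic_on ?U"
  proof -
    have "open ?U" using closed by (intro open_Diff) auto
    moreover have "control_transform T v field_differentiable at x" if "x \<in> ?U" for x
      using control_transform_derivative[OF v supp \<omega>, of x] that by (auto simp: field_differentiable_def)
    ultimately have "control_transform T v holomorphic_on ?U"
      by (simp add: holomorphic_on_open field_differentiable_def)
    then show ?thesis by (intro holomorphic_intros) auto
  qed
  have "G z = control_transform T v z / (2 * pi)"
  proof (rule analytic_continuation_open[where s="ball 0 (exp (- T))" and s'="?U" and f=G and g="\<lambda>z. control_transform T v z / (2 * pi)"])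
    show "open ?U" using closed by (intro open_Diff) auto
    show "connected ?U" by (rule starlike_imp_connected[OF star])
    show "G holomorphic_on ?U" using Ghol by (rule holomorphic_on_subset) auto
    show "ball 0 (exp (- T)) \<subseteq> ?U"
    proof
      fix y :: complex assume "y \<in> ball 0 (exp (- T))"
      then have "cmod y < exp (- T)" by simp
      moreover have "exp (- T) < 1" using T by simp
      ultimately have "cmod y < 1" "\<not> exp (- T) \<le> cmod y" by linarith+
      then show "y \<in> ?U" using norm_sector[of y] by auto
    qed
    show "G y = control_transform T v y / (2 * pi)" if "y \<in> ball 0 (exp (- T))" for y
    proof -
      have y: "cmod y < exp (- T)" using that by simp
      then have "exp T * cmod y < exp T * exp (- T)" by (intro mult_strict_left_mono) auto
      then have "exp T * cmod y < 1" by (simp flip: exp_add)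
      from sums_unique[OF control_transform_inside[OF v this]] show ?thesis by (simp add: G_def)
    qed
  qed (use z Khol in auto)
  then show ?thesis using sums[OF z(1)] by simp
qed

section \<open>Vanishing of the projected function off the arc\<close>

text \<open>Rewriting unordered sums as integrals for the counting measure opens them to dominated
  convergence and Tonelli's theorem.\<close>

lemma has_sum_nn_integral_count_space:
  fixes a :: "'a \<Rightarrow> real"
  assumes s: "(a has_sum s) A" and nn: "\<And>n. n \<in> A \<Longrightarrow> 0 \<le> a n"
  shows "(\<integral>\<^sup>+n. ennreal (a n) \<partial>count_space A) = ennreal s"
proof -
  have "a summable_on A" using s by (auto simp: summable_on_def)
  then have abs: "(\<lambda>n. norm (a n)) summable_on A"
    by (rule summable_on_cong[THEN iffD1, rotated -1]) (simp add: nn)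
  then have int: "integrable (count_space A) a"
    using abs_summable_equivalent[of a A] by (simp add: Infinite_Set_Sum.abs_summable_on_def)
  have "(\<integral>n. a n \<partial>count_space A) = infsum a A"
    using infsetsum_infsum[of a A] abs abs_summable_equivalent[of a A] by (simp add: infsetsum_def)
  then show ?thesis
    using nn_integral_eq_integral[OF int] nn infsumI[OF s] by (simp add: AE_count_space)
qed

lemma parseval_nn_integral:
  assumes f: "f \<in> L2 circle"
  shows "(\<integral>\<^sup>+z. ennreal ((cmod (f z))\<^sup>2) \<partial>circle) = (\<integral>\<^sup>+n. ennreal (2 * pi * (cmod (fourier_coeff f n))\<^sup>2) \<partial>count_space UNIV)"
  using has_sum_nn_integral_count_space[OF fourier_parseval[OF f]] L2D(2)[OF f]
  by (simp add: nn_integral_eq_integral)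

section \<open>Abel means of a Fourier series\<close>

lemma abs_convergent_fourier_series:
  fixes \<beta> :: "nat \<Rightarrow> complex" and e :: "nat \<Rightarrow> int"
  assumes \<beta>: "summable (\<lambda>n. cmod (\<beta> n))"
  shows "(\<lambda>z. \<Sum>n. \<beta> n * z powi e n) \<in> L2 circle"
    and "(\<lambda>n. if e n = m then \<beta> n else 0) sums fourier_coeff (\<lambda>z. \<Sum>n. \<beta> n * z powi e n) m"
proof -
  have term_norm: "cmod (\<beta> n * z powi k) = cmod (\<beta> n)" if "z \<in> space circle" for n z k
    using that by (simp add: norm_mult cmod_powi_circle)
  have summ: "summable (\<lambda>n. cmod (\<beta> n * z powi e n))" if "z \<in> space circle" for z
    using \<beta> by (simp only: term_norm[OF that])
  show "(\<lambda>z. \<Sum>n. \<beta> n * z powi e n) \<in> L2 circle"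
  proof (rule circle.L2_boundedI)
    show "(\<lambda>z. \<Sum>n. \<beta> n * z powi e n) \<in> borel_measurable circle" by measurable
    show "cmod (\<Sum>n. \<beta> n * z powi e n) \<le> (\<Sum>n. cmod (\<beta> n))" if "z \<in> space circle" for z
      using summable_norm[OF summ[OF that]] by (simp only: term_norm[OF that])
  qed
  have int: "integrable circle (\<lambda>z. \<beta> n * z powi e n * z powi (-m))" for n
    by (intro integrable_mult_powi circle.L2_integrable L2_cmult L2_powi)
  have norm3: "cmod (\<beta> n * z powi e n * z powi (-m)) = cmod (\<beta> n)" if "z \<in> space circle" for n z
    using that by (simp add: norm_mult cmod_powi_circle)
  have "(\<lambda>n. \<integral>z. \<beta> n * z powi e n * z powi (-m) \<partial>circle) sums (\<integral>z. (\<Sum>n. \<beta> n * z powi e n * z powi (-m)) \<partial>circle)"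
  proof (rule sums_integral[OF int])
    show "AE z in circle. summable (\<lambda>n. cmod (\<beta> n * z powi e n * z powi (-m)))"
      using \<beta> by (intro AE_I2) (simp only: norm3)
    have "(\<integral>z. cmod (\<beta> n * z powi e n * z powi (-m)) \<partial>circle) = (\<integral>z. cmod (\<beta> n) \<partial>circle)" for n
      by (rule Bochner_Integration.integral_cong[OF refl norm3])
    then show "summable (\<lambda>n. \<integral>z. cmod (\<beta> n * z powi e n * z powi (-m)) \<partial>circle)"
      using \<beta> by (simp add: summable_mult)
  qed
  also have "(\<integral>z. (\<Sum>n. \<beta> n * z powi e n * z powi (-m)) \<partial>circle) = (\<integral>z. (\<Sum>n. \<beta> n * z powi e n) * z powi (-m) \<partial>circle)"
    by (rule Bochner_Integration.integral_cong[OF refl]) (rule suminf_mult2[symmetric, OF summable_norm_cancel[OF summ]])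
  finally have "(\<lambda>n. 1 / (2*pi) * (\<integral>z. \<beta> n * z powi e n * z powi (-m) \<partial>circle)) sums fourier_coeff (\<lambda>z. \<Sum>n. \<beta> n * z powi e n) m"
    unfolding fourier_coeff_def by (rule sums_mult)
  moreover have "1 / (2*pi) * (\<integral>z. \<beta> n * z powi e n * z powi (-m) \<partial>circle) = (if e n = m then \<beta> n else 0)" for n
    using fourier_coeff_cmult[of "\<beta> n" "\<lambda>z. z powi e n" m] by (simp add: fourier_coeff_powi fourier_coeff_def[of "\<lambda>z. \<beta> n * z powi e n"])
  ultimately show "(\<lambda>n. if e n = m then \<beta> n else 0) sums fourier_coeff (\<lambda>z. \<Sum>n. \<beta> n * z powi e n) m"
    by simp
qed

text \<open>The Poisson extension at radius r, split at frequency 0 so that each half matches one of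
  the two expansions of the Cauchy transform.\<close>

definition abel_mean :: "(int \<Rightarrow> complex) \<Rightarrow> real \<Rightarrow> complex \<Rightarrow> complex" where
  "abel_mean c r z = (\<Sum>n. c (int n) * complex_of_real (r ^ n) * z powi int n)
     + (\<Sum>n. c (- int (Suc n)) * complex_of_real (r ^ Suc n) * z powi (- int (Suc n)))"

lemma abel_mean_L2:
  assumes c: "\<And>n. cmod (c n) \<le> B" and r: "0 \<le> r" "r < 1"
  shows "abel_mean c r \<in> L2 circle"
    and "fourier_coeff (abel_mean c r) m = c m * complex_of_real (r ^ nat \<bar>m\<bar>)"
proof -
  have geo: "summable (\<lambda>n. B * r ^ n)" "summable (\<lambda>n. B * r ^ Suc n)"
    using r by (intro summable_mult iffD2[OF summable_Suc_iff] summable_geometric; simp)+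
  have s1: "summable (\<lambda>n. cmod (c (int n) * complex_of_real (r ^ n)))"
    by (rule summable_comparison_test'[OF geo(1), where N=0]) (use c r in \<open>simp add: norm_mult norm_power mult_right_mono\<close>)
  have s2: "summable (\<lambda>n. cmod (c (- int (Suc n)) * complex_of_real (r ^ Suc n)))"
  proof (rule summable_comparison_test'[OF geo(2), where N=0])
    fix n
    have "cmod (c (- int (Suc n))) * r ^ Suc n \<le> B * r ^ Suc n" using c r by (intro mult_right_mono) auto
    then show "norm (cmod (c (- int (Suc n)) * complex_of_real (r ^ Suc n))) \<le> B * r ^ Suc n"
      using r by (simp only: norm_mult norm_of_real abs_of_nonneg zero_le_power) (simp add: norm_mult)
  qed
  note S1 = abs_convergent_fourier_series[OF s1, of int] and S2 = abs_convergent_fourier_series[OF s2, of "\<lambda>n. - int (Suc n)"]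
  show "abel_mean c r \<in> L2 circle"
    using L2_add[OF S1(1) S2(1)] unfolding abel_mean_def[abs_def] .
  have "fourier_coeff (abel_mean c r) m = fourier_coeff (\<lambda>z. \<Sum>n. c (int n) * complex_of_real (r ^ n) * z powi int n) m
      + fourier_coeff (\<lambda>z. \<Sum>n. c (- int (Suc n)) * complex_of_real (r ^ Suc n) * z powi (- int (Suc n))) m"
    unfolding abel_mean_def[abs_def] by (rule fourier_coeff_add[OF circle.L2_integrable[OF S1(1)] circle.L2_integrable[OF S2(1)]])
  also have "\<dots> = c m * complex_of_real (r ^ nat \<bar>m\<bar>)" (is "?f1 + ?f2 = _")
  proof (cases "0 \<le> m")
    case True
    have "(\<lambda>n. if int n = m then c (int n) * complex_of_real (r ^ n) else 0) = (\<lambda>n. if n = nat m then c m * complex_of_real (r ^ nat m) else 0)"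
      using True by (intro ext) auto
    from S1(2)[of m, unfolded this] have 1: "?f1 = c m * complex_of_real (r ^ nat m)"
      by (rule sums_unique2[OF _ sums_single])
    have "(\<lambda>n. if - int (Suc n) = m then c (- int (Suc n)) * complex_of_real (r ^ Suc n) else 0) = (\<lambda>n. 0)"
      using True by (intro ext) auto
    from S2(2)[of m, unfolded this] have 2: "?f2 = 0"
      by (rule sums_unique2[OF _ sums_zero])
    have "nat \<bar>m\<bar> = nat m" using True by simp
    then show ?thesis unfolding 1 2 by (simp only: add_0_right)
  next
    case False
    define k where "k = nat (- m - 1)"
    have k: "m = - int (Suc k)" using False by (simp add: k_def)
    have "(\<lambda>n. if int n = m then c (int n) * complex_of_real (r ^ n) else 0) = (\<lambda>n. 0)"
      using False by (intro ext) auto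
    from S1(2)[of m, unfolded this] have 1: "?f1 = 0"
      by (rule sums_unique2[OF _ sums_zero])
    have "(\<lambda>n. if - int (Suc n) = m then c (- int (Suc n)) * complex_of_real (r ^ Suc n) else 0) = (\<lambda>n. if n = k then c m * complex_of_real (r ^ Suc k) else 0)"
      using k by (intro ext) auto
    from S2(2)[of m, unfolded this] have 2: "?f2 = c m * complex_of_real (r ^ Suc k)"
      by (rule sums_unique2[OF _ sums_single])
    have "nat \<bar>m\<bar> = Suc k" using k by simp
    then show ?thesis unfolding 1 2 by (simp only: add_0_left)
  qed
  finally show "fourier_coeff (abel_mean c r) m = c m * complex_of_real (r ^ nat \<bar>m\<bar>)" .
qed

text \<open>Parseval's identity turns the distance into the sum of 2 pi |c_n|^2 (1 - r^|n|)^2, to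
  which dominated convergence applies.\<close>

lemma abel_mean_tendsto_L2:
  assumes g: "g \<in> L2 circle" and r: "\<And>k. 0 \<le> r k" "\<And>k. r k < 1" "r \<longlonglongrightarrow> 1"
  shows "(\<lambda>k. \<integral>z. (cmod (abel_mean (fourier_coeff g) (r k) z - g z))\<^sup>2 \<partial>circle) \<longlonglongrightarrow> 0"
proof -
  let ?c = "fourier_coeff g"
  let ?A = "\<lambda>k z. abel_mean ?c (r k) z - g z"
  note A = abel_mean_L2[of ?c, OF fourier_coeff_bound[OF g] r(1,2)]
  have AL2: "?A k \<in> L2 circle" for k by (rule L2_diff[OF A(1) g])
  have Ac: "fourier_coeff (?A k) n = ?c n * complex_of_real (r k ^ nat \<bar>n\<bar> - 1)" for k n
    by (simp add: fourier_coeff_diff circle.L2_integrable A g right_diff_distrib)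
  have le: "(cmod (?c n * complex_of_real (r k ^ nat \<bar>n\<bar> - 1)))\<^sup>2 \<le> (cmod (?c n))\<^sup>2" for k n
  proof -
    have "0 \<le> r k ^ nat \<bar>n\<bar>" "r k ^ nat \<bar>n\<bar> \<le> 1" using r(1)[of k] less_imp_le[OF r(2)[of k]] by (simp_all add: power_le_one)
    then have "\<bar>r k ^ nat \<bar>n\<bar> - 1\<bar> \<le> 1" by simp
    then have "cmod (?c n) * \<bar>r k ^ nat \<bar>n\<bar> - 1\<bar> \<le> cmod (?c n)" by (simp add: mult_left_le)
    then show ?thesis by (intro power_mono) (simp_all only: norm_mult norm_of_real norm_ge_zero mult_nonneg_nonneg abs_ge_zero)
  qed
  have "(\<lambda>k. \<integral>\<^sup>+n. ennreal (2 * pi * (cmod (?c n * complex_of_real (r k ^ nat \<bar>n\<bar> - 1)))\<^sup>2) \<partial>count_space UNIV) \<longlonglongrightarrow> (\<integral>\<^sup>+n. 0 \<partial>count_space (UNIV :: int set))"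
  proof (rule nn_integral_dominated_convergence[where w="\<lambda>n. ennreal (2 * pi * (cmod (?c n))\<^sup>2)"])
    show "AE n in count_space UNIV. ennreal (2 * pi * (cmod (?c n * complex_of_real (r k ^ nat \<bar>n\<bar> - 1)))\<^sup>2) \<le> ennreal (2 * pi * (cmod (?c n))\<^sup>2)" for k
      by (intro AE_I2 ennreal_leI mult_left_mono le) simp
    show "AE n in count_space UNIV. (\<lambda>k. ennreal (2 * pi * (cmod (?c n * complex_of_real (r k ^ nat \<bar>n\<bar> - 1)))\<^sup>2)) \<longlonglongrightarrow> 0"
    proof (rule AE_I2)
      fix n :: int
      have "(\<lambda>k. ennreal (2 * pi * (cmod (?c n * complex_of_real (r k ^ nat \<bar>n\<bar> - 1)))\<^sup>2)) \<longlonglongrightarrow> ennreal (2 * pi * (cmod (?c n * complex_of_real (1 ^ nat \<bar>n\<bar> - 1)))\<^sup>2)"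
        by (intro tendsto_intros tendsto_ennrealI r(3))
      then show "(\<lambda>k. ennreal (2 * pi * (cmod (?c n * complex_of_real (r k ^ nat \<bar>n\<bar> - 1)))\<^sup>2)) \<longlonglongrightarrow> 0" by simp
    qed
    show "(\<integral>\<^sup>+n. ennreal (2 * pi * (cmod (?c n))\<^sup>2) \<partial>count_space UNIV) < \<infinity>"
      using has_sum_nn_integral_count_space[OF fourier_parseval[OF g]] by simp
  qed auto
  also have "(\<lambda>k. \<integral>\<^sup>+n. ennreal (2 * pi * (cmod (?c n * complex_of_real (r k ^ nat \<bar>n\<bar> - 1)))\<^sup>2) \<partial>count_space UNIV) = (\<lambda>k. ennreal (\<integral>z. (cmod (?A k z))\<^sup>2 \<partial>circle))"
    using has_sum_nn_integral_count_space[OF fourier_parseval[OF AL2]] by (simp only: Ac) simp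
  finally have "(\<lambda>k. ennreal (\<integral>z. (cmod (?A k z))\<^sup>2 \<partial>circle)) \<longlonglongrightarrow> ennreal 0" by simp
  then show ?thesis by (subst (asm) tendsto_ennreal_iff) auto
qed

text \<open>The Abel means of \<open>g\<close> at \<open>z\<close> are differences of \<^term>\<open>control_transform T v\<close> at \<open>z / r\<close> and \<open>r z\<close>.\<close>

lemma control_moment_support:
  assumes v: "v \<in> L2 (space_time T)" and supp: "\<And>p. snd p \<notin> \<omega> \<Longrightarrow> v p = 0"
    and \<omega>: "\<omega> \<subseteq> sphere 0 1" and T: "0 < T"
    and g: "g \<in> L2 circle" and gc: "\<And>n. fourier_coeff g n = - control_moment T v n"
  shows "AE z in circle. z \<notin> closure \<omega> \<longrightarrow> g z = 0"
proof -
  let ?c = "fourier_coeff g"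
  let ?K = "control_transform T v"
  \<comment> \<open>The sequence starts at 1/2 rather than 0, since \<open>z / r k\<close> will be
    formed.\<close>
  define r where "r k = real (Suc k) / real (Suc (Suc k))" for k
  have r: "0 < r k" "r k < 1" for k by (auto simp: r_def)
  have r_lim: "r \<longlonglongrightarrow> 1"
    using LIMSEQ_Suc[OF LIMSEQ_n_over_Suc_n] unfolding r_def[abs_def] by simp
  let ?A = "\<lambda>k z. abel_mean ?c (r k) z"
  have bound: "cmod (?c n) \<le> L2_norm circle g" for n by (rule fourier_coeff_bound[OF g])
  note A = abel_mean_L2[of ?c, OF bound less_imp_le[OF r(1)] r(2)]
  have "(\<lambda>k. \<integral>z. (cmod (?A k z - g z))\<^sup>2 \<partial>circle) \<longlonglongrightarrow> 0"
    by (rule abel_mean_tendsto_L2[OF g less_imp_le[OF r(1)] r(2) r_lim])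
  \<comment> \<open>Convergence in the mean yields pointwise limits along a subsequence, which is
    enough to identify \<open>g\<close>.\<close>
  then obtain \<sigma> where \<sigma>: "strict_mono \<sigma>" and AE: "AE z in circle. (\<lambda>k. (cmod (?A (\<sigma> k) z - g z))\<^sup>2) \<longlonglongrightarrow> 0"
    using tendsto_L1_AE_subseq[of circle "\<lambda>k z. (cmod (?A k z - g z))\<^sup>2"] L2D(2)[OF L2_diff[OF A(1) g]] by auto
  have zero: "(\<lambda>k. ?A k z) \<longlonglongrightarrow> 0" if z1: "cmod z = 1" and z: "z \<notin> closure \<omega>" for z
  proof -
    have off: "complex_of_real \<rho> * z \<notin> control_sector T \<omega>" if \<rho>: "0 < \<rho>" for \<rho>
    proof
      assume "complex_of_real \<rho> * z \<in> control_sector T \<omega>"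
      then obtain s w where sw: "w \<in> closure \<omega>" "complex_of_real \<rho> * z = complex_of_real (exp (- s)) * w"
        by (auto simp: control_sector_def)
      have "cmod w = 1" using sw closure_subset_sphere[OF \<omega>] by auto
      then have "\<rho> = exp (- s)" using arg_cong[OF sw(2), of cmod] z1 \<rho> by (simp add: norm_mult)
      then have "z = w" using sw(2) by simp
      then show False using sw z by simp
    qed
    have cont: "isCont ?K z"
      using control_transform_derivative[OF v supp \<omega>, of z] off[of 1] by (auto intro: DERIV_isCont)
    have Ak: "?A k z = (?K (z / r k) - ?K (r k * z)) / (2 * pi)" for k
    proof -
      have nz: "z \<noteq> 0" using z1 by auto
      have rz: "cmod (r k * z) < 1" using r[of k] z1 by (simp add: norm_mult)
      have "(\<lambda>n. - (control_moment T v (int n) * (r k * z) ^ n)) sums - (?K (r k * z) / (2 * pi))"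
        by (intro sums_minus control_transform_continuation[OF v supp \<omega> T _ rz off[OF r(1)]])
           (use bound gc in \<open>auto simp: minus_equation_iff\<close>)
      moreover have "- (control_moment T v (int n) * (r k * z) ^ n) = ?c (int n) * complex_of_real (r k ^ n) * z powi int n" for n
        by (simp add: gc power_mult_distrib)
      ultimately have 1: "(\<Sum>n. ?c (int n) * complex_of_real (r k ^ n) * z powi int n) = - (?K (r k * z) / (2 * pi))"
        by (simp add: sums_iff)
      have zr: "1 < cmod (z / r k)" using r[of k] z1 by (simp add: norm_divide)
      have "(\<lambda>n. - (control_moment T v (- int (Suc n)) * inverse (z / r k) ^ Suc n)) sums - (- ?K (z / r k) / (2 * pi))"
        by (intro sums_minus control_transform_outside[OF v zr])
      moreover have "- (control_moment T v (- int (Suc n)) * inverse (z / r k) ^ Suc n) = ?c (- int (Suc n)) * complex_of_real (r k ^ Suc n) * z powi (- int (Suc n))" for n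
        unfolding gc power_int_minus power_int_of_nat by (simp add: divide_inverse power_mult_distrib power_inverse)
      ultimately have 2: "(\<Sum>n. ?c (- int (Suc n)) * complex_of_real (r k ^ Suc n) * z powi (- int (Suc n))) = ?K (z / r k) / (2 * pi)"
        by (simp only: sums_iff) simp
      show ?thesis unfolding abel_mean_def 1 2 by (simp add: diff_divide_distrib)
    qed
    have "(\<lambda>k. complex_of_real (r k) * z) \<longlonglongrightarrow> complex_of_real 1 * z" "(\<lambda>k. z / complex_of_real (r k)) \<longlonglongrightarrow> z / complex_of_real 1"
      by (intro tendsto_intros r_lim; simp)+
    then have "(\<lambda>k. ?K (r k * z)) \<longlonglongrightarrow> ?K z" "(\<lambda>k. ?K (z / r k)) \<longlonglongrightarrow> ?K z"
      using isCont_tendsto_compose[OF cont] by auto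
    then have "(\<lambda>k. (?K (z / r k) - ?K (r k * z)) / (2 * pi)) \<longlonglongrightarrow> (?K z - ?K z) / (2 * pi)"
      by (intro tendsto_divide tendsto_diff tendsto_const) auto
    then show ?thesis by (simp add: Ak)
  qed
  show ?thesis
    using AE AE_space
  proof eventually_elim
    case (elim z)
    show ?case
    proof
      assume "z \<notin> closure \<omega>"
      then have "(\<lambda>k. ?A (\<sigma> k) z) \<longlonglongrightarrow> 0"
        using LIMSEQ_subseq_LIMSEQ[OF zero \<sigma>, of z] elim(2) by (simp add: o_def)
      moreover have "(\<lambda>k. ?A (\<sigma> k) z - g z) \<longlonglongrightarrow> 0"
        using tendsto_real_sqrt[OF elim(1)] by (simp add: tendsto_norm_zero_iff)
      ultimately have "(\<lambda>k. ?A (\<sigma> k) z - (?A (\<sigma> k) z - g z)) \<longlonglongrightarrow> 0 - 0" by (intro tendsto_diff)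
      then show "g z = 0" by (simp add: LIMSEQ_const_iff)
    qed
  qed
qed

lemma null_controllable_imp_projection:
  assumes \<omega>: "\<omega> \<in> sets circle" and T: "0 < T"
    and f: "f\<^sub>0 \<in> H2" "f\<^sub>0 \<in> sobolev_half" and NC: "f\<^sub>0 \<in> NC_H2 \<omega> T"
  shows "\<exists>g \<in> L2 circle. ess_support g \<subseteq> closure \<omega> \<and> g \<in> sobolev_half \<and> (AE z in circle. f\<^sub>0 z = riesz_proj g z)"
proof -
  have sub: "\<omega> \<subseteq> sphere 0 1" using sets.sets_into_space[OF \<omega>] by simp
  have fL2: "f\<^sub>0 \<in> L2 circle" using f(1) by (simp add: H2_def)
  obtain u D where u: "u \<in> controls \<omega> T"
    and B: "has_L2_bochner_integral (lebesgue_on {0..T}) (\<lambda>s. absD_semigroup (T - s) (riesz_proj (\<lambda>z. if z \<in> \<omega> then u (s, z) else 0))) D"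
    and fin: "AE z in circle. 0 = absD_semigroup T f\<^sub>0 z + D z"
    using NC unfolding NC_H2_def H2_final_state_def by blast
  define v where "v p = (if snd p \<in> \<omega> then u p else 0)" for p
  have v: "v \<in> L2 (space_time T)"
    using controls_extend(1)[OF \<omega>, of u T] u unfolding v_def[abs_def] by blast
  have supp: "v p = 0" if "snd p \<notin> \<omega>" for p using that by (simp add: v_def)
  have B': "has_L2_bochner_integral (lebesgue_on {0..T}) (\<lambda>s. absD_semigroup (T - s) (riesz_proj (\<lambda>z. v (s, z)))) D"
    using B by (simp add: v_def)
  define c where "c n = - control_moment T v n" for n
  have cf: "c n = fourier_coeff f\<^sub>0 n" if "0 \<le> n" for n
    unfolding c_def using final_state_coeff[OF v T fL2 B' fin that] by simp
  have UN: "UNIV = {0..} \<union> {..<(0::int)}" by auto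
  have pos: "(\<lambda>n. h n * (cmod (c n))\<^sup>2) summable_on {0..}" if "(\<lambda>n. h n * (cmod (fourier_coeff f\<^sub>0 n))\<^sup>2) summable_on UNIV" for h :: "int \<Rightarrow> real"
  proof -
    have "(\<lambda>n. h n * (cmod (fourier_coeff f\<^sub>0 n))\<^sup>2) summable_on {0..}"
      by (rule summable_on_subset_banach[OF that]) simp
    then show ?thesis by (rule summable_on_cong[THEN iffD1, rotated -1]) (simp add: cf)
  qed
  have neg: "(\<lambda>n. of_int \<bar>n\<bar> * (cmod (c n))\<^sup>2) summable_on {..<0}"
    using control_moment_negative_summable[OF v T] by (simp add: c_def)
  have sob: "(\<lambda>n. of_int \<bar>n\<bar> * (cmod (c n))\<^sup>2) summable_on UNIV"
    unfolding UN using pos[of "\<lambda>n. of_int \<bar>n\<bar>"] neg f(2) by (intro summable_on_Un_disjoint) (auto simp: sobolev_half_def)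
  \<comment> \<open>The frequency 0 is on the other side, so |n| >= 1 here and the weighted sum
    dominates the plain one.\<close>
  have "(\<lambda>n. (cmod (c n))\<^sup>2) summable_on {..<0}"
  proof (rule summable_on_comparison_test[OF neg])
    fix n :: int assume "n \<in> {..<0}"
    then have "1 \<le> real_of_int \<bar>n\<bar>" by auto
    from mult_right_mono[OF this, of "(cmod (c n))\<^sup>2"]
    show "(cmod (c n))\<^sup>2 \<le> of_int \<bar>n\<bar> * (cmod (c n))\<^sup>2" by simp
  qed simp
  then have "(\<lambda>n. (cmod (c n))\<^sup>2) summable_on UNIV"
    unfolding UN using pos[of "\<lambda>n. 1"] fourier_coeff_square_summable[OF fL2] by (intro summable_on_Un_disjoint) auto
  note g = fourier_sum_L2[OF this]
  let ?g = "fourier_sum c"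
  have AE0: "AE z in circle. z \<notin> closure \<omega> \<longrightarrow> ?g z = 0"
    by (rule control_moment_support[OF v supp sub T g(1)], assumption, simp only: g(3), simp only: c_def)
  show ?thesis
  proof (intro bexI[of _ ?g] conjI g(1))
    show "ess_support ?g \<subseteq> closure \<omega>"
    proof
      fix p assume p: "p \<in> ess_support ?g"
      show "p \<in> closure \<omega>"
      proof (rule ccontr)
        assume "p \<notin> closure \<omega>"
        moreover have "AE w in circle. w \<in> - closure \<omega> \<longrightarrow> ?g w = 0" using AE0 by simp
        ultimately show False using p unfolding ess_support_def by (auto dest!: spec[of _ "- closure \<omega>"])
      qed
    qed
    show "?g \<in> sobolev_half" using sob g by (simp add: sobolev_half_def)
    show "AE z in circle. f\<^sub>0 z = riesz_proj ?g z"
      by (rule fourier_coeff_eq_imp_AE[OF fL2 riesz_proj_L2(1)[OF g(1)]])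
         (auto simp: riesz_proj_L2(2)[OF g(1)] g(3) cf H2_fourier_coeff_neg[OF f(1)])
  qed
qed

section \<open>Sobolev regularity through difference quotients\<close>

lemma nn_integral_count_space_summable:
  fixes a :: "'a \<Rightarrow> real"
  assumes "(\<integral>\<^sup>+n. ennreal (a n) \<partial>count_space A) < \<infinity>" and nn: "\<And>n. n \<in> A \<Longrightarrow> 0 \<le> a n"
  shows "a summable_on A"
proof -
  have "(\<integral>\<^sup>+n. ennreal (norm (a n)) \<partial>count_space A) = (\<integral>\<^sup>+n. ennreal (a n) \<partial>count_space A)"
    using nn by (intro nn_integral_cong) simp
  then have "integrable (count_space A) a"
    using assms(1) unfolding integrable_iff_bounded by simp
  then have "(\<lambda>n. norm (a n)) summable_on A"
    by (rule iffD2[OF abs_summable_equivalent, OF iffD2[OF Infinite_Set_Sum.abs_summable_on_def]])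
  then show ?thesis by (rule iffD2[OF summable_on_iff_abs_summable_on_real])
qed

text \<open>Parseval's identity on each slice precedes the exchange of integrals, so measurability
  in \<open>s\<close> is asked of one coefficient at a time.\<close>

lemma parseval_tonelli:
  fixes F :: "'s \<Rightarrow> complex \<Rightarrow> complex"
  assumes F: "\<And>s. s \<in> space M \<Longrightarrow> F s \<in> L2 circle"
    and m: "\<And>n. (\<lambda>s. fourier_coeff (F s) n) \<in> borel_measurable M"
  shows "(\<integral>\<^sup>+s. (\<integral>\<^sup>+z. ennreal ((cmod (F s z))\<^sup>2) \<partial>circle) \<partial>M)
    = (\<integral>\<^sup>+n. (\<integral>\<^sup>+s. ennreal (2 * pi * (cmod (fourier_coeff (F s) n))\<^sup>2) \<partial>M) \<partial>count_space UNIV)"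
proof -
  have "(\<integral>\<^sup>+s. (\<integral>\<^sup>+z. ennreal ((cmod (F s z))\<^sup>2) \<partial>circle) \<partial>M)
      = (\<integral>\<^sup>+s. (\<integral>\<^sup>+n. ennreal (2 * pi * (cmod (fourier_coeff (F s) n))\<^sup>2) \<partial>count_space UNIV) \<partial>M)"
    by (intro nn_integral_cong parseval_nn_integral F)
  also have "\<dots> = (\<integral>\<^sup>+n. (\<integral>\<^sup>+s. ennreal (2 * pi * (cmod (fourier_coeff (F s) n))\<^sup>2) \<partial>M) \<partial>count_space UNIV)"
    by (rule nn_integral_count_space_nn_integral) (use m in \<open>auto\<close>)
  finally show ?thesis .
qed

lemma cmod_cis_diff_one: "cmod (cis x - 1) = 2 * \<bar>sin (x / 2)\<bar>"
  using dist_exp_i_1[of x] by (simp add: cis_conv_exp)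

lemma cmod_cis_diff_one_le: "cmod (cis x - 1) \<le> \<bar>x\<bar>"
  using abs_sin_x_le_abs_x[of "x/2"] by (simp add: cmod_cis_diff_one)

lemma cmod_cis_diff_one_ge:
  assumes "\<bar>x\<bar> \<le> 1" shows "\<bar>x\<bar> / 2 \<le> cmod (cis x - 1)"
proof -
  have *: "y / 2 \<le> sin y" if y: "0 \<le> y" "y \<le> 1" for y :: real
  proof -
    have "sin 0 - 0 / 2 \<le> sin y - y / 2"
    proof (rule DERIV_nonneg_imp_nondecreasing[OF y(1)])
      fix t :: real assume t: "0 \<le> t" "t \<le> y"
      \<comment> \<open>On [0, 1] the cosine is at least 1/2 because 1 < pi / 3; so sin y - y / 2
        cannot decrease there.\<close>
      have "cos (pi / 3) \<le> cos t" using t y pi_gt3 by (intro cos_monotone_0_pi_le) auto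
      then have "0 \<le> cos t - 1 / 2" by (simp add: cos_60)
      moreover have "((\<lambda>y. sin y - y / 2) has_real_derivative cos t - 1 / 2) (at t)"
        by (auto intro!: derivative_eq_intros)
      ultimately show "\<exists>d. ((\<lambda>y. sin y - y / 2) has_real_derivative d) (at t) \<and> 0 \<le> d" by blast
    qed
    then show ?thesis by simp
  qed
  have "\<bar>x\<bar> / 2 / 2 \<le> sin (\<bar>x\<bar> / 2)" using assms by (intro *) auto
  also have "\<dots> \<le> \<bar>sin (\<bar>x\<bar> / 2)\<bar>" by simp
  also have "\<dots> = \<bar>sin (x / 2)\<bar>" by (cases "0 \<le> x") auto
  finally show ?thesis by (simp add: cmod_cis_diff_one)
qed

lemma cmod_cis_diff_one_div_le:
  assumes "0 < s" shows "cmod (cis (of_int n * s) - 1) / s \<le> min (2 / s) \<bar>of_int n\<bar>"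
proof -
  have "cmod (cis (of_int n * s) - 1) \<le> 2" by (simp add: cmod_cis_diff_one)
  moreover have "cmod (cis (of_int n * s) - 1) \<le> \<bar>of_int n\<bar> * s"
    using cmod_cis_diff_one_le[of "of_int n * s"] assms by (simp add: abs_mult)
  ultimately show ?thesis using assms by (simp add: divide_simps)
qed

text \<open>Split at s = 1 / N. On the left the bound N contributes N^2 / N; on the right the bound
  2 / s contributes at most the integral of 4 / s^2 from 1 / N on, which is 4 N. This linear growth
  is the weight |n| of the Sobolev condition.\<close>

lemma nn_integral_min_square_le:
  fixes N :: real
  assumes N: "0 \<le> N"
  shows "(\<integral>\<^sup>+s. ennreal ((min (2 / s) N)\<^sup>2) * indicator {0<..1} s \<partial>lborel) \<le> ennreal (5 * N)"
proof (cases "N = 0")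
  case True
  have "(\<integral>\<^sup>+s. ennreal ((min (2 / s) N)\<^sup>2) * indicator {0<..1} s \<partial>lborel) = (\<integral>\<^sup>+s. 0 \<partial>(lborel::real measure))"
    by (intro nn_integral_cong) (auto simp: True split: split_indicator)
  then show ?thesis by simp
next
  case False
  then have N: "0 < N" using N by simp
  have "ennreal ((min (2 / s) N)\<^sup>2) * indicator {0<..1} s \<le> ennreal (N\<^sup>2) * indicator {0..1/N} s + ennreal (4 / s\<^sup>2) * indicator {1/N..} s" for s
  proof (cases "s \<in> {0<..1}")
    case True
    show ?thesis
    proof (cases "s \<le> 1 / N")
      case s: True
      have "(min (2 / s) N)\<^sup>2 \<le> N\<^sup>2" using True N by (intro power_mono) auto
      then have "ennreal ((min (2 / s) N)\<^sup>2) \<le> ennreal (N\<^sup>2)" by (rule ennreal_leI)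
      then show ?thesis using True s by (auto intro: order_trans split: split_indicator)
    next
      case s: False
      have "(min (2 / s) N)\<^sup>2 \<le> (2 / s)\<^sup>2" using True N by (intro power_mono) auto
      then have "ennreal ((min (2 / s) N)\<^sup>2) \<le> ennreal (4 / s\<^sup>2)" by (intro ennreal_leI) (simp add: power_divide)
      then show ?thesis using True s by (auto split: split_indicator)
    qed
  qed auto
  then have "(\<integral>\<^sup>+s. ennreal ((min (2 / s) N)\<^sup>2) * indicator {0<..1} s \<partial>lborel)
      \<le> (\<integral>\<^sup>+s. ennreal (N\<^sup>2) * indicator {0..1/N} s + ennreal (4 / s\<^sup>2) * indicator {1/N..} s \<partial>lborel)"
    by (intro nn_integral_mono)
  also have "\<dots> = (\<integral>\<^sup>+s. ennreal (N\<^sup>2) * indicator {0..1/N} s \<partial>lborel) + (\<integral>\<^sup>+s. ennreal (4 / s\<^sup>2) * indicator {1/N..} s \<partial>lborel)"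
    by (rule nn_integral_add) auto
  also have "(\<integral>\<^sup>+s. ennreal (N\<^sup>2) * indicator {0..1/N} s \<partial>lborel) = ennreal N"
    using N by (subst nn_integral_cmult_indicator) (auto simp: power2_eq_square simp flip: ennreal_mult)
  also have "(\<integral>\<^sup>+s. ennreal (4 / s\<^sup>2) * indicator {1/N..} s \<partial>lborel) = ennreal (0 - (- 4 / (1/N)))"
  proof (rule nn_integral_FTC_atLeast)
    fix s :: real assume "1 / N \<le> s"
    then have s: "0 < s" using N by (meson divide_pos_pos less_le_trans zero_less_one)
    show "((\<lambda>s. - 4 / s) has_real_derivative 4 / s\<^sup>2) (at s)"
      using s by (auto intro!: derivative_eq_intros simp: power2_eq_square)
  next
    show "((\<lambda>s::real. - 4 / s) \<longlongrightarrow> 0) at_top"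
      by (intro tendsto_divide_0[OF tendsto_const] filterlim_at_top_imp_at_infinity filterlim_ident)
  qed auto
  also have "ennreal N + ennreal (0 - (- 4 / (1/N))) = ennreal (5 * N)"
    using N by (simp flip: ennreal_plus)
  finally show ?thesis .
qed

section \<open>Rotations and the Gagliardo seminorm\<close>

lemma fourier_coeff_rotate:
  assumes f: "f \<in> L2 circle"
  shows "(\<lambda>z. f (z * cis h)) \<in> L2 circle"
    and "fourier_coeff (\<lambda>z. f (z * cis h)) n = cis (of_int n * h) * fourier_coeff f n"
proof -
  note [measurable] = L2D(1)[OF f]
  have rot: "(\<lambda>z. z * cis h) \<in> measurable circle circle" by measurable
  have m: "(\<lambda>z. f (z * cis h)) \<in> borel_measurable circle"
    by (rule measurable_compose[OF rot L2D(1)[OF f]])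
  have "(\<integral>\<^sup>+z. ennreal ((cmod (f (z * cis h)))\<^sup>2) \<partial>circle) = (\<integral>\<^sup>+z. ennreal ((cmod (f z))\<^sup>2) \<partial>circle)"
    by (rule nn_integral_circle_rotate[of "\<lambda>z. ennreal ((cmod (f z))\<^sup>2)"]) measurable
  then show "(\<lambda>z. f (z * cis h)) \<in> L2 circle"
    using L2D(2)[OF f] m unfolding L2_def by (simp add: integrable_iff_bounded)
  have "(\<integral>z. f (z * cis h) * z powi (-n) \<partial>circle) = (\<integral>z. cis (of_int n * h) * (f (z * cis h) * (z * cis h) powi (-n)) \<partial>circle)"
  proof (intro Bochner_Integration.integral_cong refl)
    fix z
    have "cis (of_int n * h) * cis h powi (-n) = 1"
      by (simp add: cis_power_int cis_mult)
    then show "f (z * cis h) * z powi (-n) = cis (of_int n * h) * (f (z * cis h) * (z * cis h) powi (-n))"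
      by (simp add: power_int_mult_distrib mult.left_commute mult.assoc)
  qed
  also have "\<dots> = cis (of_int n * h) * (\<integral>z. f (z * cis h) * (z * cis h) powi (-n) \<partial>circle)" by simp
  also have "(\<integral>z. f (z * cis h) * (z * cis h) powi (-n) \<partial>circle) = (\<integral>z. f z * z powi (-n) \<partial>circle)"
    by (rule integral_circle_rotate[of "\<lambda>z. f z * z powi (-n)"]) measurable
  finally show "fourier_coeff (\<lambda>z. f (z * cis h)) n = cis (of_int n * h) * fourier_coeff f n"
    by (simp add: fourier_coeff_def)
qed

text \<open>The square of a Gagliardo seminorm of order 1/2, with shifts in (0, 1]. It sees products
  pointwise, which the multiplication by a cut-off requires; its values are extended so that
  membership in the Sobolev space can be read as finiteness.\<close>

definition gagliardo :: "(complex \<Rightarrow> complex) \<Rightarrow> ennreal" where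
  "gagliardo f = (\<integral>\<^sup>+s. (\<integral>\<^sup>+z. ennreal ((cmod (f (z * cis s) - f z))\<^sup>2 / s\<^sup>2) \<partial>circle) \<partial>restrict_space lborel {0<..1::real})"

abbreviation gagliardo_weight :: "int \<Rightarrow> ennreal" where
  "gagliardo_weight n \<equiv> (\<integral>\<^sup>+s. ennreal ((cmod (cis (of_int n * s) - 1) / s)\<^sup>2) * indicator {0<..1} s \<partial>lborel)"

text \<open>A shift by s multiplies the n-th coefficient by e^(ins), so the seminorm is diagonal in
  frequency. Its weight will be found to lie between |n| / 4 and 5 |n|.\<close>

lemma gagliardo_eq:
  assumes f: "f \<in> L2 circle"
  shows "gagliardo f = (\<integral>\<^sup>+n. ennreal (2 * pi * (cmod (fourier_coeff f n))\<^sup>2) * gagliardo_weight n \<partial>count_space UNIV)"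
proof -
  let ?M = "restrict_space lborel {0<..1::real}"
  let ?F = "\<lambda>s z. complex_of_real (1 / s) * (f (z * cis s) - f z)"
  have F: "?F s \<in> L2 circle" for s
    by (intro L2_cmult L2_diff fourier_coeff_rotate(1) f)
  have Fc: "fourier_coeff (?F s) n = complex_of_real (1 / s) * ((cis (of_int n * s) - 1) * fourier_coeff f n)" for s n
    using f by (simp only: fourier_coeff_cmult fourier_coeff_diff circle.L2_integrable fourier_coeff_rotate left_diff_distrib mult_1_left)
  have sq: "(cmod (?F s z))\<^sup>2 = (cmod (f (z * cis s) - f z))\<^sup>2 / s\<^sup>2" for s z
    by (simp add: norm_mult norm_divide power_mult_distrib power_divide)
  have "gagliardo f = (\<integral>\<^sup>+s. (\<integral>\<^sup>+z. ennreal ((cmod (?F s z))\<^sup>2) \<partial>circle) \<partial>?M)"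
    unfolding gagliardo_def sq ..
  also have "\<dots> = (\<integral>\<^sup>+n. (\<integral>\<^sup>+s. ennreal (2 * pi * (cmod (fourier_coeff (?F s) n))\<^sup>2) \<partial>?M) \<partial>count_space UNIV)"
  proof (rule parseval_tonelli[OF F])
    show "(\<lambda>s. fourier_coeff (?F s) n) \<in> borel_measurable ?M" for n
      unfolding Fc by (rule measurable_restrict_space1) measurable
  qed
  also have "\<dots> = (\<integral>\<^sup>+n. ennreal (2 * pi * (cmod (fourier_coeff f n))\<^sup>2) * gagliardo_weight n \<partial>count_space UNIV)"
  proof (rule nn_integral_cong)
    fix n :: int
    have "ennreal (2 * pi * (cmod (fourier_coeff (?F s) n))\<^sup>2) = ennreal (2 * pi * (cmod (fourier_coeff f n))\<^sup>2) * ennreal ((cmod (cis (of_int n * s) - 1) / s)\<^sup>2)" for s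
      unfolding Fc by (simp add: norm_mult norm_divide power_mult_distrib power_divide mult_ac flip: ennreal_mult)
    then show "(\<integral>\<^sup>+s. ennreal (2 * pi * (cmod (fourier_coeff (?F s) n))\<^sup>2) \<partial>?M) = ennreal (2 * pi * (cmod (fourier_coeff f n))\<^sup>2) * gagliardo_weight n"
      by (simp add: nn_integral_restrict_space mult.assoc nn_integral_cmult)
  qed
  finally show ?thesis .
qed

lemma sobolev_half_imp_gagliardo:
  assumes f: "f \<in> sobolev_half" shows "gagliardo f < \<infinity>"
proof -
  have fL: "f \<in> L2 circle" using f by (simp add: sobolev_half_def)
  obtain S where S: "((\<lambda>n. of_int \<bar>n\<bar> * (cmod (fourier_coeff f n))\<^sup>2) has_sum S) UNIV"
    using f by (auto simp: sobolev_half_def summable_on_def)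
  have "gagliardo f \<le> (\<integral>\<^sup>+n. ennreal (10 * pi) * ennreal (of_int \<bar>n\<bar> * (cmod (fourier_coeff f n))\<^sup>2) \<partial>count_space UNIV)"
    unfolding gagliardo_eq[OF fL]
  proof (rule nn_integral_mono)
    fix n :: int
    have "gagliardo_weight n
        \<le> (\<integral>\<^sup>+s. ennreal ((min (2 / s) (of_int \<bar>n\<bar>))\<^sup>2) * indicator {0<..1} s \<partial>lborel)"
      using cmod_cis_diff_one_div_le[of _ n]
      by (intro nn_integral_mono) (auto intro!: ennreal_leI power_mono split: split_indicator)
    also have "\<dots> \<le> ennreal (5 * of_int \<bar>n\<bar>)" by (rule nn_integral_min_square_le) simp
    finally have "ennreal (2 * pi * (cmod (fourier_coeff f n))\<^sup>2) * gagliardo_weight n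
      \<le> ennreal (2 * pi * (cmod (fourier_coeff f n))\<^sup>2) * ennreal (5 * of_int \<bar>n\<bar>)"
      by (intro mult_left_mono) auto
    also have "\<dots> = ennreal (10 * pi) * ennreal (of_int \<bar>n\<bar> * (cmod (fourier_coeff f n))\<^sup>2)"
      by (simp add: mult_ac flip: ennreal_mult)
    finally show "ennreal (2 * pi * (cmod (fourier_coeff f n))\<^sup>2) * gagliardo_weight n
       \<le> ennreal (10 * pi) * ennreal (of_int \<bar>n\<bar> * (cmod (fourier_coeff f n))\<^sup>2)" .
  qed
  also have "\<dots> = ennreal (10 * pi) * ennreal S"
    using has_sum_nn_integral_count_space[OF S] by (simp add: nn_integral_cmult)
  also have "\<dots> < \<infinity>" by (simp add: ennreal_mult_less_top)
  finally show ?thesis .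
qed

lemma gagliardo_imp_sobolev_half:
  assumes f: "f \<in> L2 circle" and fin: "gagliardo f < \<infinity>" shows "f \<in> sobolev_half"
proof -
  \<comment> \<open>Shifts up to 1 / |n| suffice: there the quotient is at least |n| / 2, and its
    square over an interval of that length gives |n| / 4.\<close>
  have lower: "ennreal (of_int \<bar>n\<bar> / 4) \<le> gagliardo_weight n" for n :: int
  proof (cases "n = 0")
    case False
    define N where "N = real_of_int \<bar>n\<bar>"
    have N: "1 \<le> N" using False by (simp add: N_def)
    have "ennreal (N\<^sup>2 / 4) * indicator {0<..1/N} s \<le> ennreal ((cmod (cis (of_int n * s) - 1) / s)\<^sup>2) * indicator {0<..1} s" for s
    proof (cases "s \<in> {0<..1/N}")
      case True
      have "1 / N \<le> 1" using N by simp
      then have s: "0 < s" "N * s \<le> 1" "s \<le> 1" using True N by (auto simp: field_simps intro: order_trans[of s "1/N" 1])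
      have "N * s / 2 \<le> cmod (cis (of_int n * s) - 1)"
        using cmod_cis_diff_one_ge[of "of_int n * s"] s by (simp add: abs_mult N_def)
      then have "N / 2 \<le> cmod (cis (of_int n * s) - 1) / s" using s by (simp add: field_simps)
      then have "(N / 2)\<^sup>2 \<le> (cmod (cis (of_int n * s) - 1) / s)\<^sup>2" using N by (intro power_mono) auto
      then show ?thesis using True s by (simp add: power_divide ennreal_leI)
    qed simp
    then have "(\<integral>\<^sup>+s. ennreal (N\<^sup>2 / 4) * indicator {0<..1/N} s \<partial>lborel) \<le> gagliardo_weight n"
      by (intro nn_integral_mono)
    moreover have "(\<integral>\<^sup>+s. ennreal (N\<^sup>2 / 4) * indicator {0<..1/N} s \<partial>lborel) = ennreal (N / 4)"
      using N by (subst nn_integral_cmult_indicator) (auto simp: power2_eq_square simp flip: ennreal_mult)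
    ultimately show ?thesis by (simp add: N_def)
  qed simp
  have "(\<integral>\<^sup>+n. ennreal (of_int \<bar>n\<bar> * (cmod (fourier_coeff f n))\<^sup>2) \<partial>count_space UNIV) \<le> gagliardo f"
    unfolding gagliardo_eq[OF f]
  proof (rule nn_integral_mono)
    fix n :: int
    have "of_int \<bar>n\<bar> * (cmod (fourier_coeff f n))\<^sup>2 \<le> 2 * pi * (cmod (fourier_coeff f n))\<^sup>2 * (of_int \<bar>n\<bar> / 4)"
      using mult_right_mono[of 1 "2 * pi / 4" "of_int \<bar>n\<bar> * (cmod (fourier_coeff f n))\<^sup>2"] pi_gt3 by (simp add: mult_ac)
    then have "ennreal (of_int \<bar>n\<bar> * (cmod (fourier_coeff f n))\<^sup>2) \<le> ennreal (2 * pi * (cmod (fourier_coeff f n))\<^sup>2) * ennreal (of_int \<bar>n\<bar> / 4)"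
      by (simp add: ennreal_leI flip: ennreal_mult)
    also have "\<dots> \<le> ennreal (2 * pi * (cmod (fourier_coeff f n))\<^sup>2) * gagliardo_weight n"
      by (intro mult_left_mono lower) simp
    finally show "ennreal (of_int \<bar>n\<bar> * (cmod (fourier_coeff f n))\<^sup>2) \<le> ennreal (2 * pi * (cmod (fourier_coeff f n))\<^sup>2) * gagliardo_weight n" .
  qed
  then have "(\<lambda>n. of_int \<bar>n\<bar> * (cmod (fourier_coeff f n))\<^sup>2) summable_on UNIV"
    using fin by (intro nn_integral_count_space_summable) (auto elim: le_less_trans)
  then show ?thesis using f by (simp add: sobolev_half_def)
qed

text \<open>The product rule for differences: the increment of \<theta> f is the shifted \<theta>
  times the increment of f, plus the increment of \<theta> times f. The latter is at most L s |f|,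
  so the weight 1 / s^2 cancels and a multiple of the squared norm of f remains.\<close>

lemma sobolev_half_mult_lipschitz:
  assumes f: "f \<in> sobolev_half" and \<theta>: "\<theta> \<in> borel_measurable circle"
    and \<theta>1: "\<And>z. cmod z = 1 \<Longrightarrow> cmod (\<theta> z) \<le> 1"
    and lip: "\<And>z w. cmod z = 1 \<Longrightarrow> cmod w = 1 \<Longrightarrow> cmod (\<theta> z - \<theta> w) \<le> L * cmod (z - w)" and L: "0 \<le> L"
  shows "(\<lambda>z. \<theta> z * f z) \<in> sobolev_half"
proof -
  have fL: "f \<in> L2 circle" using f by (simp add: sobolev_half_def)
  note [measurable] = L2D(1)[OF fL]
  have hL: "(\<lambda>z. \<theta> z * f z) \<in> L2 circle"
    by (rule L2_mult_bounded[OF fL \<theta>, where C=1]) (simp add: \<theta>1)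
  let ?M = "restrict_space lborel {0<..1::real}"
  let ?h = "\<lambda>z. \<theta> z * f z"
  have point: "(cmod (?h (z * cis s) - ?h z))\<^sup>2 / s\<^sup>2 \<le> 2 * ((cmod (f (z * cis s) - f z))\<^sup>2 / s\<^sup>2) + 2 * L\<^sup>2 * (cmod (f z))\<^sup>2"
    if z: "cmod z = 1" and s: "0 < s" for z s
  proof -
    have zs: "cmod (z * cis s) = 1" using z by (simp add: norm_mult)
    have "z * cis s - z = z * (cis s - 1)" by (simp add: right_diff_distrib)
    then have "cmod (z * cis s - z) = cmod (cis s - 1)" by (simp only: norm_mult z mult_1_left)
    then have d: "cmod (z * cis s - z) \<le> s" using cmod_cis_diff_one_le[of s] s by simp
    have "cmod (\<theta> (z * cis s) - \<theta> z) \<le> L * cmod (z * cis s - z)" by (rule lip[OF zs z])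
    also have "\<dots> \<le> L * s" by (rule mult_left_mono[OF d L])
    finally have t: "cmod (\<theta> (z * cis s) - \<theta> z) \<le> L * s" .
    have "?h (z * cis s) - ?h z = \<theta> (z * cis s) * (f (z * cis s) - f z) + (\<theta> (z * cis s) - \<theta> z) * f z"
      by (simp add: algebra_simps)
    then have "(cmod (?h (z * cis s) - ?h z))\<^sup>2 \<le> 2 * (cmod (\<theta> (z * cis s) * (f (z * cis s) - f z)))\<^sup>2 + 2 * (cmod ((\<theta> (z * cis s) - \<theta> z) * f z))\<^sup>2"
      using cmod_add_square_le by metis
    also have "\<dots> \<le> 2 * (1 * cmod (f (z * cis s) - f z))\<^sup>2 + 2 * (L * s * cmod (f z))\<^sup>2"
      unfolding norm_mult using \<theta>1[OF zs] t by (intro add_mono mult_left_mono power_mono mult_right_mono) auto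
    finally have "(cmod (?h (z * cis s) - ?h z))\<^sup>2 / s\<^sup>2 \<le> (2 * (1 * cmod (f (z * cis s) - f z))\<^sup>2 + 2 * (L * s * cmod (f z))\<^sup>2) / s\<^sup>2"
      by (rule divide_right_mono) simp
    also have "\<dots> = 2 * ((cmod (f (z * cis s) - f z))\<^sup>2 / s\<^sup>2) + 2 * L\<^sup>2 * (cmod (f z))\<^sup>2"
      using s by (simp add: add_divide_distrib power_mult_distrib)
    finally show ?thesis .
  qed
  have rot: "(\<lambda>z. f (z * cis s)) \<in> borel_measurable circle" for s
    by (rule L2D(1)[OF fourier_coeff_rotate(1)[OF fL]])
  define C where "C = (\<integral>\<^sup>+z. ennreal (2 * L\<^sup>2 * (cmod (f z))\<^sup>2) \<partial>circle)"
  have C: "C < \<infinity>"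
  proof -
    have "integrable circle (\<lambda>z. 2 * L\<^sup>2 * (cmod (f z))\<^sup>2)" using L2D(2)[OF fL] by simp
    then show ?thesis unfolding C_def integrable_iff_bounded by simp
  qed
  have meas: "(\<lambda>s. \<integral>\<^sup>+z. ennreal ((cmod (f (z * cis s) - f z))\<^sup>2 / s\<^sup>2) \<partial>circle) \<in> borel_measurable ?M"
  proof (rule measurable_restrict_space1)
    have "(\<lambda>p. snd p * cis (fst p)) \<in> measurable (lborel \<Otimes>\<^sub>M circle) circle"
      by measurable
    from measurable_compose[OF this L2D(1)[OF fL]]
    have "(\<lambda>p. f (snd p * cis (fst p))) \<in> borel_measurable (lborel \<Otimes>\<^sub>M circle)" .
    then have "(\<lambda>p. ennreal ((cmod (f (snd p * cis (fst p)) - f (snd p)))\<^sup>2 / (fst p)\<^sup>2)) \<in> borel_measurable (lborel \<Otimes>\<^sub>M circle)"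
      by measurable
    then show "(\<lambda>s. \<integral>\<^sup>+z. ennreal ((cmod (f (z * cis s) - f z))\<^sup>2 / s\<^sup>2) \<partial>circle) \<in> borel_measurable lborel"
      by (intro circle.borel_measurable_nn_integral) (simp add: split_beta')
  qed
  have "gagliardo ?h \<le> (\<integral>\<^sup>+s. (2 * (\<integral>\<^sup>+z. ennreal ((cmod (f (z * cis s) - f z))\<^sup>2 / s\<^sup>2) \<partial>circle) + C) \<partial>?M)"
    unfolding gagliardo_def
  proof (rule nn_integral_mono)
    fix s assume "s \<in> space ?M"
    then have s: "0 < s" by (simp add: space_restrict_space)
    have "(\<integral>\<^sup>+z. ennreal ((cmod (?h (z * cis s) - ?h z))\<^sup>2 / s\<^sup>2) \<partial>circle)
       \<le> (\<integral>\<^sup>+z. 2 * ennreal ((cmod (f (z * cis s) - f z))\<^sup>2 / s\<^sup>2) + ennreal (2 * L\<^sup>2 * (cmod (f z))\<^sup>2) \<partial>circle)"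
    proof (rule nn_integral_mono)
      fix z assume "z \<in> space circle"
      then have z: "cmod z = 1" by simp
      have "ennreal ((cmod (?h (z * cis s) - ?h z))\<^sup>2 / s\<^sup>2) \<le> ennreal (2 * ((cmod (f (z * cis s) - f z))\<^sup>2 / s\<^sup>2) + 2 * L\<^sup>2 * (cmod (f z))\<^sup>2)"
        by (rule ennreal_leI[OF point[OF z s]])
      also have "\<dots> = 2 * ennreal ((cmod (f (z * cis s) - f z))\<^sup>2 / s\<^sup>2) + ennreal (2 * L\<^sup>2 * (cmod (f z))\<^sup>2)"
      proof -
        have "ennreal (2 * x + y) = 2 * ennreal x + ennreal y" if "0 \<le> x" "0 \<le> y" for x y :: real
          using that by (simp add: ennreal_plus ennreal_mult')
        then show ?thesis by this auto
      qed
      finally show "ennreal ((cmod (?h (z * cis s) - ?h z))\<^sup>2 / s\<^sup>2) \<le> 2 * ennreal ((cmod (f (z * cis s) - f z))\<^sup>2 / s\<^sup>2) + ennreal (2 * L\<^sup>2 * (cmod (f z))\<^sup>2)" .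
    qed
    also have "\<dots> = 2 * (\<integral>\<^sup>+z. ennreal ((cmod (f (z * cis s) - f z))\<^sup>2 / s\<^sup>2) \<partial>circle) + C"
      using rot[of s] unfolding C_def by (subst nn_integral_add) (auto simp: nn_integral_cmult)
    finally show "(\<integral>\<^sup>+z. ennreal ((cmod (?h (z * cis s) - ?h z))\<^sup>2 / s\<^sup>2) \<partial>circle) \<le> 2 * (\<integral>\<^sup>+z. ennreal ((cmod (f (z * cis s) - f z))\<^sup>2 / s\<^sup>2) \<partial>circle) + C" .
  qed
  also have "\<dots> = 2 * gagliardo f + C * emeasure ?M (space ?M)"
    using meas unfolding gagliardo_def by (subst nn_integral_add) (auto simp: nn_integral_cmult)
  also have "\<dots> < \<infinity>"
  proof -
    have "emeasure ?M (space ?M) = 1" by (simp add: space_restrict_space emeasure_restrict_space)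
    then show ?thesis using sobolev_half_imp_gagliardo[OF f] C by (simp add: ennreal_mult_less_top)
  qed
  finally show ?thesis by (rule gagliardo_imp_sobolev_half[OF hL])
qed

section \<open>Controls from one-sided averages\<close>

definition window_integral :: "real \<Rightarrow> (complex \<Rightarrow> complex) \<Rightarrow> real \<Rightarrow> complex \<Rightarrow> complex" where
  "window_integral \<epsilon> h s z = (\<integral>\<sigma>. indicator {0..s} \<sigma> *\<^sub>R h (z * cis (- \<epsilon> * \<sigma>)) \<partial>lborel)"

text \<open>This is \<open>(\<partial>\<^sub>s - i\<partial>\<^sub>x) G\<close> for \<open>G(s, x) = (1/s - 1/\<delta>) \<integral>\<^sub>0\<^sup>s h(x - \<epsilon>\<sigma>) d\<sigma>\<close>, which tends to \<open>h\<close> as \<open>s\<close> tends to \<open>0\<close> and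
  vanishes at \<open>s = \<delta>\<close>. The sign \<open>\<epsilon> = \<plusminus>1\<close> selects the side on which the average is taken.\<close>

definition one_sided_control :: "real \<Rightarrow> real \<Rightarrow> (complex \<Rightarrow> complex) \<Rightarrow> real \<times> complex \<Rightarrow> complex" where
  "one_sided_control \<epsilon> \<delta> h = (\<lambda>(s, z). if 0 < s \<and> s \<le> \<delta> then
      - (1 / (complex_of_real s)\<^sup>2) * window_integral \<epsilon> h s z
      + (1 / complex_of_real s - 1 / complex_of_real \<delta>)
        * (h (z * cis (- \<epsilon> * s)) - \<i> * complex_of_real \<epsilon> * (h z - h (z * cis (- \<epsilon> * s)))) else 0)"

text \<open>The Fourier multiplier of the window integral, that is, the integral of e^(-i \<epsilon>
  n \<sigma>) over [0, s]. Its argument is complex so that the behaviour at s = 0 can be read off a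
  complex derivative.\<close>

definition window_coeff :: "real \<Rightarrow> int \<Rightarrow> complex \<Rightarrow> complex" where
  "window_coeff \<epsilon> n x = (if n = 0 then x else (exp (- \<i> * complex_of_real \<epsilon> * of_int n * x) - 1) / (- \<i> * complex_of_real \<epsilon> * of_int n))"

text \<open>The multiplier by which the time slice of \<open>one_sided_control\<close> acts on
  \<open>h\<close> for 0 < s <= \<delta>.\<close>

definition control_coeff :: "real \<Rightarrow> real \<Rightarrow> int \<Rightarrow> real \<Rightarrow> complex" where
  "control_coeff \<epsilon> \<delta> n s = - (1 / (complex_of_real s)\<^sup>2) * window_coeff \<epsilon> n (complex_of_real s)
      + (1 / complex_of_real s - 1 / complex_of_real \<delta>)
        * (cis (- \<epsilon> * of_int n * s) - \<i> * complex_of_real \<epsilon> * (1 - cis (- \<epsilon> * of_int n * s)))"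

lemma cis_eq_exp_param: "cis (- \<epsilon> * of_int n * s) = exp (- \<i> * complex_of_real \<epsilon> * of_int n * complex_of_real s)"
  by (simp add: cis_conv_exp mult_ac)

lemma window_coeff_derivative:
  assumes "\<epsilon> \<noteq> 0"
  shows "(window_coeff \<epsilon> n has_field_derivative exp (- \<i> * complex_of_real \<epsilon> * of_int n * x)) (at x)"
proof (cases "n = 0")
  case True
  then show ?thesis unfolding window_coeff_def[abs_def] by (auto intro!: derivative_eq_intros)
next
  case False
  then have nz: "- \<i> * complex_of_real \<epsilon> * of_int n \<noteq> 0" using assms by simp
  have "((\<lambda>x. (exp (- \<i> * complex_of_real \<epsilon> * of_int n * x) - 1) / (- \<i> * complex_of_real \<epsilon> * of_int n)) has_field_derivative exp (- \<i> * complex_of_real \<epsilon> * of_int n * x)) (at x)"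
  proof -
    let ?c = "- \<i> * complex_of_real \<epsilon> * of_int n"
    have "((\<lambda>x. exp (?c * x)) has_field_derivative exp (?c * x) * ?c) (at x)"
      by (auto intro!: derivative_eq_intros)
    from DERIV_cdivide[OF DERIV_diff[OF this DERIV_const[of 1]], of ?c]
    show ?thesis by (rule DERIV_cong) (use nz in simp)
  qed
  then show ?thesis using False unfolding window_coeff_def[abs_def] by simp
qed

text \<open>Multiplication by n is -i d/dx, and the x-derivative of a window integral is a
  difference of end-point values. This is the source of the last term of
  \<open>one_sided_control\<close>.\<close>

lemma window_coeff_mult:
  assumes "\<epsilon> = 1 \<or> \<epsilon> = -1"
  shows "of_int n * window_coeff \<epsilon> n (complex_of_real s) = - \<i> * complex_of_real \<epsilon> * (1 - cis (- \<epsilon> * of_int n * s))"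
proof (cases "n = 0")
  case False
  have e: "complex_of_real \<epsilon> * complex_of_real \<epsilon> = 1" using assms by auto
  have nz: "complex_of_real \<epsilon> \<noteq> 0" using assms by auto
  have "of_int n * window_coeff \<epsilon> n (complex_of_real s) = (cis (- \<epsilon> * of_int n * s) - 1) / (- \<i> * complex_of_real \<epsilon>)"
    unfolding cis_eq_exp_param using False by (simp add: window_coeff_def)
  also have "\<dots> = (\<i> * complex_of_real \<epsilon>) * (cis (- \<epsilon> * of_int n * s) - 1)"
    using nz e by (simp add: field_simps)
  finally show ?thesis by (simp add: algebra_simps)
qed simp

lemma window_coeff_integral:
  assumes e: "\<epsilon> = 1 \<or> \<epsilon> = -1" and s: "0 \<le> s"
  shows "(\<integral>\<sigma>. indicator {0..s} \<sigma> *\<^sub>R cis (- \<epsilon> * of_int n * \<sigma>) \<partial>lborel) = window_coeff \<epsilon> n (complex_of_real s)"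
proof -
  have "(\<integral>\<sigma>. indicator {0..s} \<sigma> *\<^sub>R cis (- \<epsilon> * of_int n * \<sigma>) \<partial>lborel) = window_coeff \<epsilon> n (complex_of_real s) - window_coeff \<epsilon> n (complex_of_real 0)"
  proof (rule integral_FTC_Icc[OF s])
    show "((\<lambda>\<sigma>. window_coeff \<epsilon> n (complex_of_real \<sigma>)) has_vector_derivative cis (- \<epsilon> * of_int n * x)) (at x within {0..s})" for x
      unfolding cis_eq_exp_param
      by (rule has_vector_derivative_real_field[OF window_coeff_derivative]) (use e in auto)
    show "continuous_on {0..s} (\<lambda>\<sigma>. cis (- \<epsilon> * of_int n * \<sigma>))" by (intro continuous_intros)
  qed
  then show ?thesis by (simp add: window_coeff_def)
qed

text \<open>The left side is the integral over the window of E(s) - E(\<sigma>), where E is the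
  oscillating factor; this difference is at most 2 and at most |n| s.\<close>

lemma window_coeff_estimate:
  assumes e: "\<epsilon> = 1 \<or> \<epsilon> = -1" and s: "0 \<le> s"
  shows "cmod (complex_of_real s * cis (- \<epsilon> * of_int n * s) - window_coeff \<epsilon> n (complex_of_real s)) \<le> s * min 2 (\<bar>of_int n\<bar> * s)"
proof -
  let ?E = "\<lambda>\<sigma>. cis (- \<epsilon> * of_int n * \<sigma>)"
  let ?m = "min 2 (\<bar>of_int n\<bar> * s)"
  have i1: "integrable lborel (\<lambda>\<sigma>. indicator {0..s} \<sigma> *\<^sub>R ?E t)" for t
    by (intro integrable_scaleR_left integrable_real_indicator) (auto simp: emeasure_lborel_Icc_eq)
  have i2: "integrable lborel (\<lambda>\<sigma>. indicator {0..s} \<sigma> *\<^sub>R ?E \<sigma>)"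
  proof -
    have "continuous_on {0..s} ?E" by (intro continuous_intros)
    from borel_integrable_atLeastAtMost'[OF this] show ?thesis unfolding set_integrable_def .
  qed
  have eq: "complex_of_real s * ?E s - window_coeff \<epsilon> n (complex_of_real s) = (\<integral>\<sigma>. indicator {0..s} \<sigma> *\<^sub>R ?E s - indicator {0..s} \<sigma> *\<^sub>R ?E \<sigma> \<partial>lborel)"
  proof -
    have "(\<integral>\<sigma>. indicator {0..s} \<sigma> *\<^sub>R ?E s \<partial>lborel) = (\<integral>\<sigma>. indicator {0..s} \<sigma> \<partial>lborel) *\<^sub>R ?E s"
      by (rule integral_scaleR_left) (auto intro!: integrable_real_indicator simp: emeasure_lborel_Icc_eq)
    also have "\<dots> = complex_of_real s * ?E s" using s by (simp add: scaleR_conv_of_real)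
    finally show ?thesis
      by (simp only: Bochner_Integration.integral_diff[OF i1 i2] window_coeff_integral[OF e s])
  qed
  have "cmod (\<integral>\<sigma>. indicator {0..s} \<sigma> *\<^sub>R ?E s - indicator {0..s} \<sigma> *\<^sub>R ?E \<sigma> \<partial>lborel) \<le> (\<integral>\<sigma>. indicator {0..s} \<sigma> * ?m \<partial>lborel)"
  proof (rule Bochner_Integration.integral_norm_bound_integral)
    show "integrable lborel (\<lambda>\<sigma>. indicator {0..s} \<sigma> *\<^sub>R ?E s - indicator {0..s} \<sigma> *\<^sub>R ?E \<sigma>)"
      by (rule Bochner_Integration.integrable_diff[OF i1 i2])
    show "integrable lborel (\<lambda>\<sigma>. indicator {0..s} \<sigma> * ?m)"
      by (intro integrable_mult_left integrable_real_indicator) (auto simp: emeasure_lborel_Icc_eq)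
    fix \<sigma>
    show "cmod (indicator {0..s} \<sigma> *\<^sub>R ?E s - indicator {0..s} \<sigma> *\<^sub>R ?E \<sigma>) \<le> indicator {0..s} \<sigma> * ?m"
    proof (cases "\<sigma> \<in> {0..s}")
      case True
      have "cmod (?E s - ?E \<sigma>) \<le> cmod (?E s) + cmod (?E \<sigma>)" by (rule norm_triangle_ineq4)
      moreover have "cmod (?E s - ?E \<sigma>) \<le> \<bar>of_int n\<bar> * s"
      proof -
        have "?E s - ?E \<sigma> = ?E \<sigma> * (cis (- \<epsilon> * of_int n * (s - \<sigma>)) - 1)"
          by (simp add: right_diff_distrib cis_mult algebra_simps)
        then have "cmod (?E s - ?E \<sigma>) = cmod (cis (- \<epsilon> * of_int n * (s - \<sigma>)) - 1)" by (simp add: norm_mult)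
        also have "\<dots> \<le> \<bar>- \<epsilon> * of_int n * (s - \<sigma>)\<bar>" by (rule cmod_cis_diff_one_le)
        also have "\<dots> = \<bar>of_int n\<bar> * (s - \<sigma>)" using True e by (auto simp: abs_mult)
        also have "\<dots> \<le> \<bar>of_int n\<bar> * s" using True by (intro mult_left_mono) auto
        finally show ?thesis .
      qed
      ultimately show ?thesis using True by simp
    qed simp
  qed
  also have "\<dots> = s * ?m" using s by simp
  finally show ?thesis unfolding eq .
qed

text \<open>Near s = 0 the terms -b / s^2 and E / s each grow like 1 / s. Grouped as (s E - b) / s^2
  they stay below min(2 / s, |n|) by the previous estimate. The term with 1 - E obeys the same
  bound, and 1 / \<delta> is left over from E / \<delta>.\<close>

lemma control_coeff_bound:
  assumes e: "\<epsilon> = 1 \<or> \<epsilon> = -1" and s: "0 < s" "s \<le> \<delta>"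
  shows "cmod (control_coeff \<epsilon> \<delta> n s) \<le> 2 * min (2 / s) \<bar>of_int n\<bar> + 1 / \<delta>"
proof -
  let ?E = "cis (- \<epsilon> * of_int n * s)"
  let ?b = "window_coeff \<epsilon> n (complex_of_real s)"
  let ?m = "min 2 (\<bar>of_int n\<bar> * s)"
  have \<delta>: "0 < \<delta>" using s by linarith
  have ms: "?m / s = min (2 / s) \<bar>of_int n\<bar>" using s by (simp add: min_divide_distrib_right)
  have split: "control_coeff \<epsilon> \<delta> n s = (1 / (complex_of_real s)\<^sup>2) * (complex_of_real s * ?E - ?b) - (1 / complex_of_real \<delta>) * ?E - (1 / complex_of_real s - 1 / complex_of_real \<delta>) * (\<i> * complex_of_real \<epsilon> * (1 - ?E))"
    using s by (simp add: control_coeff_def power2_eq_square right_diff_distrib left_diff_distrib distrib_left)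
  have "cmod ((1 / (complex_of_real s)\<^sup>2) * (complex_of_real s * ?E - ?b)) \<le> (1 / s\<^sup>2) * (s * ?m)"
    using window_coeff_estimate[OF e less_imp_le[OF s(1)], of n] by (simp add: norm_mult norm_divide norm_power divide_right_mono)
  also have "\<dots> = ?m / s" using s by (simp add: power2_eq_square)
  finally have 1: "cmod ((1 / (complex_of_real s)\<^sup>2) * (complex_of_real s * ?E - ?b)) \<le> ?m / s" .
  have 2: "cmod ((1 / complex_of_real \<delta>) * ?E) = 1 / \<delta>" using \<delta> by (simp add: norm_mult norm_divide)
  have E: "cmod (1 - ?E) \<le> ?m"
  proof -
    have "cmod (1 - ?E) \<le> cmod 1 + cmod ?E" by (rule norm_triangle_ineq4)
    moreover have "cmod (1 - ?E) \<le> \<bar>of_int n\<bar> * s"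
      using cmod_cis_diff_one_le[of "- \<epsilon> * of_int n * s"] e s by (auto simp: norm_minus_commute abs_mult)
    ultimately show ?thesis by simp
  qed
  have pos: "0 \<le> 1 / s - 1 / \<delta>" "1 / s - 1 / \<delta> \<le> 1 / s" using s \<delta> by (auto simp: frac_le)
  have "cmod ((1 / complex_of_real s - 1 / complex_of_real \<delta>) * (\<i> * complex_of_real \<epsilon> * (1 - ?E))) = (1 / s - 1 / \<delta>) * cmod (1 - ?E)"
  proof -
    have "cmod (complex_of_real (1 / s - 1 / \<delta>)) = 1 / s - 1 / \<delta>" using pos(1) by (simp only: norm_of_real abs_of_nonneg)
    moreover have "cmod (\<i> * complex_of_real \<epsilon> * (1 - ?E)) = cmod (1 - ?E)" using e by (auto simp: norm_mult)
    ultimately show ?thesis by (simp only: norm_mult of_real_diff of_real_divide of_real_1)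
  qed
  also have "\<dots> \<le> (1 / s) * ?m" using pos E s by (intro mult_mono) auto
  finally have 3: "cmod ((1 / complex_of_real s - 1 / complex_of_real \<delta>) * (\<i> * complex_of_real \<epsilon> * (1 - ?E))) \<le> ?m / s" by simp
  have "cmod (control_coeff \<epsilon> \<delta> n s) \<le> cmod ((1 / (complex_of_real s)\<^sup>2) * (complex_of_real s * ?E - ?b)) + cmod ((1 / complex_of_real \<delta>) * ?E) + cmod ((1 / complex_of_real s - 1 / complex_of_real \<delta>) * (\<i> * complex_of_real \<epsilon> * (1 - ?E)))"
    unfolding split by (meson add_right_mono norm_triangle_ineq4 order_trans)
  also have "\<dots> \<le> ?m / s + 1 / \<delta> + ?m / s" using 1 2 3 by linarith
  finally show ?thesis unfolding ms by simp
qed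

text \<open>The integrand is the derivative of \<open>(1/s - 1/\<delta>) e\<^sup>n\<^sup>s\<close> times the window coefficient.\<close>

lemma control_coeff_integral:
  assumes e: "\<epsilon> = 1 \<or> \<epsilon> = -1" and \<delta>: "0 < \<delta>" "\<delta> \<le> T"
  shows "(\<integral>s. complex_of_real (exp (of_int n * s)) * (if 0 < s \<and> s \<le> \<delta> then control_coeff \<epsilon> \<delta> n s else 0) \<partial>lebesgue_on {0..T}) = -1"
proof -
  let ?b = "window_coeff \<epsilon> n"
  let ?c = "- \<i> * complex_of_real \<epsilon> * of_int n"
  define \<Phi> where "\<Phi> x = (1 / x - 1 / complex_of_real \<delta>) * (?b x * exp (of_int n * x))" for x :: complex
  define f where "f s = complex_of_real (exp (of_int n * s)) * control_coeff \<epsilon> \<delta> n s" for s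
  have e0: "\<epsilon> \<noteq> 0" using e by auto
  have f_eq: "f s = - (1 / (complex_of_real s)\<^sup>2) * (?b (complex_of_real s) * exp (of_int n * complex_of_real s))
      + (1 / complex_of_real s - 1 / complex_of_real \<delta>) * (exp (?c * complex_of_real s) * exp (of_int n * complex_of_real s) + ?b (complex_of_real s) * (of_int n * exp (of_int n * complex_of_real s)))" for s
  proof -
    have nb: "- (\<i> * complex_of_real \<epsilon> * (1 - cis (- \<epsilon> * of_int n * s))) = of_int n * ?b (complex_of_real s)"
      using window_coeff_mult[OF e, of n s] by simp
    have ex: "complex_of_real (exp (of_int n * s)) = exp (of_int n * complex_of_real s)"
      by (simp flip: exp_of_real)
    have c: "control_coeff \<epsilon> \<delta> n s = - (1 / (complex_of_real s)\<^sup>2) * ?b (complex_of_real s) + (1 / complex_of_real s - 1 / complex_of_real \<delta>) * (exp (?c * complex_of_real s) + of_int n * ?b (complex_of_real s))"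
    proof -
      have "control_coeff \<epsilon> \<delta> n s = - (1 / (complex_of_real s)\<^sup>2) * ?b (complex_of_real s)
          + (1 / complex_of_real s - 1 / complex_of_real \<delta>) * (cis (- \<epsilon> * of_int n * s) + - (\<i> * complex_of_real \<epsilon> * (1 - cis (- \<epsilon> * of_int n * s))))"
        by (simp add: control_coeff_def)
      then show ?thesis unfolding nb unfolding cis_eq_exp_param .
    qed
    show ?thesis unfolding f_def ex c by (simp add: algebra_simps)
  qed
  have \<Phi>': "(\<Phi> has_field_derivative f s) (at (complex_of_real s))" if "s \<noteq> 0" for s
  proof -
    let ?x = "complex_of_real s"
    have 1: "((\<lambda>x. 1 / x - 1 / complex_of_real \<delta>) has_field_derivative - (1 / ?x\<^sup>2)) (at ?x)"
      using that by (auto intro!: derivative_eq_intros simp: power2_eq_square)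
    have "((\<lambda>x. exp (of_int n * x)) has_field_derivative of_int n * exp (of_int n * ?x)) (at ?x)"
      by (auto intro!: derivative_eq_intros)
    from DERIV_mult[OF window_coeff_derivative[OF e0] this]
    have 2: "((\<lambda>x. ?b x * exp (of_int n * x)) has_field_derivative
        exp (?c * ?x) * exp (of_int n * ?x) + of_int n * exp (of_int n * ?x) * ?b ?x) (at ?x)" .
    from DERIV_mult[OF 1 2] show ?thesis
      unfolding \<Phi>_def[abs_def] by (rule DERIV_cong) (simp add: f_eq mult.commute mult.left_commute)
  qed
  have b_cont: "continuous_on A ?b" for A
    by (rule DERIV_continuous_on) (use window_coeff_derivative[OF e0] has_field_derivative_at_within in blast)
  have b_meas: "(\<lambda>s. ?b (complex_of_real s)) \<in> borel_measurable borel"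
    by (intro borel_measurable_continuous_onI continuous_on_compose2[OF b_cont[of UNIV]] continuous_intros) auto
  have "f \<in> borel_measurable borel"
    unfolding f_eq[abs_def] using b_meas by measurable
  then have f_meas: "(\<lambda>s. indicator A s *\<^sub>R f s) \<in> borel_measurable borel" if "A \<in> sets borel" for A
    using that by (intro borel_measurable_scaleR borel_measurable_indicator)
  define C where "C = exp (\<bar>of_int n\<bar> * \<delta>) * (2 * \<bar>of_int n\<bar> + 1 / \<delta>)"
  have f_bound: "cmod (f s) \<le> C" if "0 < s" "s \<le> \<delta>" for s
  proof -
    have "cmod (control_coeff \<epsilon> \<delta> n s) \<le> 2 * min (2 / s) \<bar>of_int n\<bar> + 1 / \<delta>" by (rule control_coeff_bound[OF e that])
    also have "\<dots> \<le> 2 * \<bar>of_int n\<bar> + 1 / \<delta>" by simp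
    finally show ?thesis
      unfolding f_def C_def norm_mult using exp_bounded_time[of s \<delta> "of_int n"] that \<delta> by (intro mult_mono) auto
  qed
  \<comment> \<open>The antiderivative \<open>\<Phi>\<close> has a quotient by 0 at the origin, so
    the fundamental theorem is used on [\<eta> k, \<delta>]; the bound \<open>C\<close> for fixed n
    allows the limit. The upper end contributes 0 because 1/s - 1/\<delta> vanishes at
    \<delta>.\<close>
  define \<eta> where "\<eta> k = \<delta> / real (Suc k)" for k
  have \<eta>: "0 < \<eta> k" "\<eta> k \<le> \<delta>" for k using \<delta> by (auto simp: \<eta>_def field_simps)
  have \<eta>_lim: "\<eta> \<longlonglongrightarrow> 0"
    using tendsto_mult_right_zero[OF LIMSEQ_inverse_real_of_nat, of \<delta>] by (simp add: \<eta>_def[abs_def] divide_inverse)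
  have part: "(\<integral>s. indicator {\<eta> k..\<delta>} s *\<^sub>R f s \<partial>lborel) = - \<Phi> (\<eta> k)" for k
  proof -
    have "(\<integral>s. indicator {\<eta> k..\<delta>} s *\<^sub>R f s \<partial>lborel) = \<Phi> (complex_of_real \<delta>) - \<Phi> (complex_of_real (\<eta> k))"
    proof (rule integral_FTC_Icc[OF \<eta>(2)])
      show "((\<lambda>s. \<Phi> (complex_of_real s)) has_vector_derivative f x) (at x within {\<eta> k..\<delta>})" if "\<eta> k \<le> x" for x
        by (rule has_vector_derivative_real_field[OF \<Phi>']) (use that \<eta>(1)[of k] in linarith)
      have "continuous_on {\<eta> k..\<delta>} (\<lambda>s. ?b (complex_of_real s))"
        by (intro continuous_on_compose2[OF b_cont[of UNIV]] continuous_intros) auto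
      then show "continuous_on {\<eta> k..\<delta>} f"
        unfolding f_eq[abs_def] using \<eta>(1)[of k] by (intro continuous_intros) auto
    qed
    then show ?thesis by (simp add: \<Phi>_def)
  qed
  have "(\<lambda>k. \<integral>s. indicator {\<eta> k..\<delta>} s *\<^sub>R f s \<partial>lborel) \<longlonglongrightarrow> (\<integral>s. indicator {0<..\<delta>} s *\<^sub>R f s \<partial>lborel)"
  proof (rule integral_dominated_convergence[where w="\<lambda>s. indicator {0..\<delta>} s * C"])
    show "integrable lborel (\<lambda>s. indicator {0..\<delta>} s * C)"
      by (intro integrable_mult_left integrable_real_indicator) (auto simp: emeasure_lborel_Icc_eq)
    show "AE s in lborel. (\<lambda>k. indicator {\<eta> k..\<delta>} s *\<^sub>R f s) \<longlonglongrightarrow> indicator {0<..\<delta>} s *\<^sub>R f s"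
    proof (rule AE_I2, rule tendsto_eventually)
      fix s
      show "\<forall>\<^sub>F k in sequentially. indicator {\<eta> k..\<delta>} s *\<^sub>R f s = indicator {0<..\<delta>} s *\<^sub>R f s"
      proof (cases "0 < s")
        case True
        from order_tendstoD(2)[OF \<eta>_lim this] show ?thesis
          by eventually_elim (use True in \<open>auto split: split_indicator\<close>)
      next
        case False
        then have "indicator {\<eta> k..\<delta>} s *\<^sub>R f s = indicator {0<..\<delta>} s *\<^sub>R f s" for k
          using \<eta>(1)[of k] by (auto split: split_indicator)
        then show ?thesis by simp
      qed
    qed
    show "AE s in lborel. cmod (indicator {\<eta> k..\<delta>} s *\<^sub>R f s) \<le> indicator {0..\<delta>} s * C" for k
    proof (rule AE_I2)
      fix s
      show "cmod (indicator {\<eta> k..\<delta>} s *\<^sub>R f s) \<le> indicator {0..\<delta>} s * C"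
      proof (cases "s \<in> {\<eta> k..\<delta>}")
        case True
        then have "0 < s" "s \<le> \<delta>" using \<eta>(1)[of k] by auto
        with f_bound[OF this] True show ?thesis by simp
      next
        case False
        have "0 \<le> C" using \<delta> by (simp add: C_def)
        then show ?thesis using False by simp
      qed
    qed
  qed (simp_all add: f_meas)
  \<comment> \<open>Near 0 the function \<open>\<Phi>\<close> behaves like b(s) / s, which tends to
    the derivative of the window coefficient at 0, namely 1.\<close>
  moreover have "(\<lambda>k. - \<Phi> (\<eta> k)) \<longlonglongrightarrow> - 1"
  proof -
    have lim0: "(\<lambda>k. complex_of_real (\<eta> k)) \<longlonglongrightarrow> 0" using tendsto_of_real[OF \<eta>_lim, where 'a=complex] by simp
    have "filterlim (\<lambda>k. complex_of_real (\<eta> k)) (at 0) sequentially"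
      using lim0 \<eta>(1) by (intro filterlim_atI) (auto simp: less_imp_neq[symmetric] eventually_sequentially)
    moreover have "?b 0 = 0" by (simp add: window_coeff_def)
    then have "((\<lambda>x. ?b x / x) \<longlongrightarrow> 1) (at 0)"
      using window_coeff_derivative[OF e0, of n 0] by (simp add: has_field_derivative_iff)
    ultimately have q: "(\<lambda>k. ?b (\<eta> k) / \<eta> k) \<longlonglongrightarrow> 1" by (rule filterlim_compose[rotated])
    let ?d = "complex_of_real \<delta>"
    have "(\<lambda>k. (?b (\<eta> k) / \<eta> k) * ((1 - complex_of_real (\<eta> k) / ?d) * exp (of_int n * complex_of_real (\<eta> k)))) \<longlonglongrightarrow> 1 * ((1 - 0 / ?d) * exp (of_int n * 0))"
      by (intro tendsto_intros q lim0) (use \<delta> in simp)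
    moreover have "(?b (\<eta> k) / \<eta> k) * ((1 - complex_of_real (\<eta> k) / ?d) * exp (of_int n * complex_of_real (\<eta> k))) = \<Phi> (\<eta> k)" for k
    proof -
      have "complex_of_real (\<eta> k) \<noteq> 0" using \<eta>(1)[of k] by simp
      then have "1 / complex_of_real (\<eta> k) - 1 / ?d = (1 - complex_of_real (\<eta> k) / ?d) / complex_of_real (\<eta> k)"
        by (simp add: diff_divide_distrib)
      then show ?thesis by (simp add: \<Phi>_def)
    qed
    ultimately have "(\<lambda>k. \<Phi> (\<eta> k)) \<longlonglongrightarrow> 1" by simp
    then show ?thesis by (rule tendsto_minus)
  qed
  ultimately have main: "(\<integral>s. indicator {0<..\<delta>} s *\<^sub>R f s \<partial>lborel) = -1"
    unfolding part by (rule LIMSEQ_unique)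
  let ?g = "\<lambda>s. complex_of_real (exp (of_int n * s)) * (if 0 < s \<and> s \<le> \<delta> then control_coeff \<epsilon> \<delta> n s else 0)"
  have g: "?g s = indicator {0<..\<delta>} s *\<^sub>R f s" for s by (auto simp: f_def split: split_indicator)
  have "(\<integral>s. ?g s \<partial>lebesgue_on {0..T}) = (\<integral>s. indicator {0..T} s *\<^sub>R (indicator {0<..\<delta>} s *\<^sub>R f s) \<partial>lborel)"
    unfolding g by (rule time_integral_lborel) (simp add: f_meas)
  also have "\<dots> = (\<integral>s. indicator {0<..\<delta>} s *\<^sub>R f s \<partial>lborel)"
    using \<delta> by (intro Bochner_Integration.integral_cong) (auto split: split_indicator)
  finally show ?thesis using main by simp
qed

section \<open>The window integral and the one-sided control in physical variables\<close>

lemma window_integral_bound: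
  assumes h: "integrable circle h" and e: "\<epsilon> = 1 \<or> \<epsilon> = -1" and s: "s \<le> 1" and z: "cmod z = 1"
  shows "cmod (window_integral \<epsilon> h s z) \<le> (\<integral>w. cmod (h w) \<partial>circle)"
proof -
  have [measurable]: "h \<in> borel_measurable circle" using h by auto
  let ?k = "\<lambda>\<sigma>. indicator {0..s} \<sigma> *\<^sub>R h (z * cis (- \<epsilon> * \<sigma>))"
  have "ennreal (cmod (window_integral \<epsilon> h s z)) \<le> (\<integral>\<^sup>+\<sigma>. ennreal (cmod (?k \<sigma>)) \<partial>lborel)"
  \<comment> \<open>Without integrability the window integral is 0 by default, which satisfies the
    bound.\<close>
  proof (cases "integrable lborel ?k")
    case True
    then show ?thesis unfolding window_integral_def by (rule integral_norm_bound_ennreal)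
  qed (simp add: window_integral_def not_integrable_integral_eq)
  also have "\<dots> \<le> (\<integral>\<^sup>+\<sigma>. ennreal (cmod (h (cis (Arg z + (- \<epsilon>) * \<sigma>)))) * indicator {0..<2*pi} \<sigma> \<partial>lborel)"
  proof (rule nn_integral_mono)
    fix \<sigma>
    have "z \<noteq> 0" using z by auto
    then have "cis (Arg z) = z" using cis_Arg[of z] z by (simp add: sgn_eq)
    then have "cis (Arg z + (- \<epsilon>) * \<sigma>) = z * cis (- \<epsilon> * \<sigma>)"
      by (simp only: cis_mult[symmetric])
    \<comment> \<open>As s <= 1 < 2 pi, the window does not overlap itself, and the full circle
      majorises it.\<close>
    moreover have "\<sigma> \<in> {0..s} \<Longrightarrow> \<sigma> \<in> {0..<2*pi}" using s pi_gt3 by auto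
    ultimately show "ennreal (cmod (?k \<sigma>)) \<le> ennreal (cmod (h (cis (Arg z + (- \<epsilon>) * \<sigma>)))) * indicator {0..<2*pi} \<sigma>"
      by (auto split: split_indicator)
  qed
  also have "\<dots> = (\<integral>\<^sup>+w. ennreal (cmod (h w)) \<partial>circle)"
    using e by (intro nn_integral_circle_affine[of "\<lambda>w. ennreal (cmod (h w))"]) auto
  also have "\<dots> = ennreal (\<integral>w. cmod (h w) \<partial>circle)"
    using h by (intro nn_integral_eq_integral) auto
  finally show ?thesis by (simp add: ennreal_le_iff)
qed

lemma shift_measurable:
  assumes "h \<in> borel_measurable circle" "a \<in> borel_measurable M" "b \<in> measurable M circle"
  shows "(\<lambda>x. h (b x * cis (a x))) \<in> borel_measurable M"
  using measurable_compose[OF mult_cis_measurable_circle[OF assms(3,2)] assms(1)] .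

lemma window_integral_measurable:
  assumes h: "h \<in> borel_measurable circle" and a: "a \<in> borel_measurable M" and b: "b \<in> measurable M circle"
  shows "(\<lambda>x. window_integral \<epsilon> h (a x) (b x)) \<in> borel_measurable M"
proof -
  have b': "(\<lambda>q. b (fst q)) \<in> measurable (M \<Otimes>\<^sub>M lborel) circle"
    by (rule measurable_compose[OF measurable_fst b])
  have a'[measurable]: "(\<lambda>q. a (fst q)) \<in> borel_measurable (M \<Otimes>\<^sub>M lborel)"
    by (rule measurable_compose[OF measurable_fst a])
  have [measurable]: "(\<lambda>q. h (b (fst q) * cis (- \<epsilon> * snd q))) \<in> borel_measurable (M \<Otimes>\<^sub>M lborel)"
    by (rule shift_measurable[OF h _ b']) measurable
  have "(\<lambda>q. (if 0 \<le> snd q \<and> snd q \<le> a (fst q) then h (b (fst q) * cis (- \<epsilon> * snd q)) else 0)) \<in> borel_measurable (M \<Otimes>\<^sub>M lborel)"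
    by measurable
  moreover have "(\<lambda>q. (if 0 \<le> snd q \<and> snd q \<le> a (fst q) then h (b (fst q) * cis (- \<epsilon> * snd q)) else 0))
     = (\<lambda>(x, \<sigma>). indicator {0..a x} \<sigma> *\<^sub>R h (b x * cis (- \<epsilon> * \<sigma>)))"
    by (auto simp: fun_eq_iff split: split_indicator)
  ultimately show ?thesis
    unfolding window_integral_def by (intro lborel.borel_measurable_lebesgue_integral) simp
qed

lemma window_integral_L2:
  assumes h: "h \<in> L2 circle" and e: "\<epsilon> = 1 \<or> \<epsilon> = -1" and s: "0 \<le> s" "s \<le> 1"
  shows "window_integral \<epsilon> h s \<in> L2 circle"
    and "fourier_coeff (window_integral \<epsilon> h s) n = window_coeff \<epsilon> n (complex_of_real s) * fourier_coeff h n"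
proof -
  note hm[measurable] = L2D(1)[OF h]
  have hi: "integrable circle h" by (rule circle.L2_integrable[OF h])
  show "window_integral \<epsilon> h s \<in> L2 circle"
  proof (rule circle.L2_boundedI)
    show "window_integral \<epsilon> h s \<in> borel_measurable circle"
      using window_integral_measurable[OF hm, of "\<lambda>_. s" circle "\<lambda>z. z" \<epsilon>] by simp
    show "cmod (window_integral \<epsilon> h s z) \<le> (\<integral>w. cmod (h w) \<partial>circle)" if "z \<in> space circle" for z
      using that by (intro window_integral_bound[OF hi e s(2)]) simp
  qed
  interpret P: pair_sigma_finite lborel circle
    by (intro pair_sigma_finite.intro finite_measure.axioms(1)[OF finite_measure_circle] lborel.sigma_finite_measure_axioms)
  let ?k = "\<lambda>\<sigma> z. indicator {0..s} \<sigma> *\<^sub>R (h (z * cis (- \<epsilon> * \<sigma>)) * z powi (-n))"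
  have shift: "integrable circle (\<lambda>z. h (z * cis t))" for t
    by (rule circle.L2_integrable[OF fourier_coeff_rotate(1)[OF h]])
  have k_meas: "(\<lambda>(\<sigma>, z). ?k \<sigma> z) \<in> borel_measurable (lborel \<Otimes>\<^sub>M circle)"
  proof -
    have [measurable]: "(\<lambda>q. h (snd q * cis (- \<epsilon> * fst q))) \<in> borel_measurable (lborel \<Otimes>\<^sub>M circle)"
      by (rule shift_measurable[OF hm]) measurable
    have [measurable]: "(\<lambda>q. snd q powi (-n)) \<in> borel_measurable (lborel \<Otimes>\<^sub>M circle)"
      by (rule measurable_compose[OF measurable_snd powi_measurable_circle])
    show ?thesis unfolding split_beta' by measurable
  qed
  have k_int: "integrable (lborel \<Otimes>\<^sub>M circle) (\<lambda>(\<sigma>, z). ?k \<sigma> z)"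
  proof (rule P.Fubini_integrable[OF k_meas])
    have "(\<integral>z. norm (?k \<sigma> z) \<partial>circle) = indicator {0..s} \<sigma> * (\<integral>z. cmod (h z) \<partial>circle)" for \<sigma>
    proof -
      have "(\<integral>z. norm (?k \<sigma> z) \<partial>circle) = (\<integral>z. indicator {0..s} \<sigma> * cmod (h (z * cis (- \<epsilon> * \<sigma>))) \<partial>circle)"
        by (rule Bochner_Integration.integral_cong[OF refl]) (auto simp: norm_mult cmod_powi_circle)
      also have "\<dots> = indicator {0..s} \<sigma> * (\<integral>z. cmod (h (z * cis (- \<epsilon> * \<sigma>))) \<partial>circle)" by simp
      also have "(\<integral>z. cmod (h (z * cis (- \<epsilon> * \<sigma>))) \<partial>circle) = (\<integral>z. cmod (h z) \<partial>circle)"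
        by (rule integral_circle_rotate[of "\<lambda>z. cmod (h z)"]) measurable
      finally show ?thesis .
    qed
    moreover have "integrable lborel (\<lambda>\<sigma>. indicator {0..s} \<sigma> * (\<integral>z. cmod (h z) \<partial>circle))"
      by (intro integrable_mult_left integrable_real_indicator) (auto simp: emeasure_lborel_Icc_eq)
    ultimately show "integrable lborel (\<lambda>\<sigma>. \<integral>z. norm (case (\<sigma>, z) of (\<sigma>, z) \<Rightarrow> ?k \<sigma> z) \<partial>circle)" by (simp only: prod.case)
    show "AE \<sigma> in lborel. integrable circle (\<lambda>z. case (\<sigma>, z) of (\<sigma>, z) \<Rightarrow> ?k \<sigma> z)"
      by (rule AE_I2) (simp only: prod.case, intro integrable_scaleR_right integrable_mult_powi shift)
  qed
  have "(\<integral>z. window_integral \<epsilon> h s z * z powi (-n) \<partial>circle) = (\<integral>z. (\<integral>\<sigma>. ?k \<sigma> z \<partial>lborel) \<partial>circle)"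
    unfolding window_integral_def by (simp only: integral_mult_left_zero flip: mult_scaleR_left)
  also have "\<dots> = (\<integral>\<sigma>. (\<integral>z. ?k \<sigma> z \<partial>circle) \<partial>lborel)"
    by (rule P.Fubini_integral[OF k_int])
  also have "\<dots> = (\<integral>\<sigma>. (indicator {0..s} \<sigma> *\<^sub>R cis (- \<epsilon> * of_int n * \<sigma>)) * (2 * pi * fourier_coeff h n) \<partial>lborel)"
  proof (rule Bochner_Integration.integral_cong[OF refl])
    fix \<sigma>
    have "(\<integral>z. h (z * cis (- \<epsilon> * \<sigma>)) * z powi (-n) \<partial>circle) = 2 * pi * fourier_coeff (\<lambda>z. h (z * cis (- \<epsilon> * \<sigma>))) n"
      by (simp add: fourier_coeff_def)
    also have "\<dots> = cis (- \<epsilon> * of_int n * \<sigma>) * (2 * pi * fourier_coeff h n)"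
      by (simp add: fourier_coeff_rotate(2)[OF h] mult_ac)
    finally show "(\<integral>z. ?k \<sigma> z \<partial>circle) = (indicator {0..s} \<sigma> *\<^sub>R cis (- \<epsilon> * of_int n * \<sigma>)) * (2 * pi * fourier_coeff h n)"
      by (simp only: integral_scaleR_right mult_scaleR_left)
  qed
  also have "\<dots> = window_coeff \<epsilon> n (complex_of_real s) * (2 * pi * fourier_coeff h n)"
    by (simp only: integral_mult_left_zero window_coeff_integral[OF e s(1)])
  finally show "fourier_coeff (window_integral \<epsilon> h s) n = window_coeff \<epsilon> n (complex_of_real s) * fourier_coeff h n"
    by (simp add: fourier_coeff_def[of "window_integral \<epsilon> h s"])
qed

lemma one_sided_control_slice:
  assumes h: "h \<in> L2 circle" and e: "\<epsilon> = 1 \<or> \<epsilon> = -1" and \<delta>: "\<delta> \<le> 1"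
  shows "(\<lambda>z. one_sided_control \<epsilon> \<delta> h (s, z)) \<in> L2 circle"
    and "fourier_coeff (\<lambda>z. one_sided_control \<epsilon> \<delta> h (s, z)) n = (if 0 < s \<and> s \<le> \<delta> then control_coeff \<epsilon> \<delta> n s else 0) * fourier_coeff h n"
proof -
  let ?B = "\<lambda>z. complex_of_real (- (1 / s\<^sup>2)) * window_integral \<epsilon> h s z"
  let ?r = "\<lambda>z. h (z * cis (- \<epsilon> * s))"
  let ?R = "\<lambda>z. complex_of_real (1 / s - 1 / \<delta>) * (?r z - \<i> * \<epsilon> * (h z - ?r z))"
  have r: "?r \<in> L2 circle" by (rule fourier_coeff_rotate(1)[OF h])
  have R: "?R \<in> L2 circle" by (intro L2_cmult L2_diff r h)
  have Rc: "fourier_coeff ?R n = complex_of_real (1 / s - 1 / \<delta>) * (cis (- \<epsilon> * of_int n * s) - \<i> * \<epsilon> * (1 - cis (- \<epsilon> * of_int n * s))) * fourier_coeff h n"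
  proof -
    have "fourier_coeff ?r n = cis (- \<epsilon> * of_int n * s) * fourier_coeff h n"
      using fourier_coeff_rotate(2)[OF h, of "- \<epsilon> * s" n] by (simp add: mult_ac)
    moreover have "fourier_coeff ?R n = complex_of_real (1 / s - 1 / \<delta>) * (fourier_coeff ?r n - \<i> * \<epsilon> * (fourier_coeff h n - fourier_coeff ?r n))"
      using r h by (simp only: fourier_coeff_cmult fourier_coeff_diff circle.L2_integrable L2_cmult L2_diff)
    ultimately show ?thesis by (simp add: algebra_simps)
  qed
  have "(\<lambda>z. one_sided_control \<epsilon> \<delta> h (s, z)) \<in> L2 circle \<and>
    fourier_coeff (\<lambda>z. one_sided_control \<epsilon> \<delta> h (s, z)) n = (if 0 < s \<and> s \<le> \<delta> then control_coeff \<epsilon> \<delta> n s else 0) * fourier_coeff h n"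
  proof (cases "0 < s \<and> s \<le> \<delta>")
    case True
    then have s: "0 \<le> s" "s \<le> 1" using \<delta> by auto
    have eq: "(\<lambda>z. one_sided_control \<epsilon> \<delta> h (s, z)) = (\<lambda>z. ?B z + ?R z)"
      using True by (auto simp: one_sided_control_def)
    have B: "?B \<in> L2 circle" by (intro L2_cmult window_integral_L2(1)[OF h e s])
    have Bc: "fourier_coeff ?B n = complex_of_real (- (1 / s\<^sup>2)) * (window_coeff \<epsilon> n (complex_of_real s) * fourier_coeff h n)"
      by (simp only: fourier_coeff_cmult window_integral_L2(2)[OF h e s])
    have "fourier_coeff (\<lambda>z. ?B z + ?R z) n = fourier_coeff ?B n + fourier_coeff ?R n"
      by (intro fourier_coeff_add circle.L2_integrable B R)
    also have "\<dots> = control_coeff \<epsilon> \<delta> n s * fourier_coeff h n"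
      unfolding Bc Rc by (simp only: control_coeff_def distrib_right mult.assoc) simp
    finally show ?thesis unfolding eq using True L2_add[OF B R] by simp
  next
    case False
    then have zero: "(\<lambda>z. one_sided_control \<epsilon> \<delta> h (s, z)) = (\<lambda>z. 0)" by (auto simp: one_sided_control_def)
    show ?thesis unfolding zero if_not_P[OF False] by (simp add: L2_zero fourier_coeff_def)
  qed
  then show "(\<lambda>z. one_sided_control \<epsilon> \<delta> h (s, z)) \<in> L2 circle"
    "fourier_coeff (\<lambda>z. one_sided_control \<epsilon> \<delta> h (s, z)) n = (if 0 < s \<and> s \<le> \<delta> then control_coeff \<epsilon> \<delta> n s else 0) * fourier_coeff h n"
    by auto
qed

lemma one_sided_control_measurable:
  assumes h: "h \<in> borel_measurable circle"
  shows "one_sided_control \<epsilon> \<delta> h \<in> borel_measurable (space_time T)"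
proof -
  have [measurable]: "(\<lambda>p. window_integral \<epsilon> h (fst p) (snd p)) \<in> borel_measurable (space_time T)"
    by (rule window_integral_measurable[OF h time_measurable measurable_snd])
  have [measurable]: "(\<lambda>p. h (snd p * cis (- \<epsilon> * fst p))) \<in> borel_measurable (space_time T)"
  proof (rule shift_measurable[OF h _ measurable_snd])
    show "(\<lambda>p. - \<epsilon> * fst p) \<in> borel_measurable (space_time T)"
      by (rule measurable_compose[OF time_measurable]) measurable
  qed
  have [measurable]: "(\<lambda>p. h (snd p)) \<in> borel_measurable (space_time T)"
    by (rule measurable_compose[OF measurable_snd h])
  have t[measurable]: "(\<lambda>p. fst p) \<in> borel_measurable (space_time T)" by (rule time_measurable)
  have [measurable]: "(\<lambda>p. - (1 / complex_of_real ((fst p)\<^sup>2))) \<in> borel_measurable (space_time T)"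
    by (rule measurable_compose[OF time_measurable]) measurable
  have [measurable]: "(\<lambda>p. 1 / complex_of_real (fst p) - 1 / complex_of_real \<delta>) \<in> borel_measurable (space_time T)"
    by (rule measurable_compose[OF time_measurable]) measurable
  have "(\<lambda>p. if 0 < fst p \<and> fst p \<le> \<delta> then
      - (1 / complex_of_real ((fst p)\<^sup>2)) * window_integral \<epsilon> h (fst p) (snd p)
      + (1 / complex_of_real (fst p) - 1 / complex_of_real \<delta>) * (h (snd p * cis (- \<epsilon> * fst p)) - \<i> * \<epsilon> * (h (snd p) - h (snd p * cis (- \<epsilon> * fst p)))) else 0)
      \<in> borel_measurable (space_time T)"
  proof (rule measurable_If)
    show "{p \<in> space (space_time T). 0 < fst p \<and> fst p \<le> \<delta>} \<in> sets (space_time T)"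
      using t by measurable
  qed measurable
  then show ?thesis by (simp add: one_sided_control_def split_beta')
qed

text \<open>In frequency the squared norm is a sum of |c_n|^2 times the time integral of the squared
  multiplier, which grows at most linearly in |n|. This is where membership of \<open>h\<close> in
  the Sobolev space is spent.\<close>

lemma one_sided_control_L2:
  assumes h: "h \<in> sobolev_half" and e: "\<epsilon> = 1 \<or> \<epsilon> = -1" and \<delta>: "0 < \<delta>" "\<delta> \<le> 1"
  shows "one_sided_control \<epsilon> \<delta> h \<in> L2 (space_time T)"
proof -
  let ?u = "one_sided_control \<epsilon> \<delta> h"
  let ?c = "fourier_coeff h"
  have hL: "h \<in> L2 circle" using h by (simp add: sobolev_half_def)
  have um[measurable]: "?u \<in> borel_measurable (space_time T)" by (rule one_sided_control_measurable[OF L2D(1)[OF hL]])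
  obtain S where S: "((\<lambda>n. of_int \<bar>n\<bar> * (cmod (?c n))\<^sup>2) has_sum S) UNIV"
    using h by (auto simp: sobolev_half_def summable_on_def)
  obtain S' where S': "((\<lambda>n. (cmod (?c n))\<^sup>2) has_sum S') UNIV"
    using fourier_coeff_square_summable[OF hL] by (auto simp: summable_on_def)
  have coeff_int: "(\<integral>\<^sup>+s. ennreal (2 * pi * (cmod (fourier_coeff (\<lambda>z. ?u (s, z)) n))\<^sup>2) \<partial>lebesgue_on {0..T})
     \<le> ennreal (80 * pi) * ennreal (of_int \<bar>n\<bar> * (cmod (?c n))\<^sup>2) + ennreal (4 * pi / \<delta>) * ennreal ((cmod (?c n))\<^sup>2)" for n
  proof -
    let ?N = "real_of_int \<bar>n\<bar>"
    let ?m = "\<lambda>s. min (2 / s) ?N"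
    \<comment> \<open>Squaring the bound 2 m + 1/\<delta> gives at most 8 m^2 + 2/\<delta>^2; the
      factor 2 pi of Parseval's identity makes this 16 pi and 4 pi/\<delta>^2. Integration then
      brings 5 |n| and \<delta>.\<close>
    have point: "ennreal (2 * pi * (cmod (fourier_coeff (\<lambda>z. ?u (s, z)) n))\<^sup>2) * indicator {0..T} s
       \<le> ennreal (16 * pi * (cmod (?c n))\<^sup>2) * (ennreal ((?m s)\<^sup>2) * indicator {0<..1} s) + ennreal (4 * pi / \<delta>\<^sup>2 * (cmod (?c n))\<^sup>2) * indicator {0..\<delta>} s" for s
    proof (cases "0 < s \<and> s \<le> \<delta>")
      case True
      have "(cmod (control_coeff \<epsilon> \<delta> n s))\<^sup>2 \<le> (2 * ?m s + 1 / \<delta>)\<^sup>2"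
        using control_coeff_bound[OF e, of s \<delta> n] True by (intro power_mono) auto
      also have "\<dots> \<le> 2 * (2 * ?m s)\<^sup>2 + 2 * (1 / \<delta>)\<^sup>2"
        using sum_squares_bound[of "2 * ?m s" "1 / \<delta>"] by (simp add: power2_sum)
      finally have b: "(cmod (control_coeff \<epsilon> \<delta> n s))\<^sup>2 \<le> 8 * (?m s)\<^sup>2 + 2 / \<delta>\<^sup>2"
        by (simp add: power_mult_distrib power_divide)
      have "2 * pi * (cmod (fourier_coeff (\<lambda>z. ?u (s, z)) n))\<^sup>2 = 2 * pi * (cmod (?c n))\<^sup>2 * (cmod (control_coeff \<epsilon> \<delta> n s))\<^sup>2"
        using True by (simp add: one_sided_control_slice(2)[OF hL e \<delta>(2)] norm_mult power_mult_distrib mult_ac)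
      also have "\<dots> \<le> 2 * pi * (cmod (?c n))\<^sup>2 * (8 * (?m s)\<^sup>2 + 2 / \<delta>\<^sup>2)" by (rule mult_left_mono[OF b]) simp
      also have "\<dots> = 16 * pi * (cmod (?c n))\<^sup>2 * (?m s)\<^sup>2 + 4 * pi / \<delta>\<^sup>2 * (cmod (?c n))\<^sup>2" by (simp add: algebra_simps)
      finally have "ennreal (2 * pi * (cmod (fourier_coeff (\<lambda>z. ?u (s, z)) n))\<^sup>2) \<le> ennreal (16 * pi * (cmod (?c n))\<^sup>2 * (?m s)\<^sup>2 + 4 * pi / \<delta>\<^sup>2 * (cmod (?c n))\<^sup>2)"
        by (rule ennreal_leI)
      also have "\<dots> = ennreal (16 * pi * (cmod (?c n))\<^sup>2) * ennreal ((?m s)\<^sup>2) + ennreal (4 * pi / \<delta>\<^sup>2 * (cmod (?c n))\<^sup>2)"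
      proof -
        have "ennreal (x * y + w) = ennreal x * ennreal y + ennreal w" if "0 \<le> x" "0 \<le> y" "0 \<le> w" for x y w :: real
          using that by (simp add: ennreal_plus ennreal_mult)
        then show ?thesis by this auto
      qed
      finally show ?thesis using True \<delta>(2) by (auto split: split_indicator)
    next
      case False
      then have "fourier_coeff (\<lambda>z. ?u (s, z)) n = 0" by (simp only: one_sided_control_slice(2)[OF hL e \<delta>(2)] if_False mult_zero_left)
      then show ?thesis by simp
    qed
    have coeff_meas: "(\<lambda>s. ennreal (2 * pi * (cmod (fourier_coeff (\<lambda>z. ?u (s, z)) n))\<^sup>2)) \<in> borel_measurable (lebesgue_on {0..T})"
      using slice_coeff_measurable[OF um, of n] by measurable
    have "(\<integral>\<^sup>+s. ennreal (2 * pi * (cmod (fourier_coeff (\<lambda>z. ?u (s, z)) n))\<^sup>2) \<partial>lebesgue_on {0..T})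
       = (\<integral>\<^sup>+s. ennreal (2 * pi * (cmod (fourier_coeff (\<lambda>z. ?u (s, z)) n))\<^sup>2) * indicator {0..T} s \<partial>lebesgue)"
      by (rule nn_integral_restrict_space) simp
    also have "\<dots> \<le> (\<integral>\<^sup>+s. ennreal (16 * pi * (cmod (?c n))\<^sup>2) * (ennreal ((?m s)\<^sup>2) * indicator {0<..1} s) + ennreal (4 * pi / \<delta>\<^sup>2 * (cmod (?c n))\<^sup>2) * indicator {0..\<delta>} s \<partial>lebesgue)"
      by (rule nn_integral_mono) (rule point)
    also have "\<dots> = (\<integral>\<^sup>+s. ennreal (16 * pi * (cmod (?c n))\<^sup>2) * (ennreal ((?m s)\<^sup>2) * indicator {0<..1} s) + ennreal (4 * pi / \<delta>\<^sup>2 * (cmod (?c n))\<^sup>2) * indicator {0..\<delta>} s \<partial>lborel)"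
      by (rule nn_integral_completion)
    also have "\<dots> = ennreal (16 * pi * (cmod (?c n))\<^sup>2) * (\<integral>\<^sup>+s. ennreal ((?m s)\<^sup>2) * indicator {0<..1} s \<partial>lborel) + ennreal (4 * pi / \<delta>\<^sup>2 * (cmod (?c n))\<^sup>2) * ennreal \<delta>"
      using \<delta>(1) by (subst nn_integral_add) (auto simp: nn_integral_cmult)
    also have "\<dots> \<le> ennreal (16 * pi * (cmod (?c n))\<^sup>2) * ennreal (5 * ?N) + ennreal (4 * pi / \<delta>\<^sup>2 * (cmod (?c n))\<^sup>2) * ennreal \<delta>"
      by (intro add_right_mono mult_left_mono nn_integral_min_square_le) auto
    also have "\<dots> = ennreal (80 * pi) * ennreal (?N * (cmod (?c n))\<^sup>2) + ennreal (4 * pi / \<delta>) * ennreal ((cmod (?c n))\<^sup>2)"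
    proof -
      have "ennreal (16 * pi * (cmod (?c n))\<^sup>2) * ennreal (5 * ?N) = ennreal (80 * pi) * ennreal (?N * (cmod (?c n))\<^sup>2)"
        by (simp add: mult_ac flip: ennreal_mult)
      moreover have "ennreal (4 * pi / \<delta>\<^sup>2 * (cmod (?c n))\<^sup>2) * ennreal \<delta> = ennreal (4 * pi / \<delta>) * ennreal ((cmod (?c n))\<^sup>2)"
        using \<delta>(1) by (simp add: power2_eq_square flip: ennreal_mult)
      ultimately show ?thesis by simp
    qed
    finally show ?thesis .
  qed
  have "(\<integral>\<^sup>+p. ennreal ((cmod (?u p))\<^sup>2) \<partial>space_time T) = (\<integral>\<^sup>+s. (\<integral>\<^sup>+z. ennreal ((cmod (?u (s, z)))\<^sup>2) \<partial>circle) \<partial>lebesgue_on {0..T})"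
    by (rule circle.nn_integral_fst[symmetric]) measurable
  also have "\<dots> = (\<integral>\<^sup>+n. (\<integral>\<^sup>+s. ennreal (2 * pi * (cmod (fourier_coeff (\<lambda>z. ?u (s, z)) n))\<^sup>2) \<partial>lebesgue_on {0..T}) \<partial>count_space UNIV)"
    by (rule parseval_tonelli[OF one_sided_control_slice(1)[OF hL e \<delta>(2)] slice_coeff_measurable[OF um]])
  also have "\<dots> \<le> (\<integral>\<^sup>+n. ennreal (80 * pi) * ennreal (of_int \<bar>n\<bar> * (cmod (?c n))\<^sup>2) + ennreal (4 * pi / \<delta>) * ennreal ((cmod (?c n))\<^sup>2) \<partial>count_space UNIV)"
    by (rule nn_integral_mono) (rule coeff_int)
  also have "\<dots> = ennreal (80 * pi) * ennreal S + ennreal (4 * pi / \<delta>) * ennreal S'"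
    using has_sum_nn_integral_count_space[OF S] has_sum_nn_integral_count_space[OF S']
    by (simp add: nn_integral_add nn_integral_cmult)
  also have "\<dots> < \<infinity>" by (simp add: ennreal_mult_less_top)
  finally show ?thesis using um by (simp add: L2_def integrable_iff_bounded)
qed

lemma one_sided_control_moment:
  assumes h: "h \<in> L2 circle" and e: "\<epsilon> = 1 \<or> \<epsilon> = -1" and \<delta>: "0 < \<delta>" "\<delta> \<le> 1" "\<delta> \<le> T"
  shows "control_moment T (one_sided_control \<epsilon> \<delta> h) n = - fourier_coeff h n"
proof -
  have "control_moment T (one_sided_control \<epsilon> \<delta> h) n = (\<integral>s. complex_of_real (exp (of_int n * s)) * (if 0 < s \<and> s \<le> \<delta> then control_coeff \<epsilon> \<delta> n s else 0) * fourier_coeff h n \<partial>lebesgue_on {0..T})"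
    unfolding control_moment_def one_sided_control_slice(2)[OF h e \<delta>(2)] mult.assoc ..
  also have "\<dots> = - 1 * fourier_coeff h n"
    unfolding integral_mult_left_zero control_coeff_integral[OF e \<delta>(1,3)] ..
  finally show ?thesis by simp
qed

lemma one_sided_control_support:
  assumes "\<And>\<sigma>. 0 \<le> \<sigma> \<Longrightarrow> \<sigma> \<le> \<delta> \<Longrightarrow> h (z * cis (- \<epsilon> * \<sigma>)) = 0"
  shows "one_sided_control \<epsilon> \<delta> h (s, z) = 0"
proof (cases "0 < s \<and> s \<le> \<delta>")
  case True
  have "window_integral \<epsilon> h s z = (\<integral>\<sigma>. 0 \<partial>(lborel :: real measure))"
    unfolding window_integral_def using assms True
    by (intro Bochner_Integration.integral_cong) (auto split: split_indicator)
  then show ?thesis using assms[of 0] assms[of s] True by (simp add: one_sided_control_def)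
next
  case False
  then show ?thesis by (auto simp: one_sided_control_def)
qed

section \<open>Null controllability of projections\<close>

lemma AE_circle_neq: "AE z in circle. z \<noteq> cis t"
proof -
  have [measurable]: "{cis t} \<in> sets circle"
    by (auto simp: sets_circle sets_restrict_space)
  have "emeasure circle {cis t} = (\<integral>\<^sup>+z. indicator {cis t} z \<partial>circle)" by simp
  also have "\<dots> = (\<integral>\<^sup>+x. indicator {cis t} (cis x) * indicator {0..<2*pi} x \<partial>lborel)"
    by (rule nn_integral_circle) measurable
  also have "\<dots> = 0"
  proof -
    have "{x. cis x = cis t} \<subseteq> range (\<lambda>n::int. t + 2 * pi * n)"
    proof
      fix x assume "x \<in> {x. cis x = cis t}"
      then have "sin x = sin t \<and> cos x = cos t" by (auto simp: complex_eq_iff)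
      then show "x \<in> range (\<lambda>n::int. t + 2 * pi * n)" by (auto simp: sin_cos_eq_iff)
    qed
    then have "countable {x. cis x = cis t}" by (rule countable_subset) auto
    then have "{x. cis x = cis t} \<in> null_sets lborel" by (rule countable_imp_null_set_lborel)
    then have "AE x in lborel. x \<notin> {x. cis x = cis t}" by (rule AE_not_in)
    then have "AE x in lborel. indicator {cis t} (cis x) * indicator {0..<2*pi} x = (0::ennreal)"
      by eventually_elim auto
    then show ?thesis by (subst nn_integral_0_iff_AE) auto
  qed
  finally have "{cis t} \<in> null_sets circle" by auto
  from AE_not_in[OF this] show ?thesis by simp
qed

lemma arc_closure_subset: "closure (cis ` {a<..<b}) \<subseteq> cis ` {a..b}"
proof (rule closure_minimal)
  show "closed (cis ` {a..b})"
    by (intro compact_imp_closed compact_continuous_image continuous_intros) auto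
qed auto

text \<open>An open interval is a countable union of compact ones, whose images are compact and
  hence Borel.\<close>

lemma arc_sets_circle: "cis ` {a<..<b} \<in> sets circle"
proof -
  have "{a<..<b} = (\<Union>n. {a + 1 / real (Suc n)..b - 1 / real (Suc n)})"
  proof (intro equalityI subsetI)
    fix x assume x: "x \<in> {a<..<b}"
    then obtain n where n: "1 / real (Suc n) < min (x - a) (b - x)"
      using nat_approx_posE[of "min (x - a) (b - x)"] by auto
    then show "x \<in> (\<Union>n. {a + 1 / real (Suc n)..b - 1 / real (Suc n)})"
      by (intro UN_I[of n]) auto
  next
    fix x assume "x \<in> (\<Union>n. {a + 1 / real (Suc n)..b - 1 / real (Suc n)})"
    then obtain n where n: "a + 1 / real (Suc n) \<le> x" "x \<le> b - 1 / real (Suc n)" by auto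
    have "0 < 1 / real (Suc n)" by simp
    then show "x \<in> {a<..<b}" using n unfolding greaterThanLessThan_iff by linarith
  qed
  then have eq: "cis ` {a<..<b} = (\<Union>n. cis ` {a + 1 / real (Suc n)..b - 1 / real (Suc n)})" by (metis image_UN)
  have "cis ` {c..d} \<in> sets borel" for c d
    by (intro borel_closed compact_imp_closed compact_continuous_image continuous_intros) auto
  then have "cis ` {a<..<b} \<in> sets borel" unfolding eq by (intro sets.countable_UN) auto
  moreover have "cis ` {a<..<b} = sphere 0 1 \<inter> cis ` {a<..<b}" by auto
  ultimately show ?thesis unfolding sets_circle sets_restrict_space by blast
qed

text \<open>Each point off the support has a neighbourhood on which \<open>g\<close> vanishes almost
  everywhere. Lindelof's theorem leaves countably many of them, so that the exceptional null sets
  can be united.\<close>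

lemma ess_support_vanishing:
  assumes "ess_support g \<subseteq> closure \<omega>"
  shows "AE z in circle. z \<notin> closure \<omega> \<longrightarrow> g z = 0"
proof -
  define \<F> where "\<F> = {U. open U \<and> (AE w in circle. w \<in> U \<longrightarrow> g w = 0)}"
  obtain \<F>' where \<F>': "\<F>' \<subseteq> \<F>" "countable \<F>'" "\<Union>\<F>' = \<Union>\<F>"
    by (rule Lindelof[of \<F>]) (auto simp: \<F>_def)
  have "AE z in circle. \<forall>U\<in>\<F>'. z \<in> U \<longrightarrow> g z = 0"
    using \<F>' by (subst AE_ball_countable) (auto simp: \<F>_def)
  then show ?thesis
    using AE_space
  proof eventually_elim
    case (elim z)
    show ?case
    proof
      assume "z \<notin> closure \<omega>"
      then have "z \<notin> ess_support g" using assms by auto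
      then have "z \<in> \<Union>\<F>" using elim(2) by (auto simp: ess_support_def \<F>_def)
      then obtain U where "U \<in> \<F>'" "z \<in> U" using \<F>'(3) by auto
      then show "g z = 0" using elim(1) by auto
    qed
  qed
qed

text \<open>The criterion \<open>has_L2_bochner_integralI\<close> identifies the integral by its
  coefficients. For n >= 0 this is the moment condition; for n < 0 both sides vanish because
  \<open>f\<close> is in \<open>H2\<close>. Slices are taken square-integrable at every time, since
  the criterion asks this of every \<open>s\<close>.\<close>

lemma null_control_final_state:
  assumes v: "v \<in> L2 (space_time T)" and slice: "\<And>s. (\<lambda>z. v (s, z)) \<in> L2 circle"
    and T: "0 < T" and f: "f \<in> H2"
    and moment: "\<And>n. 0 \<le> n \<Longrightarrow> control_moment T v n = - fourier_coeff f n"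
  shows "has_L2_bochner_integral (lebesgue_on {0..T}) (\<lambda>s. absD_semigroup (T - s) (riesz_proj (\<lambda>z. v (s, z))))
      (\<lambda>z. - absD_semigroup T f z)"
proof -
  interpret time: finite_measure "lebesgue_on {0..T}" by (rule finite_measure_time)
  have fL: "f \<in> L2 circle" using f by (simp add: H2_def)
  note S = absD_semigroup_L2[OF fL less_imp_le[OF T]]
  let ?G = "\<lambda>s. absD_semigroup (T - s) (riesz_proj (\<lambda>z. v (s, z)))"
  let ?\<phi> = "\<lambda>n s. fourier_coeff (\<lambda>z. v (s, z)) n"
  have G: "?G s \<in> L2 circle"
    and Gc: "fourier_coeff (?G s) n = (if 0 \<le> n then complex_of_real (exp (- of_int n * T) * exp (of_int n * s)) * ?\<phi> n s else 0)"
    if "s \<in> space (lebesgue_on {0..T})" for s n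
  proof -
    have t: "0 \<le> T - s" using that by simp
    note R = riesz_proj_L2[OF slice[of s]] and A = absD_semigroup_L2[OF riesz_proj_L2(1)[OF slice[of s]] t]
    show "?G s \<in> L2 circle" by (rule A(1))
    show "fourier_coeff (?G s) n = (if 0 \<le> n then complex_of_real (exp (- of_int n * T) * exp (of_int n * s)) * ?\<phi> n s else 0)"
      by (simp add: A(2) R(2) algebra_simps flip: exp_add of_real_mult)
  qed
  have \<phi>_meas[measurable]: "?\<phi> n \<in> borel_measurable (lebesgue_on {0..T})" for n
    by (rule slice_coeff_measurable[OF L2D(1)[OF v]])
  have Gm: "(\<lambda>s. fourier_coeff (?G s) n) \<in> borel_measurable (lebesgue_on {0..T})" for n
  proof (subst measurable_cong[OF Gc], assumption, cases "0 \<le> n")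
    case True
    have "(\<lambda>s. complex_of_real (exp (- of_int n * T) * exp (of_int n * s))) \<in> borel_measurable (lebesgue_on {0..T})"
      by (intro measurable_restrict_space1 measurable_completion) simp
    then show "(\<lambda>s. if 0 \<le> n then complex_of_real (exp (- of_int n * T) * exp (of_int n * s)) * ?\<phi> n s else 0) \<in> borel_measurable (lebesgue_on {0..T})"
      using True by simp
  qed simp
  show ?thesis
  proof (rule time.has_L2_bochner_integralI[OF G _ Gm])
    show "integrable (lebesgue_on {0..T}) (\<lambda>s. \<integral>z. (cmod (?G s z))\<^sup>2 \<partial>circle)"
    proof (rule Bochner_Integration.integrable_bound[OF space_time_slice(2)[OF v]])
      show "(\<lambda>s. \<integral>z. (cmod (?G s z))\<^sup>2 \<partial>circle) \<in> borel_measurable (lebesgue_on {0..T})"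
      \<comment> \<open>The norm of a slice is measurable in time as the limit of its Parseval
        sums.\<close>
      proof (rule borel_measurable_LIMSEQ_real)
        show "(\<lambda>N. \<Sum>n\<in>{- int N..int N}. 2 * pi * (cmod (fourier_coeff (?G s) n))\<^sup>2) \<longlonglongrightarrow> (\<integral>z. (cmod (?G s z))\<^sup>2 \<partial>circle)"
          if "s \<in> space (lebesgue_on {0..T})" for s
          by (rule parseval_limit[OF G[OF that]])
        show "(\<lambda>s. \<Sum>n\<in>{- int N..int N}. 2 * pi * (cmod (fourier_coeff (?G s) n))\<^sup>2) \<in> borel_measurable (lebesgue_on {0..T})" for N
          using Gm by measurable
      qed
      show "AE s in lebesgue_on {0..T}. norm (\<integral>z. (cmod (?G s z))\<^sup>2 \<partial>circle) \<le> norm (\<integral>z. (cmod (v (s, z)))\<^sup>2 \<partial>circle)"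
      proof (rule AE_I2)
        fix s assume s: "s \<in> space (lebesgue_on {0..T})"
        have "(\<integral>z. (cmod (?G s z))\<^sup>2 \<partial>circle) \<le> (\<integral>z. (cmod (v (s, z)))\<^sup>2 \<partial>circle)"
        proof (rule has_sum_mono[OF fourier_parseval[OF G[OF s]] fourier_parseval[OF slice[of s]]])
          fix n :: int
          have "cmod (fourier_coeff (?G s) n) \<le> cmod (?\<phi> n s)"
          proof (cases "0 \<le> n")
            case True
            have "of_int n * s \<le> of_int n * T" using s True by (intro mult_left_mono) auto
            then have "exp (- of_int n * T) * exp (of_int n * s) \<le> 1" by (simp flip: exp_add)
            then show ?thesis using True by (simp add: Gc[OF s] norm_mult mult_left_le_one_le)
          qed (simp add: Gc[OF s])
          then show "2 * pi * (cmod (fourier_coeff (?G s) n))\<^sup>2 \<le> 2 * pi * (cmod (?\<phi> n s))\<^sup>2"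
            by (intro mult_left_mono power_mono) auto
        qed
        then show "norm (\<integral>z. (cmod (?G s z))\<^sup>2 \<partial>circle) \<le> norm (\<integral>z. (cmod (v (s, z)))\<^sup>2 \<partial>circle)" by simp
      qed
    qed
    show "(\<lambda>z. - absD_semigroup T f z) \<in> L2 circle" using L2_cmult[OF S(1), of "-1"] by simp
    show "fourier_coeff (\<lambda>z. - absD_semigroup T f z) n = (\<integral>s. fourier_coeff (?G s) n \<partial>lebesgue_on {0..T})" for n
    proof -
      have l: "fourier_coeff (\<lambda>z. - absD_semigroup T f z) n = - (complex_of_real (exp (- of_int \<bar>n\<bar> * T)) * fourier_coeff f n)"
        using fourier_coeff_cmult[of "-1" "absD_semigroup T f" n] by (simp add: S(2))
      show ?thesis
      proof (cases "0 \<le> n")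
        case True
        have "(\<integral>s. fourier_coeff (?G s) n \<partial>lebesgue_on {0..T}) = (\<integral>s. complex_of_real (exp (- of_int n * T)) * (complex_of_real (exp (of_int n * s)) * ?\<phi> n s) \<partial>lebesgue_on {0..T})"
          by (rule Bochner_Integration.integral_cong[OF refl]) (simp add: Gc True mult.assoc)
        also have "\<dots> = complex_of_real (exp (- of_int n * T)) * control_moment T v n"
          by (simp add: control_moment_def)
        finally show ?thesis using True by (simp add: l moment)
      next
        case False
        have "(\<integral>s. fourier_coeff (?G s) n \<partial>lebesgue_on {0..T}) = (\<integral>s. 0 \<partial>lebesgue_on {0..T})"
          by (rule Bochner_Integration.integral_cong[OF refl]) (simp add: Gc False)
        then show ?thesis using False by (simp add: l H2_fourier_coeff_neg[OF f])
      qed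
    qed
  qed
qed

lemma projection_imp_null_controllable:
  assumes ab: "0 < b - a" "b - a < 2 * pi" and \<omega>: "\<omega> = cis ` {a<..<b}" and T: "0 < T"
    and f: "f\<^sub>0 \<in> H2"
    and g: "g \<in> sobolev_half" "ess_support g \<subseteq> closure \<omega>" "AE z in circle. f\<^sub>0 z = riesz_proj g z"
  shows "f\<^sub>0 \<in> NC_H2 \<omega> T"
proof -
  define p where "p = cis b"
  have \<omega>_sets: "\<omega> \<in> sets circle" unfolding \<omega> by (rule arc_sets_circle)
  have gL: "g \<in> L2 circle" using g(1) by (simp add: sobolev_half_def)
  have fL: "f\<^sub>0 \<in> L2 circle" using f by (simp add: H2_def)
  \<comment> \<open>Two distinct end points let one cut-off be 0 near one of them and 1 near the
    other.\<close>
  have "cis a \<noteq> p"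
  proof
    assume "cis a = p"
    then have "sin a = sin b \<and> cos a = cos b" by (auto simp: p_def complex_eq_iff)
    then obtain k :: int where k: "a = b + 2 * pi * k" by (auto simp: sin_cos_eq_iff)
    then have "2 * pi * real_of_int (- k) < 2 * pi * 1" "2 * pi * 0 < 2 * pi * real_of_int (- k)" using ab by auto
    then have "real_of_int (- k) < 1" "0 < real_of_int (- k)"
      by (simp_all only: mult_less_cancel_left_pos mult_pos_pos zero_less_numeral pi_gt_zero)
    then show False unfolding of_int_less_1_iff of_int_0_less_iff by linarith
  qed
  \<comment> \<open>The cut-off rises from 0 to 1 between distances d and 2 d from \<open>p\<close>;
    one third of the chord leaves another d before the other end point.\<close>
  define d where "d = min (cmod (cis a - p) / 3) 1"
  have d: "0 < d" "3 * d \<le> cmod (cis a - p)" using \<open>cis a \<noteq> p\<close> by (auto simp: d_def)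
  \<comment> \<open>\<open>\<delta> \<le> d\<close> keeps shifted supports within the arc,
    \<open>\<delta> \<le> 1\<close> is the range of the shift estimates, and
    \<open>\<delta> \<le> T\<close> lets the control finish in time.\<close>
  define \<delta> where "\<delta> = min d (min 1 T)"
  have \<delta>: "0 < \<delta>" "\<delta> \<le> 1" "\<delta> \<le> T" "\<delta> \<le> d" using d T by (auto simp: \<delta>_def)
  \<comment> \<open>\<open>\<theta>\<close> vanishes near \<open>p = e\<^sup>i\<^sup>b\<close>, and \<open>1 - \<theta>\<close> vanishes near \<open>e\<^sup>i\<^sup>a\<close>.\<close>
  define \<theta> where "\<theta> z = max 0 (min 1 (cmod (z - p) / d - 1))" for z
  have \<theta>01: "0 \<le> \<theta> z" "\<theta> z \<le> 1" for z by (auto simp: \<theta>_def)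
  have \<theta>_lip: "\<bar>\<theta> z - \<theta> w\<bar> \<le> (1 / d) * cmod (z - w)" for z w
  proof -
    have "\<bar>\<theta> z - \<theta> w\<bar> \<le> \<bar>(cmod (z - p) / d - 1) - (cmod (w - p) / d - 1)\<bar>" unfolding \<theta>_def by linarith
    also have "\<dots> = (1 / d) * \<bar>cmod (z - p) - cmod (w - p)\<bar>" using d by (simp add: abs_divide flip: diff_divide_distrib)
    also have "\<dots> \<le> (1 / d) * cmod (z - w)"
      using norm_triangle_ineq3[of "z - p" "w - p"] d by (intro mult_left_mono) auto
    finally show ?thesis .
  qed
  have \<theta>_meas: "\<theta> \<in> borel_measurable circle"
    by (rule continuous_imp_measurable_circle) (unfold \<theta>_def[abs_def], intro continuous_intros, use d in auto)
  define K where "K = closure \<omega>"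
  have K_meas: "Measurable.pred circle (\<lambda>z. z \<in> K)"
    using borel_measurable_circleI[of "\<lambda>z. z"] by (intro pred_sets2[where N=borel]) (auto simp: K_def)
  have K_arc: "K \<subseteq> cis ` {a..b}" unfolding K_def \<omega> by (rule arc_closure_subset)
  have vanish: "AE z in circle. z \<notin> K \<longrightarrow> g z = 0"
    unfolding K_def by (rule ess_support_vanishing[OF g(2)])
  \<comment> \<open>The representative \<open>h\<close> is set to 0 everywhere off the closed arc:
    \<open>g\<close> vanishes there only almost everywhere, while the support argument below
    evaluates \<open>h\<close> along single windows.\<close>
  have cut: "\<exists>h. h \<in> sobolev_half \<and> (\<forall>n. fourier_coeff h n = fourier_coeff (\<lambda>z. \<kappa> z * g z) n) \<and> (\<forall>z. h z \<noteq> 0 \<longrightarrow> z \<in> K \<and> \<kappa> z \<noteq> 0) \<and> (\<lambda>z. \<kappa> z * g z) \<in> L2 circle"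
    if \<kappa>: "\<kappa> \<in> borel_measurable circle" "\<And>z. cmod z = 1 \<Longrightarrow> cmod (\<kappa> z) \<le> 1"
      "\<And>z w. cmod z = 1 \<Longrightarrow> cmod w = 1 \<Longrightarrow> cmod (\<kappa> z - \<kappa> w) \<le> (1 / d) * cmod (z - w)" for \<kappa> :: "complex \<Rightarrow> complex"
  proof -
    have sob: "(\<lambda>z. \<kappa> z * g z) \<in> sobolev_half"
      by (rule sobolev_half_mult_lipschitz[OF g(1) \<kappa>]) (use d in auto)
    then have L: "(\<lambda>z. \<kappa> z * g z) \<in> L2 circle" by (simp add: sobolev_half_def)
    define h where "h z = (if z \<in> K then \<kappa> z * g z else 0)" for z
    have hm: "h \<in> borel_measurable circle"
      unfolding h_def[abs_def] using L2D(1)[OF L] K_meas by measurable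
    have ae: "AE z in circle. h z = \<kappa> z * g z" using vanish by eventually_elim (auto simp: h_def)
    have hc: "fourier_coeff h n = fourier_coeff (\<lambda>z. \<kappa> z * g z) n" for n
      by (rule fourier_coeff_cong_AE[OF hm L2D(1)[OF L] ae])
    have hL: "h \<in> L2 circle"
    proof -
      have "(\<lambda>z. (if z \<in> K then 1 else 0) * (\<kappa> z * g z)) \<in> L2 circle"
        using K_meas by (intro L2_mult_bounded[OF L, where C=1]) auto
      moreover have "(\<lambda>z. (if z \<in> K then 1 else 0) * (\<kappa> z * g z)) = h" by (auto simp: h_def)
      ultimately show ?thesis by simp
    qed
    have "h \<in> sobolev_half" using hL sob by (simp add: sobolev_half_def hc)
    then show ?thesis using hc L by (intro exI[of _ h]) (auto simp: h_def)
  qed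
  obtain h1 where h1: "h1 \<in> sobolev_half" "\<And>n. fourier_coeff h1 n = fourier_coeff (\<lambda>z. complex_of_real (\<theta> z) * g z) n"
    "\<And>z. h1 z \<noteq> 0 \<Longrightarrow> z \<in> K \<and> \<theta> z \<noteq> 0" "(\<lambda>z. complex_of_real (\<theta> z) * g z) \<in> L2 circle"
    using cut[of "\<lambda>z. complex_of_real (\<theta> z)"] \<theta>_meas \<theta>01 \<theta>_lip by (auto simp flip: of_real_diff)
  obtain h2 where h2: "h2 \<in> sobolev_half" "\<And>n. fourier_coeff h2 n = fourier_coeff (\<lambda>z. complex_of_real (1 - \<theta> z) * g z) n"
    "\<And>z. h2 z \<noteq> 0 \<Longrightarrow> z \<in> K \<and> 1 - \<theta> z \<noteq> 0" "(\<lambda>z. complex_of_real (1 - \<theta> z) * g z) \<in> L2 circle"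
  proof -
    have "cmod (complex_of_real (1 - \<theta> z) - complex_of_real (1 - \<theta> w)) \<le> (1 / d) * cmod (z - w)" for z w
      using \<theta>_lip[of z w] by (simp add: abs_minus_commute flip: of_real_diff)
    moreover have "cmod (complex_of_real (1 - \<theta> z)) \<le> 1" for z using \<theta>01[of z] by (simp only: norm_of_real)
    ultimately show thesis using cut[of "\<lambda>z. complex_of_real (1 - \<theta> z)"] \<theta>_meas that by auto
  qed
  have h1L: "h1 \<in> L2 circle" and h2L: "h2 \<in> L2 circle" using h1(1) h2(1) by (auto simp: sobolev_half_def)
  have hsum: "fourier_coeff h1 n + fourier_coeff h2 n = fourier_coeff g n" for n
  proof -
    have "fourier_coeff h1 n + fourier_coeff h2 n = fourier_coeff (\<lambda>z. complex_of_real (\<theta> z) * g z + complex_of_real (1 - \<theta> z) * g z) n"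
      unfolding h1(2) h2(2) by (rule fourier_coeff_add[symmetric]) (intro circle.L2_integrable h1(4) h2(4))+
    also have "(\<lambda>z. complex_of_real (\<theta> z) * g z + complex_of_real (1 - \<theta> z) * g z) = g" by (simp add: algebra_simps)
    finally show ?thesis .
  qed
  define u where "u q = one_sided_control 1 \<delta> h1 q + one_sided_control (-1) \<delta> h2 q" for q
  have chord: "cmod (cis x - cis y) \<le> \<bar>x - y\<bar>" for x y
  proof -
    have "cis x - cis y = cis y * (cis (x - y) - 1)" by (simp add: right_diff_distrib cis_mult)
    then show ?thesis using cmod_cis_diff_one_le[of "x - y"] by (simp add: norm_mult)
  qed
  have supp1: "one_sided_control 1 \<delta> h1 (s, z) = 0" if z: "z \<notin> cis ` {a..b}" for s z
  proof (rule one_sided_control_support, rule ccontr)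
    fix \<sigma> assume \<sigma>: "0 \<le> \<sigma>" "\<sigma> \<le> \<delta>" and nz: "h1 (z * cis (- 1 * \<sigma>)) \<noteq> 0"
    then obtain x where x: "a \<le> x" "x \<le> b" "z * cis (- \<sigma>) = cis x" using h1(3) K_arc by fastforce
    \<comment> \<open>Such a point is at chord distance more than d from \<open>p\<close>. A chord
      is no longer than its arc, so b - x >= d >= \<delta>, and a forward shift by \<sigma> stays in
      the arc.\<close>
    have "\<theta> (cis x) \<noteq> 0" using h1(3)[OF nz] x(3) by simp
    then have "1 < cmod (cis x - p) / d" by (auto simp: \<theta>_def max_def split: if_splits)
    then have "d \<le> cmod (cis x - p)" using d by (simp add: field_simps)
    also have "\<dots> \<le> b - x" using chord[of x b] x by (simp add: p_def)
    finally have "x + \<sigma> \<in> {a..b}" using x \<sigma> \<delta>(4) by auto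
    moreover have "z = cis (x + \<sigma>)"
    proof -
      have "z = (z * cis (- \<sigma>)) * cis \<sigma>" by (simp add: mult.assoc cis_mult)
      then show ?thesis by (simp add: x(3) cis_mult)
    qed
    ultimately show False using z by blast
  qed
  have supp2: "one_sided_control (-1) \<delta> h2 (s, z) = 0" if z: "z \<notin> cis ` {a..b}" for s z
  proof (rule one_sided_control_support, rule ccontr)
    fix \<sigma> assume \<sigma>: "0 \<le> \<sigma>" "\<sigma> \<le> \<delta>" and nz: "h2 (z * cis (- (- 1) * \<sigma>)) \<noteq> 0"
    then obtain x where x: "a \<le> x" "x \<le> b" "z * cis \<sigma> = cis x" using h2(3) K_arc by fastforce
    \<comment> \<open>The mirror image: now the distance to \<open>p\<close> is below 2 d, and the
      end points are at least 3 d apart, so there is room d towards \<open>cis a\<close>.\<close>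
    have "\<theta> (cis x) \<noteq> 1" using h2(3)[OF nz] x(3) by simp
    then have "cmod (cis x - p) / d < 2" by (auto simp: \<theta>_def max_def min_def split: if_splits)
    then have "cmod (cis x - p) < 2 * d" using d by (simp add: field_simps)
    moreover have "cmod (cis a - p) \<le> cmod (cis a - cis x) + cmod (cis x - p)"
      using norm_triangle_ineq[of "cis a - cis x" "cis x - p"] by simp
    moreover have "cmod (cis a - cis x) \<le> x - a" using chord[of a x] x by simp
    ultimately have "d \<le> x - a" using d(2) by linarith
    then have "x - \<sigma> \<in> {a..b}" using x \<sigma> \<delta>(4) by auto
    moreover have "z = cis (x - \<sigma>)"
    proof -
      have "z = (z * cis \<sigma>) * cis (- \<sigma>)" by (simp add: mult.assoc cis_mult)
      then show ?thesis by (simp add: x(3) cis_mult)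
    qed
    ultimately show False using z by blast
  qed
  \<comment> \<open>The supports lie in the closed arc, whereas controls live on the open one; the
    difference is two null points.\<close>
  have arc_ends: "AE z in circle. z \<in> cis ` {a..b} \<longrightarrow> z \<in> \<omega>"
    using AE_circle_neq[of a] AE_circle_neq[of b]
  proof eventually_elim
    case (elim z)
    then show ?case unfolding \<omega> by (auto simp: image_iff) (metis greaterThanLessThan_iff order_le_less)
  qed
  note L1 = one_sided_control_L2[OF h1(1), of 1 \<delta> T] and L2' = one_sided_control_L2[OF h2(1), of "-1" \<delta> T]
  have uL: "u \<in> L2 (space_time T)"
    unfolding u_def[abs_def] using L1 L2' \<delta> by (intro L2_add) auto
  have u_slice: "(\<lambda>z. u (s, z)) \<in> L2 circle" for s
    unfolding u_def using \<delta> by (intro L2_add one_sided_control_slice(1) h1L h2L) auto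
  \<comment> \<open>On each slice \<open>v\<close> differs from \<open>u\<close> at most at the end
    points, so coefficients agree, and extending \<open>v\<close> by zero off the arc leaves it
    unchanged.\<close>
  define v where "v q = (if snd q \<in> \<omega> then u q else 0)" for q
  have vL: "v \<in> L2 (space_time T)"
    using controls_extend(1)[OF \<omega>_sets, of u T] controls_extend(2)[OF \<omega>_sets uL] unfolding v_def[abs_def] by blast
  have \<omega>_pred: "Measurable.pred circle (\<lambda>z. z \<in> \<omega>)" using \<omega>_sets by measurable
  have v_slice: "(\<lambda>z. v (s, z)) \<in> L2 circle" for s
  proof -
    have "(\<lambda>z. (if z \<in> \<omega> then 1 else 0) * u (s, z)) \<in> L2 circle"
      using \<omega>_pred by (intro L2_mult_bounded[OF u_slice, where C=1]) auto
    moreover have "(\<lambda>z. (if z \<in> \<omega> then 1 else 0) * u (s, z)) = (\<lambda>z. v (s, z))" by (auto simp: v_def)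
    ultimately show ?thesis by simp
  qed
  have v_coeff: "fourier_coeff (\<lambda>z. v (s, z)) n = fourier_coeff (\<lambda>z. u (s, z)) n" for s n
  proof (rule fourier_coeff_cong_AE[OF L2D(1)[OF v_slice] L2D(1)[OF u_slice]])
    show "AE z in circle. v (s, z) = u (s, z)"
      using arc_ends by eventually_elim (use supp1 supp2 in \<open>auto simp: v_def u_def\<close>)
  qed
  have moment: "control_moment T v n = - fourier_coeff f\<^sub>0 n" if n: "0 \<le> n" for n
  proof -
    let ?w = "\<lambda>s. complex_of_real (exp (of_int n * s))"
    have uc: "fourier_coeff (\<lambda>z. u (s, z)) n = fourier_coeff (\<lambda>z. one_sided_control 1 \<delta> h1 (s, z)) n + fourier_coeff (\<lambda>z. one_sided_control (-1) \<delta> h2 (s, z)) n" for s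
      unfolding u_def using \<delta> by (intro fourier_coeff_add circle.L2_integrable one_sided_control_slice(1) h1L h2L) auto
    have int: "integrable (lebesgue_on {0..T}) (\<lambda>s. ?w s * fourier_coeff (\<lambda>z. q (s, z)) n)" if "q \<in> L2 (space_time T)" for q
      by (rule integrable_slice_coeff(2)[OF that _ exp_bounded_time]) auto
    have "control_moment T v n = control_moment T (one_sided_control 1 \<delta> h1) n + control_moment T (one_sided_control (-1) \<delta> h2) n"
      unfolding control_moment_def v_coeff uc distrib_left
      using L1 L2' \<delta> by (intro Bochner_Integration.integral_add int) auto
    also have "\<dots> = - fourier_coeff g n"
      using \<delta> by (simp add: one_sided_control_moment[OF h1L] one_sided_control_moment[OF h2L] flip: hsum)
    also have "fourier_coeff g n = fourier_coeff f\<^sub>0 n"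
      using fourier_coeff_cong_AE[OF L2D(1)[OF fL] L2D(1)[OF riesz_proj_L2(1)[OF gL]] g(3), of n] n
      by (simp add: riesz_proj_L2(2)[OF gL])
    finally show ?thesis .
  qed
  have B: "has_L2_bochner_integral (lebesgue_on {0..T}) (\<lambda>s. absD_semigroup (T - s) (riesz_proj (\<lambda>z. v (s, z)))) (\<lambda>z. - absD_semigroup T f\<^sub>0 z)"
    by (rule null_control_final_state[OF vL v_slice T f moment])
  have "(\<lambda>z. if z \<in> \<omega> then v (s, z) else 0) = (\<lambda>z. v (s, z))" for s by (auto simp: v_def)
  then have "H2_final_state \<omega> T f\<^sub>0 v (\<lambda>z. 0)"
    unfolding H2_final_state_def using B by (intro exI[of _ "\<lambda>z. - absD_semigroup T f\<^sub>0 z"]) simp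
  moreover have "v \<in> controls \<omega> T" by (rule controls_extend(2)[OF \<omega>_sets vL])
  ultimately show ?thesis using f unfolding NC_H2_def by blast
qed

theorem corollary1p9:
  fixes \<omega> :: "complex set" and T :: real and f\<^sub>0 :: "complex \<Rightarrow> complex"
  assumes "open_strict_interval \<omega>"
    and "T > 0"
    and "f\<^sub>0 \<in> H2 \<inter> sobolev_half"
  shows "f\<^sub>0 \<in> NC_H2 \<omega> T \<longleftrightarrow>
    (\<exists>g \<in> L2 circle.
       ess_support g \<subseteq> closure \<omega> \<and>
       g \<in> sobolev_half \<and>
       (AE z in circle. f\<^sub>0 z = riesz_proj g z))"
proof -
  obtain a b where ab: "0 < b - a" "b - a < 2 * pi" and \<omega>: "\<omega> = cis ` {a<..<b}"
    using assms(1) by (auto simp: open_strict_interval_def)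
  have \<omega>_sets: "\<omega> \<in> sets circle" unfolding \<omega> by (rule arc_sets_circle)
  show ?thesis
    using null_controllable_imp_projection[OF \<omega>_sets assms(2), of f\<^sub>0]
      projection_imp_null_controllable[OF ab \<omega> assms(2), of f\<^sub>0] assms(3) by blast
qed

end
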